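(* There exist universal constants $c,C,C'>0$ such that the following holds. Let $N,M,Z\in\mathbb{R}^{m\times m}$ be deterministic symmetric matrices with $N=M+Z$, where $M$ has rank $K$ with nonzero eigenvalues $\lambda_1(M)\ge\cdots\ge\lambda_K(M)>0$, and let $V\in\mathbb{R}^{m\times K}$ consist of its first $K$ (orthonormal) eigenvectors. Assume $$\max_{1\le j\le m}\|e_j^TV\|_2^2\cdot\frac{\lambda_1(M)}{\lambda_K(M)}\le c\qquad\text{and}\qquad\|\Gamma(Z)\|_F\le c\sqrt K\,\lambda_K(M).$$ Then the output $\widehat V$ of $\mathrm{HeteroPCA}(N,K,T)$ with $T\ge C\left(1\vee\log\frac{\sqrt K\lambda_K(M)}{\|\Gamma(Z)\|_F}\right)$ satisfies $$\|\sin\Theta(\widehat V,V)\|_F\le C'\left(\frac{\|\Gamma(Z)\|_F}{\lambda_K(M)}\wedge\sqrt K\right).$$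
   Context: Notation. $e_1,\dots,e_m$ is the canonical basis of $\mathbb{R}^m$; $a\vee b=\max(a,b)$, $a\wedge b=\min(a,b)$. For a square matrix $D$, $G(D)$ is the diagonal matrix with the same diagonal entries as $D$, and $\Gamma(D)=D-G(D)$ is its off-diagonal part. $\sin\Theta(\widehat V,V):=\widehat V_\perp^TV$, where $\widehat V_\perp\in\mathbb{R}^{m\times(m-K)}$ is such that $[\widehat V,\widehat V_\perp]$ is an orthogonal matrix. $\|\cdot\|_F$ is the Frobenius norm. Algorithm $\mathrm{HeteroPCA}(S,r,T)$ for a symmetric $S\in\mathbb{R}^{m\times m}$: set $N^{(0)}_{ij}=S_{ij}$ for $i\ne j$ and $N^{(0)}_{ii}=0$. For $t=0,1,\dots,T$: compute the singular value decomposition $N^{(t)}=\sum_i\lambda_i^{(t)}u_i^{(t)}(v_i^{(t)})^T$ with $\lambda_1^{(t)}\ge\lambda_2^{(t)}\ge\cdots\ge0$; let $\widetilde N^{(t)}=\sum_{i=1}^r\lambda_i^{(t)}u_i^{(t)}(v_i^{(t)})^T$; set $N^{(t+1)}_{ij}=S_{ij}$ for $i\ne j$ and $N^{(t+1)}_{ii}=\widetilde N^{(t)}_{ii}$. Output $U^{(T)}=[u_1^{(T)},\dots,u_r^{(T)}]$. *)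

theory Defs
  imports
    "HOL-Library.Extended_Real"
    "Jordan_Normal_Form.DL_Rank"
    "Jordan_Normal_Form.Char_Poly"
begin

text \<open>
  Matrices are those of \<open>Jordan_Normal_Form\<close>, so that dimensions are ordinary natural
  numbers and universal constants can be quantified before them. Rows and columns are
  numbered from 0.
\<close>

definition frob_norm :: "real mat \<Rightarrow> real" where
  "frob_norm A = sqrt (\<Sum>i<dim_row A. \<Sum>j<dim_col A. (A $$ (i, j))\<^sup>2)"

definition l2_norm :: "real vec \<Rightarrow> real" where
  "l2_norm v = sqrt (v \<bullet> v)"

definition diag_part :: "real mat \<Rightarrow> real mat" where
  "diag_part D = mat (dim_row D) (dim_col D) (\<lambda>(i, j). if i = j then D $$ (i, j) else 0)"

definition off_diag :: "real mat \<Rightarrow> real mat" where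
  "off_diag D = D - diag_part D"

definition orthonormal_cols :: "real mat \<Rightarrow> bool" where
  "orthonormal_cols A \<longleftrightarrow> transpose_mat A * A = 1\<^sub>m (dim_col A)"

text \<open>The library predicate \<^const>\<open>orthogonal_mat\<close> does not require columns of norm 1.\<close>

definition orthogonal_matrix :: "real mat \<Rightarrow> bool" where
  "orthogonal_matrix A \<longleftrightarrow> square_mat A \<and> orthonormal_cols A"

text \<open>The \<open>i\<close>-th largest real eigenvalue, \<open>i \<ge> 1\<close>, counted with algebraic multiplicity.\<close>

definition eigval :: "real mat \<Rightarrow> nat \<Rightarrow> real" where
  "eigval A i = rev (sorted_list_of_multiset (proots (char_poly A))) ! (i - 1)"

text \<open>The columns of \<open>V\<close> are orthonormal eigenvectors for the \<open>K\<close> largest eigenvalues.\<close>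

definition leading_eigenvectors :: "real mat \<Rightarrow> nat \<Rightarrow> real mat \<Rightarrow> bool" where
  "leading_eigenvectors A K V \<longleftrightarrow>
     V \<in> carrier_mat (dim_row A) K \<and> orthonormal_cols V \<and>
     (\<forall>i<K. eigenvector A (col V i) (eigval A (i + 1)))"

text \<open>
  The set of all matrices \<open>Vp\<^sup>T V\<close> where \<open>[Vh, Vp]\<close> is orthogonal; the completion \<open>Vp\<close> is
  not unique, but the Frobenius norm of \<open>Vp\<^sup>T V\<close> does not depend on its choice.
\<close>

definition sin_theta :: "real mat \<Rightarrow> real mat \<Rightarrow> real mat set" where
  "sin_theta Vh V =
     {transpose_mat Vp * V | Vp.
        Vp \<in> carrier_mat (dim_row Vh) (dim_row Vh - dim_col Vh) \<and>
        orthogonal_matrix (mat_of_cols (dim_row Vh) (cols Vh @ cols Vp))}"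

text \<open>The partial sum \<open>\<Sum>k<r. s\<^sub>k u\<^sub>k w\<^sub>k\<^sup>T\<close>, with \<open>u\<^sub>k\<close>, \<open>w\<^sub>k\<close> the columns of \<open>U\<close>, \<open>W\<close>.\<close>

definition svd_sum :: "nat \<Rightarrow> real mat \<Rightarrow> (nat \<Rightarrow> real) \<Rightarrow> real mat \<Rightarrow> real mat" where
  "svd_sum r U s W =
     mat (dim_row U) (dim_row W) (\<lambda>(i, j). \<Sum>k<r. s k * U $$ (i, k) * W $$ (j, k))"

definition is_svd :: "nat \<Rightarrow> real mat \<Rightarrow> real mat \<Rightarrow> (nat \<Rightarrow> real) \<Rightarrow> real mat \<Rightarrow> bool" where
  "is_svd m A U s W \<longleftrightarrow>
     U \<in> carrier_mat m m \<and> orthogonal_matrix U \<and>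
     W \<in> carrier_mat m m \<and> orthogonal_matrix W \<and>
     (\<forall>k<m. 0 \<le> s k) \<and> (\<forall>k l. k \<le> l \<and> l < m \<longrightarrow> s l \<le> s k) \<and>
     A = svd_sum m U s W"

text \<open>
  A singular value decomposition is not unique, so the algorithm is a relation: any
  decomposition may be used in any step. \<open>hetero_iterate S r t N\<close> means that \<open>N\<close> is a
  possible value of the \<open>t\<close>-th iterate.
\<close>

inductive hetero_iterate :: "real mat \<Rightarrow> nat \<Rightarrow> nat \<Rightarrow> real mat \<Rightarrow> bool"
  for S :: "real mat" and r :: nat where
  init: "hetero_iterate S r 0
           (mat (dim_row S) (dim_row S) (\<lambda>(i, j). if i = j then 0 else S $$ (i, j)))"
| step: "hetero_iterate S r t N \<Longrightarrow> is_svd (dim_row S) N U s W \<Longrightarrow>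
         hetero_iterate S r (Suc t)
           (mat (dim_row S) (dim_row S)
              (\<lambda>(i, j). if i = j then svd_sum r U s W $$ (i, i) else S $$ (i, j)))"

definition heteroPCA_output :: "real mat \<Rightarrow> nat \<Rightarrow> nat \<Rightarrow> real mat \<Rightarrow> bool" where
  "heteroPCA_output S r T Vh \<longleftrightarrow>
     (\<exists>N U s W. hetero_iterate S r T N \<and> is_svd (dim_row S) N U s W \<and>
        Vh = mat_of_cols (dim_row S) (map (col U) [0..<r]))"

text \<open>\<open>log (a / b)\<close> for \<open>a > 0\<close>, \<open>b \<ge> 0\<close>, with \<open>log (a / 0) = \<infinity>\<close>.\<close>

definition log_ratio :: "real \<Rightarrow> real \<Rightarrow> ereal" where
  "log_ratio a b = (if b = 0 then \<infinity> else ereal (ln (a / b)))"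

end

theory Submission
  imports Defs "HOL-Analysis.Inner_Product" "HOL-Computational_Algebra.Fundamental_Theorem_Algebra"
begin

text \<open>
  Scale so that \<open>\<lambda>\<^sub>K(M) = 1\<close>, and write \<open>N\<^sub>t = M + \<Gamma>(Z) + D\<^sub>t\<close> with \<open>D\<^sub>t\<close> diagonal,
  \<open>X\<^sub>t = P\<^sub>t N\<^sub>t\<close> for the rank-\<open>K\<close> truncation and \<open>R\<^sub>t = N\<^sub>t - X\<^sub>t\<close>.
  When \<open>K\<close> is large the noise need not be small in operator norm, so \<open>D\<^sub>t\<close> cannot be shown to
  contract. Instead the run is compared with the noiseless run \<open>N'\<^sub>t = M + D'\<^sub>t\<close> started from the
  same diagonal. There incoherence gives \<open>\<parallel>D'\<^sub>t\<parallel> \<le> 4\<^sup>-\<^sup>t / 10000\<close> in operator norm, and hence near-identity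
  matrices carry \<open>X'\<^sub>t\<close> to \<open>X'\<^sub>t\<^sub>+\<^sub>1\<close>. Applying them to \<open>X\<^sub>t\<close> yields a rank-\<open>K\<close> competitor for
  \<open>N\<^sub>t\<^sub>+\<^sub>1\<close>, and since \<open>R'\<^sub>t\<close> is normal to the rank-\<open>K\<close> matrices at \<open>X'\<^sub>t\<close>, optimality of the truncation
  shows that \<open>\<parallel>R\<^sub>t - R'\<^sub>t\<parallel>\<^sub>F\<close> grows only by relative errors of order \<open>\<parallel>D'\<^sub>t\<parallel>\<close>, which are summable; so it stays
  below \<open>2 \<parallel>\<Gamma>(Z)\<parallel>\<^sub>F\<close>, although \<open>D\<^sub>t - D'\<^sub>t\<close> itself may grow.

  For the last iterate, \<open>(I - P)(M + D)\<close> is then small up to a term of size \<open>\<parallel>D'\<^sub>T\<parallel>\<close>. At the indices \<open>j\<close> with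
  \<open>P\<^sub>j\<^sub>j < 1/2\<close> this bounds the diagonal entry \<open>D\<^sub>j\<^sub>j\<close>. The other indices number at most
  \<open>16 \<parallel>(I - P)V\<parallel>\<^sub>F\<^sup>2\<close>, and by incoherence each of them contributes little to
  \<open>\<parallel>(I - P)V\<parallel>\<^sub>F\<^sup>2\<close>.
\<close>

section \<open>Finitely supported matrices\<close>

text \<open>The update reads N_{t+1} = N_t - diag(R_t), and likewise for the noiseless run, so
  N_{t+1} - N'_{t+1} equals X_t - X'_t plus the off-diagonal part of R_t - R'_t. Deleting a diagonal
  never increases the Frobenius norm; this is why the residuals, and not the diagonals, carry the
  invariant. The distance of the truncations enters only through terms with a factor |D'_t|. It
  grows by at most 4g per step, g = |Gamma(Z)|_F / lambda_K, and is carried as the cruder bound 8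
  (3/2)^t g: since (1/4) (3/2)^2 = 9/16 < 1, the terms |D'_t| |X_t - X'_t|^2 then sum to a small
  multiple of g^2. The number of steps matters only at the end: T >= log(sqrt K / g) gives 4^-T sqrt
  K <= g because e <= 4. The condition number lambda_1 / lambda_K always meets a squared row norm of
  V, in the noiseless contraction as well as in the last step, so that only their product has to be
  small.\<close>

text \<open>
  Square and rectangular matrices of all sizes, padded with zeros, live in one ring with the
  Frobenius inner product; a column vector is a matrix supported in column 0.
\<close>

typedef fmat = "{f :: nat \<Rightarrow> nat \<Rightarrow> real. \<exists>n. \<forall>i j. f i j \<noteq> 0 \<longrightarrow> i < n \<and> j < n}"
  morphisms ent Fmat
  by (rule exI[of _ "\<lambda>_ _. 0"]) auto

setup_lifting type_definition_fmat

lemma fmat_eqI: "(\<And>i j. ent A i j = ent B i j) \<Longrightarrow> A = B"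
  by (metis ent_inject ext)

lemma fmat_eq_iff: "A = B \<longleftrightarrow> (\<forall>i j. ent A i j = ent B i j)"
  using fmat_eqI by blast

definition supp_in :: "nat \<Rightarrow> nat \<Rightarrow> fmat \<Rightarrow> bool" where
  "supp_in m n A \<longleftrightarrow> (\<forall>i j. ent A i j \<noteq> 0 \<longrightarrow> i < m \<and> j < n)"

lemma ex_supp: "\<exists>n. supp_in n n A"
  unfolding supp_in_def using ent[of A] by auto

lemma supp_in_mono: "supp_in m n A \<Longrightarrow> m \<le> m' \<Longrightarrow> n \<le> n' \<Longrightarrow> supp_in m' n' A"
  unfolding supp_in_def by (meson less_le_trans)

lemma ex_supp_list: "\<exists>n. \<forall>A\<in>set As. supp_in n n A"
proof (induction As)
  case (Cons A As)
  obtain n where n: "\<forall>A\<in>set As. supp_in n n A" using Cons by blast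
  obtain k where k: "supp_in k k A" using ex_supp by blast
  show ?case
    by (rule exI[of _ "max n k"]) (use n k in \<open>auto intro: supp_in_mono\<close>)
qed auto

definition mk_fmat :: "nat \<Rightarrow> nat \<Rightarrow> (nat \<Rightarrow> nat \<Rightarrow> real) \<Rightarrow> fmat" where
  "mk_fmat m n f = Fmat (\<lambda>i j. if i < m \<and> j < n then f i j else 0)"

lemma ent_mk_fmat: "ent (mk_fmat m n f) i j = (if i < m \<and> j < n then f i j else 0)"
proof -
  have "(\<lambda>i j. if i < m \<and> j < n then f i j else 0) \<in> {f. \<exists>n. \<forall>i j. f i j \<noteq> 0 \<longrightarrow> i < n \<and> j < n}"
    by (auto intro!: exI[of _ "max m n"] split: if_splits)
  then show ?thesis unfolding mk_fmat_def by (simp add: Fmat_inverse)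
qed

lemma supp_in_mk_fmat: "supp_in m n (mk_fmat m n f)"
  by (auto simp: supp_in_def ent_mk_fmat split: if_splits)

instantiation fmat :: ring
begin

lift_definition zero_fmat :: fmat is "\<lambda>_ _. 0" by auto

lift_definition plus_fmat :: "fmat \<Rightarrow> fmat \<Rightarrow> fmat" is "\<lambda>f g i j. f i j + g i j"
proof -
  fix f g :: "nat \<Rightarrow> nat \<Rightarrow> real"
  assume "\<exists>n. \<forall>i j. f i j \<noteq> 0 \<longrightarrow> i < n \<and> j < n" "\<exists>n. \<forall>i j. g i j \<noteq> 0 \<longrightarrow> i < n \<and> j < n"
  then obtain n k where "\<forall>i j. f i j \<noteq> 0 \<longrightarrow> i < n \<and> j < n" "\<forall>i j. g i j \<noteq> 0 \<longrightarrow> i < k \<and> j < k" by blast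
  then show "\<exists>n. \<forall>i j. f i j + g i j \<noteq> 0 \<longrightarrow> i < n \<and> j < n"
    by (intro exI[of _ "max n k"]) (metis add_cancel_left_right less_max_iff_disj)
qed

lift_definition uminus_fmat :: "fmat \<Rightarrow> fmat" is "\<lambda>f i j. - f i j" by auto

lift_definition minus_fmat :: "fmat \<Rightarrow> fmat \<Rightarrow> fmat" is "\<lambda>f g i j. f i j - g i j"
proof -
  fix f g :: "nat \<Rightarrow> nat \<Rightarrow> real"
  assume "\<exists>n. \<forall>i j. f i j \<noteq> 0 \<longrightarrow> i < n \<and> j < n" "\<exists>n. \<forall>i j. g i j \<noteq> 0 \<longrightarrow> i < n \<and> j < n"
  then obtain n k where "\<forall>i j. f i j \<noteq> 0 \<longrightarrow> i < n \<and> j < n" "\<forall>i j. g i j \<noteq> 0 \<longrightarrow> i < k \<and> j < k" by blast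
  then show "\<exists>n. \<forall>i j. f i j - g i j \<noteq> 0 \<longrightarrow> i < n \<and> j < n"
    by (intro exI[of _ "max n k"]) (metis diff_zero less_max_iff_disj)
qed

text \<open>Summing over the support of a row of \<open>f\<close> keeps the sum finite without
  naming a dimension; \<open>ent_mult\<close> and \<open>ent_mult'\<close> turn it into a sum over
  an initial segment.\<close>

lift_definition times_fmat :: "fmat \<Rightarrow> fmat \<Rightarrow> fmat"
  is "\<lambda>f g i j. \<Sum>k | f i k \<noteq> 0. f i k * g k j"
proof -
  fix f g :: "nat \<Rightarrow> nat \<Rightarrow> real"
  assume "\<exists>n. \<forall>i j. f i j \<noteq> 0 \<longrightarrow> i < n \<and> j < n" "\<exists>n. \<forall>i j. g i j \<noteq> 0 \<longrightarrow> i < n \<and> j < n"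
  then obtain n k where n: "\<forall>i j. f i j \<noteq> 0 \<longrightarrow> i < n \<and> j < n" and k: "\<forall>i j. g i j \<noteq> 0 \<longrightarrow> i < k \<and> j < k" by blast
  show "\<exists>n. \<forall>i j. (\<Sum>k | f i k \<noteq> 0. f i k * g k j) \<noteq> 0 \<longrightarrow> i < n \<and> j < n"
  proof (intro exI[of _ "max n k"] allI impI)
    fix i j assume "(\<Sum>k | f i k \<noteq> 0. f i k * g k j) \<noteq> 0"
    then obtain l where "f i l * g l j \<noteq> 0" by (meson sum.not_neutral_contains_not_neutral)
    then have "f i l \<noteq> 0" "g l j \<noteq> 0" by auto
    with n k show "i < max n k \<and> j < max n k" by (metis less_max_iff_disj)
  qed
qed

lemma ent_zero[simp]: "ent 0 i j = 0" by transfer simp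
lemma ent_add[simp]: "ent (A + B) i j = ent A i j + ent B i j" by transfer simp
lemma ent_diff[simp]: "ent (A - B) i j = ent A i j - ent B i j" by transfer simp
lemma ent_minus[simp]: "ent (- A) i j = - ent A i j" by transfer simp

lemma ent_mult_raw: "ent (A * B) i j = (\<Sum>k | ent A i k \<noteq> 0. ent A i k * ent B k j)" by transfer simp

lemma ent_mult: 
  assumes "supp_in m n A" 
  shows "ent (A * B) i j = (\<Sum>k<n. ent A i k * ent B k j)"
  unfolding ent_mult_raw
  by (rule sum.mono_neutral_left) (use assms in \<open>auto simp: supp_in_def\<close>)

lemma ent_mult':
  assumes "supp_in m n B" 
  shows "ent (A * B) i j = (\<Sum>k<m. ent A i k * ent B k j)"
proof -
  obtain l where l: "supp_in l l A" using ex_supp by blast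
  have "ent (A * B) i j = (\<Sum>k<max l m. ent A i k * ent B k j)"
    by (rule ent_mult[of l]) (rule supp_in_mono[OF l], auto)
  also have "\<dots> = (\<Sum>k<m. ent A i k * ent B k j)"
  proof (rule sum.mono_neutral_right)
    show "\<forall>k\<in>{..<max l m} - {..<m}. ent A i k * ent B k j = 0"
      using assms unfolding supp_in_def by (metis DiffD2 lessThan_iff mult_zero_right)
  qed auto
  finally show ?thesis .
qed

lemma supp_in_mult:
  assumes "supp_in m n A" "supp_in n' k B"
  shows "supp_in m k (A * B)"
  unfolding supp_in_def
proof (intro allI impI)
  fix i j assume "ent (A * B) i j \<noteq> 0"
  then obtain l where "ent A i l * ent B l j \<noteq> 0"
    unfolding ent_mult_raw by (meson sum.not_neutral_contains_not_neutral)
  then have "ent A i l \<noteq> 0" "ent B l j \<noteq> 0" by auto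
  with assms show "i < m \<and> j < k" unfolding supp_in_def by blast
qed

instance
proof
  fix A B C :: fmat
  obtain n where "\<forall>X\<in>set [A, B, C]. supp_in n n X" using ex_supp_list by blast
  then have s: "supp_in n n A" "supp_in n n B" "supp_in n n C" by auto
  have sAB: "supp_in n n (A + B)" using s by (auto simp: supp_in_def) (metis add_cancel_left_left)+
  have sMAB: "supp_in n n (A * B)" using s by (blast intro: supp_in_mult)
  show "A + B + C = A + (B + C)" "A + B = B + A" "0 + A = A" "- A + A = 0" "A - B = A + - B"
    by (auto intro: fmat_eqI)
  show "A * B * C = A * (B * C)"
  proof (rule fmat_eqI)
    fix i j
    have "ent (A * B * C) i j = (\<Sum>k<n. \<Sum>l<n. ent A i l * ent B l k * ent C k j)"
      by (simp add: ent_mult[OF sMAB] ent_mult[OF s(1)] sum_distrib_right)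
    also have "\<dots> = (\<Sum>l<n. \<Sum>k<n. ent A i l * ent B l k * ent C k j)" by (rule sum.swap)
    also have "\<dots> = ent (A * (B * C)) i j"
      by (simp add: ent_mult[OF s(1)] ent_mult[OF s(2)] sum_distrib_left mult.assoc)
    finally show "ent (A * B * C) i j = ent (A * (B * C)) i j" .
  qed
  show "(A + B) * C = A * C + B * C"
    by (rule fmat_eqI) (simp add: ent_mult'[OF s(3)] algebra_simps sum.distrib)
  show "A * (B + C) = A * B + A * C"
    by (rule fmat_eqI) (simp add: ent_mult[OF s(1)] algebra_simps sum.distrib)
qed

end

instantiation fmat :: real_algebra
begin

lift_definition scaleR_fmat :: "real \<Rightarrow> fmat \<Rightarrow> fmat" is "\<lambda>c f i j. c * f i j" by auto

lemma ent_scaleR[simp]: "ent (c *\<^sub>R A) i j = c * ent A i j" by transfer simp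

instance
proof
  fix A B :: fmat and c d :: real
  obtain n where s: "supp_in n n A" using ex_supp by blast
  then have sc: "supp_in n n (c *\<^sub>R A)" by (auto simp: supp_in_def)
  show "c *\<^sub>R (A + B) = c *\<^sub>R A + c *\<^sub>R B" "(c + d) *\<^sub>R A = c *\<^sub>R A + d *\<^sub>R A" 
    "c *\<^sub>R d *\<^sub>R A = (c * d) *\<^sub>R A" "1 *\<^sub>R A = A"
    by (auto intro!: fmat_eqI simp: algebra_simps)
  show "c *\<^sub>R A * B = c *\<^sub>R (A * B)"
    by (auto intro!: fmat_eqI simp: ent_mult[OF s] ent_mult[OF sc] sum_distrib_left mult.assoc)
  show "A * c *\<^sub>R B = c *\<^sub>R (A * B)"
    by (auto intro!: fmat_eqI simp: ent_mult[OF s] sum_distrib_left mult_ac)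
qed

end

instantiation fmat :: real_inner
begin

definition inner_fmat :: "fmat \<Rightarrow> fmat \<Rightarrow> real" where
  "inner_fmat A B = (\<Sum>(i, j) | ent A i j \<noteq> 0. ent A i j * ent B i j)"
definition norm_fmat :: "fmat \<Rightarrow> real" where "norm_fmat A = sqrt (inner A A)"
definition dist_fmat :: "fmat \<Rightarrow> fmat \<Rightarrow> real" where "dist_fmat A B = norm (A - B)"
definition sgn_fmat :: "fmat \<Rightarrow> fmat" where "sgn_fmat A = inverse (norm A) *\<^sub>R A"
definition uniformity_fmat :: "(fmat \<times> fmat) filter" where
  "uniformity_fmat = (INF e\<in>{0 <..}. principal {(x, y). dist x y < e})"
definition open_fmat :: "fmat set \<Rightarrow> bool" where
  "open_fmat U = (\<forall>x\<in>U. \<forall>\<^sub>F (x', y) in uniformity. x' = x \<longrightarrow> y \<in> U)"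

lemma inner_eq_sum:
  assumes "supp_in m n A" 
  shows "inner A B = (\<Sum>i<m. \<Sum>j<n. ent A i j * ent B i j)"
proof -
  have "inner A B = (\<Sum>(i, j)\<in>{..<m} \<times> {..<n}. ent A i j * ent B i j)"
    unfolding inner_fmat_def
    by (rule sum.mono_neutral_left) (use assms in \<open>auto simp: supp_in_def\<close>)
  then show ?thesis by (simp add: sum.cartesian_product)
qed

instance
proof
  fix A B C :: fmat and c :: real
  obtain n where "\<forall>X\<in>set [A, B, C]. supp_in n n X" using ex_supp_list by blast
  then have s: "supp_in n n A" "supp_in n n B" "supp_in n n C" by auto
  have sAB: "supp_in n n (A + B)" using s by (auto simp: supp_in_def) (metis add_cancel_left_left)+
  have sc: "supp_in n n (c *\<^sub>R A)" using s by (auto simp: supp_in_def)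
  show "dist A B = norm (A - B)" "sgn A = inverse (norm A) *\<^sub>R A" "norm A = sqrt (inner A A)"
    by (simp_all add: dist_fmat_def sgn_fmat_def norm_fmat_def)
  show "(uniformity :: (fmat \<times> fmat) filter) = (INF e\<in>{0 <..}. principal {(x, y). dist x y < e})"
    by (simp add: uniformity_fmat_def)
  show "open U = (\<forall>x\<in>U. \<forall>\<^sub>F (x', y) in uniformity. x' = x \<longrightarrow> y \<in> U)" for U :: "fmat set"
    by (simp add: open_fmat_def)
  show "inner A B = inner B A" by (simp add: inner_eq_sum[OF s(1)] inner_eq_sum[OF s(2)] mult.commute)
  show "inner (A + B) C = inner A C + inner B C" 
    by (simp add: inner_eq_sum[OF s(1)] inner_eq_sum[OF s(2)] inner_eq_sum[OF sAB] sum.distrib algebra_simps)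
  show "inner (c *\<^sub>R A) B = c * inner A B"
    by (simp add: inner_eq_sum[OF s(1)] inner_eq_sum[OF sc] sum_distrib_left mult.assoc)
  show "0 \<le> inner A A" by (simp add: inner_eq_sum[OF s(1)] sum_nonneg)
  show "inner A A = 0 \<longleftrightarrow> A = 0"
  proof
    assume *: "inner A A = 0"
    show "A = 0"
    proof (rule fmat_eqI)
      fix i j
      have "(\<Sum>j<n. ent A i j * ent A i j) = 0" if "i < n"
        using * that unfolding inner_eq_sum[OF s(1)]
        by (subst (asm) sum_nonneg_eq_0_iff) (auto intro: sum_nonneg)
      then have "ent A i j * ent A i j = 0" if "i < n" "j < n"
        using that by (subst (asm) sum_nonneg_eq_0_iff) auto
      then show "ent A i j = ent 0 i j" using s(1) by (auto simp: supp_in_def)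
    qed
  qed (simp add: inner_fmat_def)
qed

end

lift_definition adj :: "fmat \<Rightarrow> fmat" is "\<lambda>f i j. f j i" by auto

lemma ent_adj[simp]: "ent (adj A) i j = ent A j i" by transfer simp

lemma adj_add: "adj (A + B) = adj A + adj B" by (rule fmat_eqI) simp
lemma adj_diff: "adj (A - B) = adj A - adj B" by (rule fmat_eqI) simp
lemma adj_scaleR: "adj (c *\<^sub>R A) = c *\<^sub>R adj A" by (rule fmat_eqI) simp
lemma adj_zero[simp]: "adj 0 = 0" by (rule fmat_eqI) simp
lemma adj_adj[simp]: "adj (adj A) = A" by (rule fmat_eqI) simp
lemma adj_sum: "adj (sum f I) = (\<Sum>i\<in>I. adj (f i))"
  by (induction I rule: infinite_finite_induct) (auto simp: adj_add)

lemma ent_sum: "ent (sum f I) i j = (\<Sum>k\<in>I. ent (f k) i j)"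
  by (induction I rule: infinite_finite_induct) auto

lemma supp_in_adj: "supp_in m n A \<Longrightarrow> supp_in n m (adj A)" by (auto simp: supp_in_def)

lemma adj_mult: "adj (A * B) = adj B * adj A"
proof -
  obtain n where s: "supp_in n n A" using ex_supp by blast
  show ?thesis
    by (rule fmat_eqI) (simp add: ent_mult[OF s] ent_mult'[OF supp_in_adj[OF s]] mult.commute)
qed

lemma inner_adj_adj: "inner (adj A) (adj B) = inner A B"
proof -
  obtain n where s: "supp_in n n A" using ex_supp by blast
  show ?thesis
    unfolding inner_eq_sum[OF s] inner_eq_sum[OF supp_in_adj[OF s]] by (subst sum.swap) simp
qed

lemma norm_adj[simp]: "norm (adj A) = norm A" by (simp add: norm_eq_sqrt_inner inner_adj_adj)

lemma inner_adj_left: "inner (adj A) B = inner A (adj B)"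
  by (metis inner_adj_adj adj_adj)

text \<open>With \<open>inner_mult_right\<close> this is the cyclicity of the trace. Nearly all
  later computations with norms move a factor across the inner product in this way.\<close>

lemma inner_mult_left: "inner (A * B) C = inner B (adj A * C)"
proof -
  obtain n where "\<forall>X\<in>set [A, B, C]. supp_in n n X" using ex_supp_list by blast
  then have s: "supp_in n n A" "supp_in n n B" "supp_in n n C" by auto
  have "inner (A * B) C = (\<Sum>i<n. \<Sum>j<n. \<Sum>k<n. ent A i k * ent B k j * ent C i j)"
    by (simp add: inner_eq_sum[OF supp_in_mult[OF s(1) s(2)]] ent_mult[OF s(1)] sum_distrib_right)
  also have "\<dots> = (\<Sum>k<n. \<Sum>j<n. \<Sum>i<n. ent A i k * ent B k j * ent C i j)"
    by (subst sum.swap, subst (2) sum.swap, subst sum.swap) simp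
  also have "\<dots> = inner B (adj A * C)"
    by (simp add: inner_eq_sum[OF s(2)] ent_mult[OF supp_in_adj[OF s(1)]] sum_distrib_left mult_ac)
  finally show ?thesis .
qed

lemma inner_mult_right: "inner (A * B) C = inner A (C * adj B)"
proof -
  have "inner (A * B) C = inner (adj B * adj A) (adj C)" by (metis inner_adj_adj adj_mult)
  also have "\<dots> = inner (adj A) (B * adj C)" by (simp add: inner_mult_left)
  also have "\<dots> = inner A (C * adj B)" by (metis inner_adj_left adj_mult adj_adj)
  finally show ?thesis .
qed

section \<open>Operator norm bounds and orthogonal projections\<close>

lemma supp_inD: "supp_in m n A \<Longrightarrow> m \<le> i \<or> n \<le> j \<Longrightarrow> ent A i j = 0"
  unfolding supp_in_def by (meson leD)

lemma supp_in_0[simp]: "supp_in m n 0" by (simp add: supp_in_def)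

lemma supp_in_add: "supp_in m n A \<Longrightarrow> supp_in m n B \<Longrightarrow> supp_in m n (A + B)"
  unfolding supp_in_def by (metis add.left_neutral ent_add)

lemma supp_in_diff: "supp_in m n A \<Longrightarrow> supp_in m n B \<Longrightarrow> supp_in m n (A - B)"
  unfolding supp_in_def by (metis diff_0_right ent_diff)

lemma supp_in_scaleR: "supp_in m n A \<Longrightarrow> supp_in m n (c *\<^sub>R A)"
  unfolding supp_in_def by auto

lemma supp_in_sum: "(\<And>i. i \<in> I \<Longrightarrow> supp_in m n (f i)) \<Longrightarrow> supp_in m n (sum f I)"
  by (induction I rule: infinite_finite_induct) (auto intro: supp_in_add)

text \<open>The product acts on each column of \<open>B\<close> separately, so the least \<open>r\<close> is the operator norm of \<open>A\<close>.\<close>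

definition opnorm_le :: "fmat \<Rightarrow> real \<Rightarrow> bool" where
  "opnorm_le A r \<longleftrightarrow> (\<forall>B. norm (A * B) \<le> r * norm B)"

text \<open>Basis vector as a matrix in column 0: \<open>A * unit_col j\<close> is column
  \<open>j\<close> of \<open>A\<close>, so entries and columns are reached by multiplication in the
  ring.\<close>

definition unit_col :: "nat \<Rightarrow> fmat" where "unit_col i = mk_fmat (Suc i) 1 (\<lambda>a b. if a = i then 1 else 0)"

lemma ent_unit_col: "ent (unit_col i) a b = (if a = i \<and> b = 0 then 1 else 0)"
  by (auto simp: unit_col_def ent_mk_fmat)

lemma supp_in_unit_col: "i < m \<Longrightarrow> supp_in m 1 (unit_col i)"
  by (auto simp: supp_in_def ent_unit_col)

lemma inner_unit_col: 
  assumes "supp_in m 1 v" shows "inner (unit_col i) v = ent v i 0"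
proof -
  have "inner (unit_col i) v = (\<Sum>a<Suc i. (if a = i then 1 else 0) * ent v a 0)"
    by (subst inner_eq_sum[OF supp_in_unit_col[of i "Suc i"]]) (auto simp: ent_unit_col)
  also have "\<dots> = (\<Sum>a<Suc i. if a = i then ent v a 0 else 0)" by (rule sum.cong) auto
  finally show ?thesis by simp
qed

lemma ent_mult_unit_col: "ent (A * unit_col j) i b = (if b = 0 then ent A i j else 0)"
proof -
  have "ent (A * unit_col j) i b = (\<Sum>k<Suc j. if k = j then (if b = 0 then ent A i j else 0) else 0)"
    unfolding ent_mult'[OF supp_in_unit_col[of j "Suc j", simplified]]
    by (rule sum.cong) (auto simp: ent_unit_col)
  then show ?thesis by simp
qed

lemma ent_eq_inner: "ent A i j = inner (unit_col i) (A * unit_col j)"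
proof -
  obtain n where "supp_in n n A" using ex_supp by blast
  then have "supp_in n 1 (A * unit_col j)"
    by (rule supp_in_mult) (rule supp_in_unit_col[of j "Suc j", OF lessI])
  then show ?thesis by (simp add: inner_unit_col ent_mult_unit_col)
qed

lemma norm_unit_col[simp]: "norm (unit_col i) = 1"
  using inner_unit_col[OF supp_in_unit_col[of i "Suc i"], of i] 
  by (simp add: norm_eq_sqrt_inner ent_unit_col)

lemma inner_unit_col_unit_col: "inner (unit_col i) (unit_col j) = (if i = j then 1 else 0)"
  using inner_unit_col[OF supp_in_unit_col[of j "Suc j"], of i] by (simp add: ent_unit_col)

lemma mult_unit_col_eq_zero: "supp_in m n A \<Longrightarrow> n \<le> j \<Longrightarrow> A * unit_col j = 0"
  by (rule fmat_eqI) (auto simp: ent_mult_unit_col supp_inD)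

lemma fmat_eqI_cols: 
  assumes "supp_in m n A" "supp_in m' n B" "\<And>j. j < n \<Longrightarrow> A * unit_col j = B * unit_col j"
  shows "A = B"
proof (rule fmat_eqI)
  fix i j
  have "A * unit_col j = B * unit_col j" 
    using assms mult_unit_col_eq_zero by (cases "j < n") (auto simp: not_less)
  then show "ent A i j = ent B i j" by (simp add: ent_eq_inner)
qed

lemma norm_sq_eq_sum: "supp_in m n A \<Longrightarrow> (norm A)\<^sup>2 = (\<Sum>i<m. \<Sum>j<n. (ent A i j)\<^sup>2)"
  unfolding power2_norm_eq_inner by (simp add: inner_eq_sum power2_eq_square)

lemma norm_sq_eq_cols: 
  assumes "supp_in m n A" 
  shows "(norm A)\<^sup>2 = (\<Sum>j<n. (norm (A * unit_col j))\<^sup>2)"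
proof -
  have "(norm (A * unit_col j))\<^sup>2 = (\<Sum>i<m. (ent A i j)\<^sup>2)" for j
    using norm_sq_eq_sum[OF supp_in_mult[OF assms supp_in_unit_col[of j "Suc j"]]] 
    by (simp add: ent_mult_unit_col)
  then show ?thesis unfolding norm_sq_eq_sum[OF assms] by (subst sum.swap) simp
qed

lemma opbD: "opnorm_le A r \<Longrightarrow> norm (A * B) \<le> r * norm B" by (simp add: opnorm_le_def)

lemma opnorm_le_nonneg: assumes "opnorm_le A r" shows "0 \<le> r"
  using opbD[OF assms, of "unit_col 0"] norm_ge_zero[of "A * unit_col 0"] by (simp del: norm_ge_zero)

lemma opnorm_le_mono: "opnorm_le A r \<Longrightarrow> r \<le> s \<Longrightarrow> opnorm_le A s"
  unfolding opnorm_le_def by (meson mult_right_mono norm_ge_zero order_trans)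

text \<open>The square of \<open>norm (adj A * B)\<close> is the inner product of \<open>B\<close>
  with \<open>A * (adj A * B)\<close>; Cauchy-Schwarz leaves one common factor to cancel.\<close>

lemma opnorm_le_adj: assumes "opnorm_le A r" shows "opnorm_le (adj A) r"
  unfolding opnorm_le_def
proof
  fix B
  have "(norm (adj A * B))\<^sup>2 = inner B (A * (adj A * B))"
    by (simp add: power2_norm_eq_inner inner_mult_left)
  also have "\<dots> \<le> norm B * (r * norm (adj A * B))"
    by (rule order_trans[OF norm_cauchy_schwarz mult_left_mono[OF opbD[OF assms]]]) simp
  finally show "norm (adj A * B) \<le> r * norm B"
    using opnorm_le_nonneg[OF assms]
    by (cases "norm (adj A * B) = 0") (auto simp: power2_eq_square mult_ac)
qed

lemma opnorm_le_right: "opnorm_le A r \<Longrightarrow> norm (B * A) \<le> r * norm B"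
  by (metis norm_adj opbD opnorm_le_adj adj_mult)

lemma opnorm_le_diff: "opnorm_le A r \<Longrightarrow> opnorm_le B s \<Longrightarrow> opnorm_le (A - B) (r + s)"
  unfolding opnorm_le_def left_diff_distrib distrib_right by (meson add_mono norm_triangle_le_diff)

lemma opnorm_le_mult: assumes "opnorm_le A r" "opnorm_le B s" shows "opnorm_le (A * B) (r * s)"
  unfolding opnorm_le_def
proof
  fix C
  have "norm (A * B * C) \<le> r * norm (B * C)" using opbD[OF assms(1), of "B * C"] by (simp add: mult.assoc)
  also have "\<dots> \<le> r * (s * norm C)" by (intro mult_left_mono opbD assms opnorm_le_nonneg[OF assms(1)])
  finally show "norm (A * B * C) \<le> r * s * norm C" by (simp add: mult.assoc)
qed

lemma abs_inner_mult_le: "opnorm_le A r \<Longrightarrow> \<bar>inner u (A * v)\<bar> \<le> r * norm u * norm v"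
  using order_trans[OF Cauchy_Schwarz_ineq2 mult_left_mono[OF opbD norm_ge_zero], of A r u v] 
  by (simp add: mult_ac)

section \<open>Orthogonal projections\<close>

definition proj :: "fmat \<Rightarrow> bool" where "proj P \<longleftrightarrow> adj P = P \<and> P * P = P"

lemma projD: "proj P \<Longrightarrow> adj P = P" "proj P \<Longrightarrow> P * P = P" 
  "proj P \<Longrightarrow> P * (P * A) = P * A" "proj P \<Longrightarrow> A * P * P = A * P"
  unfolding proj_def by (metis mult.assoc)+

lemma proj_pythagoras: 
  assumes "proj P" shows "(norm B)\<^sup>2 = (norm (P * B))\<^sup>2 + (norm (B - P * B))\<^sup>2"
proof -
  have "inner (P * B) (B - P * B) = 0"
    by (simp add: inner_mult_left projD[OF assms] algebra_simps inner_diff_right)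
  then show ?thesis
    using dot_norm[of "P * B" "B - P * B"] by simp
qed

lemma proj_opnorm_le: "proj P \<Longrightarrow> opnorm_le P 1"
  unfolding opnorm_le_def using proj_pythagoras 
  by (metis le_add_same_cancel1 mult_1 norm_ge_zero power2_le_imp_le zero_le_power2)

lemma proj_compl_le: "proj P \<Longrightarrow> norm (B - P * B) \<le> norm B"
  using proj_pythagoras by (metis le_add_same_cancel2 norm_ge_zero power2_le_imp_le zero_le_power2)

lemma proj_compl_le_right: assumes "proj P" shows "norm (B - B * P) \<le> norm B"
  using proj_compl_le[OF assms, of "adj B"] projD(1)[OF assms]
  by (metis norm_adj adj_diff adj_mult)

lemma opnorm_le_proj_compl: "proj P \<Longrightarrow> opnorm_le A r \<Longrightarrow> opnorm_le (A - P * A) r"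
  unfolding opnorm_le_def left_diff_distrib mult.assoc by (meson order_trans proj_compl_le)

lemma opnorm_le_proj_compl_right: assumes "proj P" "opnorm_le A r" shows "opnorm_le (A - A * P) r"
  using opnorm_le_adj[OF opnorm_le_proj_compl[OF assms(1) opnorm_le_adj[OF assms(2)]]] projD(1)[OF assms(1)]
  by (simp add: adj_diff adj_mult)

lemma proj_0: "proj 0" by (simp add: proj_def)

lemma norm_proj_swap: "proj P \<Longrightarrow> proj Q \<Longrightarrow> norm (P * Q) = norm (Q * P)"
  by (metis norm_adj projD(1) adj_mult)

text \<open>The scalar 1 as a matrix: a product \<open>adj u * v\<close> of column vectors is a
  multiple of it, and it is a right unit for column vectors.\<close>

definition one00 :: fmat where "one00 = mk_fmat 1 1 (\<lambda>_ _. 1)"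

lemma adj_one00: "adj one00 = one00" by (rule fmat_eqI) (auto simp: one00_def ent_mk_fmat)

lemma adj_mult_vec: 
  assumes "supp_in m 1 u" "supp_in m 1 v"
  shows "adj u * v = inner u v *\<^sub>R one00"
proof (rule fmat_eqI)
  fix i j
  have "ent (adj u * v) i j = (if i = 0 \<and> j = 0 then (\<Sum>k<m. ent u k 0 * ent v k 0) else 0)"
    by (auto simp: ent_mult[OF supp_in_adj[OF assms(1)]] supp_inD[OF assms(1)] supp_inD[OF assms(2)])
  then show "ent (adj u * v) i j = ent (inner u v *\<^sub>R one00) i j"
    by (auto simp: one00_def ent_mk_fmat inner_eq_sum[OF assms(1)])
qed

lemma mult_one00: "supp_in m 1 u \<Longrightarrow> u * one00 = u"
  by (rule fmat_eqI) (auto simp: ent_mult[of m 1] one00_def ent_mk_fmat supp_inD)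

lemma outer_mult_vec:
  assumes "supp_in m 1 u" "supp_in n 1 v" "supp_in n 1 w"
  shows "u * adj v * w = inner v w *\<^sub>R u"
  using assms by (simp add: mult.assoc adj_mult_vec mult_one00)

lemma outer_mult_outer:
  assumes "supp_in m 1 u" "supp_in n 1 v" "supp_in n 1 w"
  shows "u * adj v * (w * adj z) = inner v w *\<^sub>R (u * adj z)"
  using outer_mult_vec[OF assms] by (simp add: mult.assoc[symmetric])

lemma inner_outer_outer:
  assumes "supp_in m 1 u" "supp_in m 1 w" "supp_in n 1 v" "supp_in n 1 z"
  shows "inner (u * adj v) (w * adj z) = inner u w * inner v z"
proof -
  have "inner (u * adj v) (w * adj z) = inner (adj v) (adj u * w * adj z)" 
    by (simp add: inner_mult_left mult.assoc)
  also have "adj u * w * adj z = inner u w *\<^sub>R (one00 * adj z)" 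
    using assms by (simp add: adj_mult_vec)
  also have "one00 * adj z = adj (z * one00)" 
    by (simp add: adj_mult adj_one00)
  finally show ?thesis using assms by (simp add: mult_one00 inner_adj_adj)
qed

section \<open>Diagonal matrices and identity blocks\<close>

definition idm :: "nat \<Rightarrow> fmat" where "idm m = mk_fmat m m (\<lambda>i j. if i = j then 1 else 0)"

definition diagm :: "nat \<Rightarrow> (nat \<Rightarrow> real) \<Rightarrow> fmat" where "diagm m f = mk_fmat m m (\<lambda>i j. if i = j then f i else 0)"

lemma supp_in_diagm: "supp_in m m (diagm m f)" unfolding diagm_def by (rule supp_in_mk_fmat)

lemma ent_diagm: "ent (diagm m f) i j = (if i = j \<and> i < m then f i else 0)" by (auto simp: diagm_def ent_mk_fmat)

lemma ent_diagm_mult: "ent (diagm m f * A) i j = (if i < m then f i * ent A i j else 0)"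
proof -
  have "ent (diagm m f * A) i j = (\<Sum>k<m. if k = i then f i * ent A i j else 0)"
    unfolding ent_mult[OF supp_in_diagm] by (rule sum.cong) (auto simp: ent_diagm)
  then show ?thesis by simp
qed

lemma idm_eq_diagm: "idm m = diagm m (\<lambda>_. 1)" by (simp add: idm_def diagm_def)

lemma adj_diagm[simp]: "adj (diagm m f) = diagm m f" by (rule fmat_eqI) (auto simp: ent_diagm)

lemma ent_mult_diagm: "ent (A * diagm m f) i j = (if j < m then ent A i j * f j else 0)"
proof -
  have "ent (A * diagm m f) i j = ent (diagm m f * adj A) j i" by (metis ent_adj adj_diagm adj_mult)
  then show ?thesis by (simp add: ent_diagm_mult)
qed

lemma diagm_mult_diagm: "diagm m f * diagm m g = diagm m (\<lambda>i. f i * g i)" 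
  by (rule fmat_eqI) (auto simp: ent_diagm ent_diagm_mult)

lemma diagm_diff_diagm: "diagm m f - diagm m g = diagm m (\<lambda>i. f i - g i)" 
  by (rule fmat_eqI) (auto simp: ent_diagm)

lemma diagm_add_diagm: "diagm m f + diagm m g = diagm m (\<lambda>i. f i + g i)" 
  by (rule fmat_eqI) (auto simp: ent_diagm)

lemma idm_mult: "supp_in m n A \<Longrightarrow> idm m * A = A"
  by (rule fmat_eqI) (auto simp: idm_eq_diagm ent_diagm_mult supp_in_def)

lemma mult_idm: "supp_in m n A \<Longrightarrow> A * idm n = A"
  by (metis idm_eq_diagm idm_mult supp_in_adj adj_diagm adj_mult adj_adj)

lemma proj_idm: "proj (idm m)" by (simp add: proj_def idm_eq_diagm diagm_mult_diagm)

lemma diagm_mult_unit_col: "j < m \<Longrightarrow> diagm m f * unit_col j = f j *\<^sub>R unit_col j"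
  by (rule fmat_eqI) (auto simp: ent_mult_unit_col ent_diagm ent_unit_col)

lemma diagm_eq_sum: "diagm m f = (\<Sum>j<m. f j *\<^sub>R (unit_col j * adj (unit_col j)))"
proof -
  have "(\<Sum>j<m. f j *\<^sub>R (unit_col j * adj (unit_col j))) = diagm m f * (\<Sum>j<m. unit_col j * adj (unit_col j))"
    unfolding sum_distrib_left by (intro sum.cong refl) (simp add: mult.assoc[symmetric] diagm_mult_unit_col)
  also have "(\<Sum>j<m. unit_col j * adj (unit_col j)) = idm m"
  proof (rule fmat_eqI)
    fix a b
    have e: "ent (unit_col j * adj (unit_col j)) a b = (if a = j \<and> b = j then 1 else 0)" for j
      using ent_mult[OF supp_in_unit_col[of j "Suc j", OF lessI], of "adj (unit_col j)" a b]
      by (simp add: ent_unit_col)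
    have "(\<Sum>j<m. if a = j \<and> b = j then 1 else (0::real)) = (\<Sum>j<m. if j = a then (if b = a then 1 else 0) else 0)"
      by (intro sum.cong) auto
    then show "ent (\<Sum>j<m. unit_col j * adj (unit_col j)) a b = ent (idm m) a b"
      by (auto simp: ent_sum e idm_eq_diagm ent_diagm)
  qed
  finally show ?thesis by (simp add: mult_idm[OF supp_in_diagm])
qed

lemma inner_diagm_nonneg: 
  assumes "\<And>i. i < m \<Longrightarrow> 0 \<le> f i" shows "0 \<le> inner y (diagm m f * y)"
proof -
  have "diagm m f = diagm m (\<lambda>i. sqrt (f i)) * diagm m (\<lambda>i. sqrt (f i))"
    unfolding diagm_mult_diagm by (rule fmat_eqI) (use assms in \<open>auto simp: ent_diagm\<close>)
  then have "inner y (diagm m f * y) = inner (diagm m (\<lambda>i. sqrt (f i)) * y) (diagm m (\<lambda>i. sqrt (f i)) * y)"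
    by (simp add: inner_mult_left mult.assoc)
  then show ?thesis by simp
qed

lemma norm_diagm_sq: "(norm (diagm m f))\<^sup>2 = (\<Sum>i<m. (f i)\<^sup>2)"
proof -
  have "(\<Sum>j<m. (ent (diagm m f) i j)\<^sup>2) = (f i)\<^sup>2" if "i < m" for i
  proof -
    have "(\<Sum>j<m. (ent (diagm m f) i j)\<^sup>2) = (\<Sum>j<m. if j = i then (f i)\<^sup>2 else 0)"
      by (rule sum.cong) (use that in \<open>auto simp: ent_diagm\<close>)
    then show ?thesis using that by simp
  qed
  then show ?thesis by (simp add: norm_sq_eq_sum[OF supp_in_diagm])
qed

lemma norm_idm_sq: "(norm (idm m))\<^sup>2 = m" by (simp add: idm_eq_diagm norm_diagm_sq)

lemma opnorm_le_diagm: 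
  assumes "\<And>i. i < m \<Longrightarrow> \<bar>f i\<bar> \<le> r" "0 \<le> r" shows "opnorm_le (diagm m f) r"
  unfolding opnorm_le_def
proof
  fix B
  obtain n where n: "supp_in n n B" using ex_supp by blast
  have s: "supp_in m n (diagm m f * B)" by (rule supp_in_mult[OF supp_in_diagm n])
  have B: "supp_in (max m n) n B" by (rule supp_in_mono[OF n]) auto
  have "(norm (diagm m f * B))\<^sup>2 = (\<Sum>i<m. \<Sum>j<n. (f i)\<^sup>2 * (ent B i j)\<^sup>2)"
    by (simp add: norm_sq_eq_sum[OF s] ent_diagm_mult power_mult_distrib)
  also have "\<dots> \<le> (\<Sum>i<m. \<Sum>j<n. r\<^sup>2 * (ent B i j)\<^sup>2)"
    using assms by (intro sum_mono mult_right_mono) (auto simp: abs_le_square_iff[symmetric])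
  also have "\<dots> \<le> (\<Sum>i<max m n. \<Sum>j<n. r\<^sup>2 * (ent B i j)\<^sup>2)"
    by (rule sum_mono2) (auto intro: sum_nonneg)
  also have "\<dots> = (r * norm B)\<^sup>2"
    by (simp add: norm_sq_eq_sum[OF B] power_mult_distrib sum_distrib_left)
  finally show "norm (diagm m f * B) \<le> r * norm B"
    using assms(2) by (meson norm_ge_zero power2_le_imp_le split_mult_pos_le)
qed

lemma opnorm_le_isometry: assumes "adj U * U = idm n" shows "opnorm_le U 1"
  unfolding opnorm_le_def
proof
  fix B
  have "(norm (U * B))\<^sup>2 = inner B (idm n * B)" 
    by (simp add: power2_norm_eq_inner inner_mult_left mult.assoc[symmetric] assms)
  also have "\<dots> \<le> norm B * norm (idm n * B)" by (rule norm_cauchy_schwarz)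
  \<comment> \<open>\<open>B\<close> may have more than \<open>n\<close> rows; then
    \<open>idm n\<close> only projects, which still does not increase the norm.\<close>
  also have "\<dots> \<le> norm B * norm B" using opbD[OF proj_opnorm_le[OF proj_idm]] by (simp add: mult_left_mono)
  finally have "(norm (U * B))\<^sup>2 \<le> (norm B)\<^sup>2" by (simp add: power2_eq_square)
  then show "norm (U * B) \<le> 1 * norm B" by (simp add: power2_le_imp_le[OF _ norm_ge_zero])
qed

lift_definition diagp :: "fmat \<Rightarrow> fmat" is "\<lambda>f i j. if i = j then f i j else 0" by auto

lemma ent_diagp[simp]: "ent (diagp A) i j = (if i = j then ent A i j else 0)" by transfer simp

lemma diagp_diff: "diagp (A - B) = diagp A - diagp B" by (rule fmat_eqI) auto
lemma diagp_add: "diagp (A + B) = diagp A + diagp B" by (rule fmat_eqI) auto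

lemma diagp_eq_diagm: "supp_in m n A \<Longrightarrow> diagp A = diagm m (\<lambda>i. ent A i i)"
  by (rule fmat_eqI) (auto simp: ent_diagm supp_in_def)

lemma norm_off_diag_le: "norm (A - diagp A) \<le> norm A"
proof -
  obtain n where n: "supp_in n n A" using ex_supp by blast
  then have n': "supp_in n n (A - diagp A)" by (auto simp: supp_in_def split: if_splits)
  have "(norm (A - diagp A))\<^sup>2 \<le> (norm A)\<^sup>2"
    unfolding norm_sq_eq_sum[OF n] norm_sq_eq_sum[OF n']
    by (intro sum_mono) auto
  then show ?thesis by (rule power2_le_imp_le) simp
qed

text \<open>Gram-Schmidt: the residual of the next column, once normalised to \<open>v\<close>, adds
  the rank-one projection \<open>v * adj v\<close>. For an orthogonal projection the squared
  Frobenius norm is the trace, hence the rank; rank at most \<open>n\<close> is expressed by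
  \<open>(norm P)\<^sup>2 \<le> n\<close> throughout.\<close>

lemma ex_proj_cols: 
  assumes "supp_in m n0 A"
  shows "\<exists>P. proj P \<and> supp_in m m P \<and> (norm P)\<^sup>2 \<le> real n \<and> (\<forall>k<n. P * (A * unit_col k) = A * unit_col k)"
proof (induction n)
  case 0
  show ?case by (rule exI[of _ 0]) (auto simp: proj_0 supp_in_def)
next
  case (Suc n)
  then obtain P where P: "proj P" "supp_in m m P" "(norm P)\<^sup>2 \<le> real n" 
    "\<And>k. k < n \<Longrightarrow> P * (A * unit_col k) = A * unit_col k" by blast
  define w where "w = A * unit_col n - P * (A * unit_col n)"
  have sA: "supp_in m 1 (A * unit_col n)" 
    by (rule supp_in_mult[OF assms supp_in_unit_col[of n "Suc n"]]) simp
  have sw: "supp_in m 1 w"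
    using sA supp_in_mult[OF P(2) sA] unfolding w_def supp_in_def by (metis diff_zero ent_diff)
  have Pw: "P * w = 0" by (simp add: w_def algebra_simps projD[OF P(1)])
  then have wP: "adj w * P = 0" by (metis P(1) projD(1) adj_mult adj_zero)
  show ?case
  proof (cases "w = 0")
    case True
    have "P * (A * unit_col k) = A * unit_col k" if "k < Suc n" for k
      using P(4)[of k] True that by (cases "k = n") (auto simp: w_def)
    moreover have "(norm P)\<^sup>2 \<le> real (Suc n)" using P(3) by simp
    ultimately show ?thesis using P(1,2) by blast
  next
    case False
    define v where "v = (1 / norm w) *\<^sub>R w"
    have nv: "inner v v = 1" using False by (simp add: v_def power2_norm_eq_inner[symmetric] power2_eq_square)
    have sv: "supp_in m 1 v" using sw by (auto simp: v_def supp_in_def)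
    have Pv: "P * v = 0" "adj v * P = 0" by (simp_all add: v_def Pw wP adj_scaleR)
    define Q where "Q = P + v * adj v"
    have vv: "v * adj v * (v * adj v) = v * adj v" by (simp add: outer_mult_outer[OF sv sv sv] nv)
    have "Q * Q = P * P + P * v * adj v + v * (adj v * P) + v * adj v * (v * adj v)"
      by (simp add: Q_def algebra_simps)
    then have Q: "proj Q" unfolding proj_def 
      by (simp add: Pv vv projD[OF P(1)]) (simp add: Q_def adj_add adj_mult projD[OF P(1)])
    have "supp_in m m (v * adj v)" by (rule supp_in_mult[OF sv supp_in_adj[OF sv]])
    then have sQ: "supp_in m m Q" using P(2) unfolding Q_def supp_in_def by (metis add_cancel_right_left ent_add)
    have "(norm Q)\<^sup>2 = (norm P)\<^sup>2 + 2 * inner P (v * adj v) + inner (v * adj v) (v * adj v)"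
      by (simp add: Q_def power2_norm_eq_inner inner_add_left inner_add_right inner_commute)
    also have "inner P (v * adj v) = 0" 
      using inner_mult_left[of v "adj v" P] by (simp add: inner_commute Pv)
    also have "inner (v * adj v) (v * adj v) = 1" by (simp add: inner_outer_outer[OF sv sv sv sv] nv)
    finally have nQ: "(norm Q)\<^sup>2 \<le> real (Suc n)" using P(3) by simp
    have "Q * (A * unit_col k) = A * unit_col k" if "k < Suc n" for k
    proof (cases "k = n")
      case True
      have "P * (A * unit_col n) = A * unit_col n - w" by (simp add: w_def)
      moreover have "v * adj v * (A * unit_col n) = w"
      proof -
        have eq: "A * unit_col n = w + P * (A * unit_col n)" by (simp add: w_def)
        have "v * adj v * (A * unit_col n) = v * adj v * w + v * (adj v * P) * (A * unit_col n)"
          by (subst eq) (simp add: algebra_simps)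
        also have "\<dots> = w" using False outer_mult_vec[OF sv sv sw] Pv 
          by (simp add: v_def power2_norm_eq_inner[symmetric] power2_eq_square)
        finally show ?thesis .
      qed
      ultimately show ?thesis using True by (simp add: Q_def algebra_simps)
    next
      case False
      then have eq: "P * (A * unit_col k) = A * unit_col k" using P(4) that by simp
      have "v * adj v * (A * unit_col k) = v * (adj v * P) * (A * unit_col k)" 
        by (subst eq[symmetric]) (simp add: mult.assoc)
      then show ?thesis using eq Pv by (simp add: Q_def algebra_simps)
    qed
    then show ?thesis using Q sQ nQ by blast
  qed
qed

lemma ex_proj_range: 
  assumes "supp_in m n A"
  obtains P where "proj P" "(norm P)\<^sup>2 \<le> real n" "P * A = A"
proof -
  obtain P where P: "proj P" "supp_in m m P" "(norm P)\<^sup>2 \<le> real n" 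
    "\<forall>k<n. P * (A * unit_col k) = A * unit_col k" using ex_proj_cols[OF assms] by blast
  have "P * A = A"
    by (rule fmat_eqI_cols[OF supp_in_mult[OF P(2) assms] assms]) (use P(4) in \<open>simp add: mult.assoc\<close>)
  with P that show thesis by blast
qed

section \<open>The spectral theorem\<close>

declare One_nat_def [simp del]

text \<open>Horner evaluation of p(A)v. Only the action on \<open>v\<close> is formed, because the
  constant term of p(A) itself would require a unit in the ring, and \<open>fmat\<close> is not
  unital.\<close>

definition poly_apply :: "fmat \<Rightarrow> real poly \<Rightarrow> fmat \<Rightarrow> fmat" where
  "poly_apply A p v = fold_coeffs (\<lambda>a w. a *\<^sub>R v + A * w) p 0"

lemma poly_apply_0[simp]: "poly_apply A 0 v = 0" by (simp add: poly_apply_def)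

lemma poly_apply_pCons[simp]: "poly_apply A (pCons a p) v = a *\<^sub>R v + A * poly_apply A p v"
  by (cases "a = 0 \<and> p = 0") (auto simp: poly_apply_def)

lemma poly_apply_add: "poly_apply A (p + q) v = poly_apply A p v + poly_apply A q v"
proof (induction p arbitrary: q)
  case (pCons a p)
  obtain b r where "q = pCons b r" by (cases q) auto
  then show ?case by (simp add: pCons.IH algebra_simps)
qed simp

lemma poly_apply_smult: "poly_apply A (smult c p) v = c *\<^sub>R poly_apply A p v"
  by (induction p) (auto simp: algebra_simps)

lemma poly_apply_mult: "poly_apply A (p * q) v = poly_apply A p (poly_apply A q v)"
  by (induction p) (auto simp: poly_apply_add poly_apply_smult)

lemma poly_apply_monom: "poly_apply A (monom c n) v = c *\<^sub>R ((\<lambda>x. A * x) ^^ n) v"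
  by (induction n) (auto simp: monom_0 monom_Suc)

lemma poly_apply_diff: "poly_apply A (p - q) v = poly_apply A p v - poly_apply A q v"
  using poly_apply_add[of A "p - q" q v] by simp

lemma poly_apply_sum: "poly_apply A (sum f I) v = (\<Sum>i\<in>I. poly_apply A (f i) v)"
  by (induction I rule: infinite_finite_induct) (auto simp: poly_apply_add)

lemma vec_expand: assumes "supp_in m 1 v" shows "v = (\<Sum>i<m. ent v i 0 *\<^sub>R unit_col i)"
proof (rule fmat_eqI)
  fix i j :: nat
  have "(\<Sum>k<m. ent v k 0 * (if i = k \<and> j = 0 then 1 else 0)) = (\<Sum>k<m. if k = i then (if j = 0 then ent v i 0 else 0) else 0)"
    by (rule sum.cong) auto
  then show "ent v i j = ent (\<Sum>i<m. ent v i 0 *\<^sub>R unit_col i) i j"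
    by (auto simp: ent_sum ent_unit_col supp_inD[OF assms])
qed

lemma vec_in_span: assumes "supp_in m 1 v" shows "v \<in> span (unit_col ` {..<m})"
  by (subst vec_expand[OF assms]) (intro span_sum span_scale span_base imageI, simp)

text \<open>The m + 1 Krylov vectors w, Aw, ..., A^m w lie in a space spanned by m vectors, and a
  linear relation among them is such a polynomial.\<close>

lemma ex_annihilating_poly:
  assumes A: "supp_in m m A" and w: "supp_in m 1 w"
  shows "\<exists>p. p \<noteq> 0 \<and> poly_apply A p w = 0"
proof -
  define x where "x n = ((\<lambda>x. A * x) ^^ n) w" for n
  have sx: "supp_in m 1 (x n)" for n
    by (induction n) (use w in \<open>auto simp: x_def intro: supp_in_mult[OF A]\<close>)
  have xs: "x n \<in> span (unit_col ` {..<m})" for n by (rule vec_in_span[OF sx])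
  show ?thesis
  \<comment> \<open>Dependence is a property of the set of Krylov vectors and does not see
    repetitions, so a repeated vector is treated separately.\<close>
  proof (cases "inj_on x {..m}")
    case False
    then obtain i j where ij: "x i = x j" "i \<noteq> j" by (auto simp: inj_on_def)
    have "monom (1::real) i \<noteq> monom 1 j" using ij(2) by (metis degree_monom_eq one_neq_zero)
    moreover have "poly_apply A (monom 1 i - monom 1 j) w = 0" 
      using ij(1) by (simp add: poly_apply_diff poly_apply_monom x_def)
    ultimately show ?thesis by (intro exI[of _ "monom 1 i - monom 1 j"]) auto
  next
    case True
    have "dependent (x ` {..m})"
    proof (rule ccontr)
      assume "independent (x ` {..m})"
      from independent_span_bound[OF _ this, of "unit_col ` {..<m}"] xs
      have "card (x ` {..m}) \<le> card (unit_col ` {..<m})" by auto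
      also have "\<dots> \<le> m" using card_image_le[of "{..<m}" unit_col] by simp
      finally show False by (simp add: card_image[OF True])
    qed
    then obtain u where u: "\<exists>v\<in>x ` {..m}. u v \<noteq> 0" "(\<Sum>v\<in>x ` {..m}. u v *\<^sub>R v) = 0"
      using dependent_finite[of "x ` {..m}"] by auto
    define p where "p = (\<Sum>i\<le>m. monom (u (x i)) i)"
    have "poly_apply A p w = (\<Sum>i\<le>m. u (x i) *\<^sub>R x i)" by (simp add: p_def poly_apply_sum poly_apply_monom x_def)
    also have "\<dots> = 0" using u(2) by (simp add: sum.reindex[OF True] o_def)
    finally have "poly_apply A p w = 0" .
    moreover have "p \<noteq> 0"
    proof
      assume "p = 0"
      from u(1) obtain i where i: "i \<le> m" "u (x i) \<noteq> 0" by auto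
      have "coeff p i = (\<Sum>k\<le>m. if k = i then u (x i) else 0)" 
        unfolding p_def coeff_sum by (rule sum.cong) auto
      with i \<open>p = 0\<close> show False by simp
    qed
    ultimately show ?thesis by blast
  qed
qed

section \<open>Real polynomials at complex points\<close>

lemma cpoly_pCons: "poly (map_poly complex_of_real (pCons a p)) z 
    = complex_of_real a + z * poly (map_poly complex_of_real p) z"
  by (cases "a = 0 \<and> p = 0") (auto simp: map_poly_pCons)

lemma cpoly_add: "poly (map_poly complex_of_real (p + q)) z 
    = poly (map_poly complex_of_real p) z + poly (map_poly complex_of_real q) z"
proof (induction p arbitrary: q)
  case (pCons a p)
  obtain b r where "q = pCons b r" by (cases q) auto
  then show ?case by (simp add: pCons.IH cpoly_pCons algebra_simps)
qed simp

lemma cpoly_smult: "poly (map_poly complex_of_real (smult c p)) z 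
    = complex_of_real c * poly (map_poly complex_of_real p) z"
  by (induction p) (auto simp: cpoly_pCons algebra_simps)

lemma cpoly_mult: "poly (map_poly complex_of_real (p * q)) z 
    = poly (map_poly complex_of_real p) z * poly (map_poly complex_of_real q) z"
  by (induction p) (auto simp: cpoly_add cpoly_smult cpoly_pCons algebra_simps)

text \<open>The quadratic is (X - z)(X - conj z). The remainder modulo it has degree at most 1 and
  vanishes at the non-real point z, which forces both real coefficients to be 0.\<close>

lemma quadratic_dvd_of_complex_root:
  fixes p :: "real poly"
  assumes z: "poly (map_poly complex_of_real p) z = 0" and im: "Im z \<noteq> 0"
  shows "[:(cmod z)\<^sup>2, - 2 * Re z, 1:] dvd p"
proof -
  define s where "s = [:(cmod z)\<^sup>2, - 2 * Re z, 1:]"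
  have sz: "poly (map_poly complex_of_real s) z = 0"
    using cmod_power2[of z] unfolding s_def by (auto simp: complex_eq_iff algebra_simps power2_eq_square)
  define r where "r = p mod s"
  have s0: "s \<noteq> 0" "degree s = 2" by (auto simp: s_def)
  have p: "p = p div s * s + r" by (simp add: r_def)
  have rz: "poly (map_poly complex_of_real r) z = 0"
    using z sz by (subst (asm) p) (simp add: cpoly_add cpoly_mult)
  have "r = 0 \<or> degree r < 2" using degree_mod_less[of s p] s0 by (auto simp: r_def)
  then have "degree r \<le> 1" by auto
  then obtain a b where r: "r = [:a, b:]" 
    by (metis degree_pCons_eq_if degree_0_id le_zero_eq pCons_cases Suc_le_mono One_nat_def pCons_0_0)
  have "complex_of_real a + z * complex_of_real b = 0" using rz by (simp add: r cpoly_pCons)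
  then have "b * Im z = 0" "a + Re z * b = 0" by (auto simp: complex_eq_iff mult.commute)
  then have "r = 0" using im by (simp add: r)
  then show ?thesis using p by (metis add_0_right dvd_triv_right s_def)
qed

text \<open>Take an annihilating polynomial of least degree and split off a factor belonging to a
  complex root: the cofactor q no longer annihilates \<open>w\<close>, and q(A)w is an eigenvector
  if the root is real. Symmetry excludes a non-real root. The form q(A)w matters, because
  orthogonality of \<open>w\<close> to known eigenvectors passes to it.\<close>

lemma ex_poly_eigenvector:
  assumes A: "supp_in m m A" "adj A = A" and w: "supp_in m 1 w" "w \<noteq> 0"
  shows "\<exists>p l. poly_apply A p w \<noteq> 0 \<and> A * poly_apply A p w = l *\<^sub>R poly_apply A p w"
proof -
  obtain p where p: "p \<noteq> 0" "poly_apply A p w = 0" 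
    and min: "\<And>q. q \<noteq> 0 \<Longrightarrow> poly_apply A q w = 0 \<Longrightarrow> degree p \<le> degree q"
    using ex_has_least_nat[of "\<lambda>p. p \<noteq> 0 \<and> poly_apply A p w = 0" _ degree] ex_annihilating_poly[OF A(1) w(1)] 
    by blast
  have "degree p \<noteq> 0"
  proof
    assume "degree p = 0"
    then obtain c where "p = [:c:]" by (metis degree_eq_zeroE)
    with p w(2) show False by simp
  qed
  then have "\<not> constant (poly (map_poly complex_of_real p))" 
    by (simp add: constant_degree)
  then obtain z where z: "poly (map_poly complex_of_real p) z = 0" 
    using fundamental_theorem_of_algebra by blast
  show ?thesis
  proof (cases "Im z = 0")
    case True
    then have "z = complex_of_real (Re z)" by (simp add: complex_eq_iff)
    then have "complex_of_real (poly p (Re z)) = 0" using z by (metis of_real_hom.poly_map_poly)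
    then have "[:- Re z, 1:] dvd p" by (simp add: poly_eq_0_iff_dvd)
    then obtain q where q: "p = [:- Re z, 1:] * q" by auto
    then have "q \<noteq> 0" using p(1) by auto
    then have "degree p = Suc (degree q)" unfolding q by (subst degree_mult_eq) auto
    then have "poly_apply A q w \<noteq> 0" using min[OF \<open>q \<noteq> 0\<close>] by auto
    moreover have "A * poly_apply A q w = Re z *\<^sub>R poly_apply A q w"
      using p(2) unfolding q poly_apply_mult by (simp add: algebra_simps)
    ultimately show ?thesis by blast
  next
    case False
    obtain q where q: "p = [:(cmod z)\<^sup>2, - 2 * Re z, 1:] * q" 
      using quadratic_dvd_of_complex_root[OF z False] by auto
    then have "q \<noteq> 0" using p(1) by auto
    then have "degree p = 2 + degree q" unfolding q by (subst degree_mult_eq) auto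
    then have v0: "poly_apply A q w \<noteq> 0" using min[OF \<open>q \<noteq> 0\<close>] by auto
    define v where "v = poly_apply A q w"
    have "(cmod z)\<^sup>2 *\<^sub>R v + A * ((- 2 * Re z) *\<^sub>R v + A * v) = 0"
      using p(2) unfolding q poly_apply_mult v_def by simp
    then have "inner v ((cmod z)\<^sup>2 *\<^sub>R v + A * ((- 2 * Re z) *\<^sub>R v + A * v)) = 0" by simp
    then have "(cmod z)\<^sup>2 * inner v v + ((- 2 * Re z) * inner v (A * v) + inner v (A * (A * v))) = 0"
      by (simp only: distrib_left inner_add_right mult_scaleR_right inner_scaleR_right)
    moreover have "inner v (A * (A * v)) = (norm (A * v))\<^sup>2"
      by (simp add: power2_norm_eq_inner inner_mult_left A(2))
    ultimately have eq: "(cmod z)\<^sup>2 * (norm v)\<^sup>2 - 2 * Re z * inner v (A * v) + (norm (A * v))\<^sup>2 = 0"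
      by (simp add: power2_norm_eq_inner[of v])
    \<comment> \<open>Completing the square turns the quadratic relation into a vanishing sum of two
      squares, one of them positive.\<close>
    have "(norm (A * v - Re z *\<^sub>R v))\<^sup>2 = (norm (A * v))\<^sup>2 - 2 * Re z * inner v (A * v) + (Re z)\<^sup>2 * (norm v)\<^sup>2"
      using dot_norm_neg[of "A * v" "Re z *\<^sub>R v"] by (simp add: inner_commute power_mult_distrib)
    with eq have "(norm (A * v - Re z *\<^sub>R v))\<^sup>2 + (Im z)\<^sup>2 * (norm v)\<^sup>2 = 0"
      by (simp add: cmod_power2 algebra_simps)
    then have "(Im z)\<^sup>2 * (norm v)\<^sup>2 \<le> 0"
      using zero_le_power2[of "norm (A * v - Re z *\<^sub>R v)"] by linarith
    moreover have "(Im z)\<^sup>2 * (norm v)\<^sup>2 > 0" using False v0 by (simp add: v_def)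
    ultimately show ?thesis by simp
  qed
qed

lemma norm_sq_sum_orthonormal:
  assumes "\<And>i j. i < k \<Longrightarrow> j < k \<Longrightarrow> inner (u i) (u j) = (if i = j then 1 else 0)"
    and "\<And>i. i < (k::nat) \<Longrightarrow> supp_in m 1 (u i)" and "I \<subseteq> {..<k}"
  shows "(norm (\<Sum>i\<in>I. f i *\<^sub>R (u i * adj (u i))))\<^sup>2 = (\<Sum>i\<in>I. (f i)\<^sup>2)"
proof -
  have fin: "finite I" using assms(3) finite_subset by blast
  have "(norm (\<Sum>i\<in>I. f i *\<^sub>R (u i * adj (u i))))\<^sup>2 
     = (\<Sum>i\<in>I. \<Sum>j\<in>I. f i * f j * (inner (u i) (u j) * inner (u i) (u j)))"
    unfolding power2_norm_eq_inner inner_sum_left inner_sum_right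
    by (intro sum.cong refl) (use assms in \<open>simp add: inner_outer_outer[where m=m and n=m] subset_iff\<close>)
  also have "\<dots> = (\<Sum>i\<in>I. \<Sum>j\<in>I. if j = i then f i * f i else 0)"
    by (intro sum.cong refl) (use assms in \<open>auto simp: subset_iff\<close>)
  finally show ?thesis using fin by (simp add: power2_eq_square)
qed

text \<open>Functional calculus: over a fixed orthonormal family, matrices are multiplied by
  multiplying their coefficient functions.\<close>

lemma outer_sum_mult:
  assumes "\<And>i j. i < k \<Longrightarrow> j < k \<Longrightarrow> inner (u i) (u j) = (if i = j then 1 else 0)"
    and "\<And>i. i < (k::nat) \<Longrightarrow> supp_in m 1 (u i)"
  shows "(\<Sum>i<k. f i *\<^sub>R (u i * adj (u i))) * (\<Sum>i<k. g i *\<^sub>R (u i * adj (u i))) 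
    = (\<Sum>i<k. (f i * g i) *\<^sub>R (u i * adj (u i)))"
proof -
  have "(\<Sum>i<k. f i *\<^sub>R (u i * adj (u i))) * (\<Sum>i<k. g i *\<^sub>R (u i * adj (u i)))
     = (\<Sum>i<k. \<Sum>j<k. (f i * g j * inner (u i) (u j)) *\<^sub>R (u i * adj (u j)))"
    unfolding sum_product
    by (intro sum.cong refl) (use assms in \<open>simp add: outer_mult_outer[where m=m and n=m] mult.commute\<close>)
  also have "\<dots> = (\<Sum>i<k. \<Sum>j<k. if j = i then (f i * g i) *\<^sub>R (u i * adj (u i)) else 0)"
    by (intro sum.cong refl) (use assms in auto)
  finally show ?thesis by simp
qed

text \<open>One eigenvector is added at a time: start from a nonzero vector orthogonal to those
  already found. Its whole Krylov space stays orthogonal to them and contains an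
  eigenvector.\<close>

lemma spectral_aux:
  assumes A: "supp_in m m A" "adj A = A" 
  shows "k \<le> m \<Longrightarrow> \<exists>u l. (\<forall>i<k. supp_in m 1 (u i) \<and> A * u i = l i *\<^sub>R u i) \<and>
     (\<forall>i<k. \<forall>j<k. inner (u i) (u j) = (if i = j then 1 else 0))"
proof (induction k)
  case 0
  then show ?case by auto
next
  case (Suc k)
  then obtain u l where *: "\<forall>i<k. supp_in m 1 (u i) \<and> A * u i = l i *\<^sub>R u i"
     "\<forall>i<k. \<forall>j<k. inner (u i) (u j) = (if i = j then 1 else 0)" using Suc_leD by blast
  have u: "\<And>i. i < k \<Longrightarrow> supp_in m 1 (u i)" "\<And>i. i < k \<Longrightarrow> A * u i = l i *\<^sub>R u i"
     "\<And>i j. i < k \<Longrightarrow> j < k \<Longrightarrow> inner (u i) (u j) = (if i = j then 1 else 0)"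
    using * by auto
  define P where "P = (\<Sum>i<k. 1 *\<^sub>R (u i * adj (u i)))"
  have nP: "(norm P)\<^sup>2 = k" unfolding P_def 
    by (subst norm_sq_sum_orthonormal[where k=k and m=m]) (use u in auto)
  have sP: "supp_in m m P" unfolding P_def
    by (rule supp_in_sum) (use u(1) in \<open>auto intro!: supp_in_mult supp_in_adj supp_in_scaleR\<close>)
  \<comment> \<open>Otherwise \<open>P\<close> would be \<open>idm m\<close>, although its squared
    norm \<open>k\<close> is smaller than \<open>m\<close>.\<close>
  have "\<exists>j<m. unit_col j - P * unit_col j \<noteq> 0"
  proof (rule ccontr)
    assume "\<not> (\<exists>j<m. unit_col j - P * unit_col j \<noteq> 0)"
    then have "P * unit_col j = idm m * unit_col j" if "j < m" for j
      using that by (simp add: idm_eq_diagm diagm_mult_unit_col)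
    then have "P = idm m" by (intro fmat_eqI_cols[OF sP supp_in_diagm[of m "\<lambda>_. 1", folded idm_eq_diagm]]) auto
    then show False using nP norm_idm_sq[of m] Suc(2) by simp
  qed
  then obtain j where j: "j < m" "unit_col j - P * unit_col j \<noteq> 0" by blast
  define w where "w = unit_col j - P * unit_col j"
  have sw: "supp_in m 1 w" unfolding w_def 
    by (intro supp_in_diff supp_in_mult[OF sP supp_in_unit_col[OF j(1)]] supp_in_unit_col j)
  have uP: "P * u i = u i" if "i < k" for i
  proof -
    have "P * u i = (\<Sum>j<k. inner (u j) (u i) *\<^sub>R u j)"
      unfolding P_def sum_distrib_right
      by (intro sum.cong refl) (use u(1) that in \<open>simp add: outer_mult_vec[where m=m and n=m]\<close>)
    also have "\<dots> = (\<Sum>j<k. if j = i then u i else 0)" 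
      by (intro sum.cong refl) (use u(3) that in auto)
    finally show ?thesis using that by simp
  qed
  have trP: "adj P = P" by (simp add: P_def adj_sum adj_mult)
  have orth: "inner (u i) w = 0" if "i < k" for i
    unfolding w_def inner_diff_right 
    using inner_mult_left[of P "u i" "unit_col j"] by (simp add: uP[OF that] trP)
  obtain p c where pc: "poly_apply A p w \<noteq> 0" "A * poly_apply A p w = c *\<^sub>R poly_apply A p w" 
    using ex_poly_eigenvector[OF A sw] j(2) unfolding w_def by blast
  define v where "v = poly_apply A p w"
  have ov: "inner (u i) (poly_apply A q w) = 0" if "i < k" for i q
  proof (induction q)
    case (pCons a q)
    have "inner (u i) (A * poly_apply A q w) = inner (A * u i) (poly_apply A q w)" 
      by (simp add: inner_mult_left A(2))
    then show ?case using u(2)[OF that] orth[OF that] pCons by (simp add: inner_add_right)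
  qed simp
  have sv: "supp_in m 1 (poly_apply A q w)" for q
    by (induction q) (auto intro!: supp_in_add supp_in_scaleR sw supp_in_mult[OF A(1)])
  define v' where "v' = (1 / norm v) *\<^sub>R v"
  have v0: "v \<noteq> 0" using pc v_def by simp
  have v': "supp_in m 1 v'" "A * v' = c *\<^sub>R v'" "inner v' v' = 1" "\<And>i. i < k \<Longrightarrow> inner (u i) v' = 0"
    unfolding v'_def using sv[of p] pc ov[of _ p, folded v_def] v0
    by (auto simp: v_def[symmetric] power2_norm_eq_inner[symmetric] power2_eq_square intro: supp_in_scaleR)
  show ?case
    by (rule exI[of _ "u(k := v')"], rule exI[of _ "l(k := c)"])
      (use u v' in \<open>auto simp: less_Suc_eq inner_commute\<close>)
qed

theorem spectral:
  assumes A: "supp_in m m A" "adj A = A"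
  obtains u l where "\<And>i. i < m \<Longrightarrow> supp_in m 1 (u i)" "\<And>i. i < m \<Longrightarrow> A * u i = l i *\<^sub>R u i"
     "\<And>i j. i < m \<Longrightarrow> j < m \<Longrightarrow> inner (u i) (u j) = (if i = j then 1 else 0)"
     "(\<Sum>i<m. u i * adj (u i)) = idm m"
proof -
  obtain u l where *: "\<forall>i<m. supp_in m 1 (u i) \<and> A * u i = l i *\<^sub>R u i"
     "\<forall>i<m. \<forall>j<m. inner (u i) (u j) = (if i = j then 1 else 0)" using spectral_aux[OF A, of m] by blast
  have u: "\<And>i. i < m \<Longrightarrow> supp_in m 1 (u i)" "\<And>i. i < m \<Longrightarrow> A * u i = l i *\<^sub>R u i"
     "\<And>i j. i < m \<Longrightarrow> j < m \<Longrightarrow> inner (u i) (u j) = (if i = j then 1 else 0)"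
    using * by auto
  define P where "P = (\<Sum>i<m. 1 *\<^sub>R (u i * adj (u i)))"
  have nP: "(norm P)\<^sup>2 = m" unfolding P_def 
    by (subst norm_sq_sum_orthonormal[where k=m and m=m]) (use u in auto)
  have sP: "supp_in m m P" unfolding P_def
    by (rule supp_in_sum) (use u(1) in \<open>auto intro!: supp_in_mult supp_in_adj supp_in_scaleR\<close>)
  have "proj P" unfolding proj_def 
    using outer_sum_mult[OF u(3) u(1), where f="\<lambda>_. 1" and g="\<lambda>_. 1"] by (simp add: P_def adj_sum adj_mult)
  \<comment> \<open>\<open>P\<close> and \<open>idm m\<close> have the same squared norm
    \<open>m\<close>, so nothing is left for their difference.\<close>
  from proj_pythagoras[OF this, of "idm m"] have "(norm (idm m - P))\<^sup>2 = 0"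
    by (simp add: mult_idm[OF sP] nP norm_idm_sq)
  then have "P = idm m" by simp
  then show thesis by (intro that[of u l] u) (simp_all add: P_def)
qed

section \<open>Resolvents and best approximation\<close>

text \<open>Independence of a family is phrased through coefficients, which also yields injectivity
  of \<open>f\<close>; the exchange bound for sets then applies to the image of
  \<open>J\<close>.\<close>

lemma dim_bound:
  fixes f :: "'i \<Rightarrow> fmat"
  assumes J: "finite J" and S: "finite S" "\<And>j. j \<in> J \<Longrightarrow> f j \<in> span S"
    and inj: "\<And>c j. (\<Sum>i\<in>J. c i *\<^sub>R f i) = 0 \<Longrightarrow> j \<in> J \<Longrightarrow> c j = 0"
  shows "card J \<le> card S"
proof -
  have inj_f: "inj_on f J"
  proof (rule inj_onI, rule ccontr)
    fix i j assume ij: "i \<in> J" "j \<in> J" "f i = f j" "i \<noteq> j"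
    have "(\<Sum>k\<in>J. ((if k = i then 1 else 0) - (if k = j then 1 else 0)) *\<^sub>R f k)
       = (\<Sum>k\<in>J. if k = i then f k else 0) - (\<Sum>k\<in>J. if k = j then f k else 0)"
      unfolding sum_subtractf[symmetric] by (intro sum.cong) auto
    also have "\<dots> = 0" using ij J by (simp add: sum.delta)
    finally show False using inj[OF _ ij(1)] ij(4) by fastforce
  qed
  have "independent (f ` J)"
  proof
    assume "dependent (f ` J)"
    then obtain u where u: "\<exists>v\<in>f ` J. u v \<noteq> 0" "(\<Sum>v\<in>f ` J. u v *\<^sub>R v) = 0"
      using dependent_finite[of "f ` J"] J by auto
    have "(\<Sum>i\<in>J. u (f i) *\<^sub>R f i) = 0" using u(2) by (simp add: sum.reindex[OF inj_f] o_def)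
    from inj[OF this] u(1) show False by auto
  qed
  from independent_span_bound[OF S(1) this] S(2) have "card (f ` J) \<le> card S" by auto
  then show ?thesis by (simp add: card_image[OF inj_f])
qed

text \<open>Write S(f) for the sum. With g = sqrt(r^2 - f^2), functional calculus gives S(g)^2 = r^2
  I - S(f)^2, and the left side is positive semidefinite.\<close>

lemma opnorm_le_outer_sum:
  assumes u: "\<And>i j. i < m \<Longrightarrow> j < m \<Longrightarrow> inner (u i) (u j) = (if i = j then 1 else 0)"
    "\<And>i. i < m \<Longrightarrow> supp_in m 1 (u i)" "(\<Sum>i<m. u i * adj (u i)) = idm m"
    and f: "\<And>i. i < m \<Longrightarrow> \<bar>f i\<bar> \<le> r" and r: "0 \<le> r"
  shows "opnorm_le (\<Sum>i<m. f i *\<^sub>R (u i * adj (u i))) r"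
  unfolding opnorm_le_def
proof
  fix B
  define S where "S g = (\<Sum>i<m. g i *\<^sub>R (u i * adj (u i)))" for g :: "nat \<Rightarrow> real"
  have S_mult: "S g * S h = S (\<lambda>i. g i * h i)" for g h
    unfolding S_def by (rule outer_sum_mult[OF u(1,2)]) auto
  have S_adj: "adj (S g) = S g" for g by (simp add: S_def adj_sum adj_scaleR adj_mult)
  have inner_S: "inner (S g * B) (S g * B) = inner B (S (\<lambda>i. g i * g i) * B)" for g
    by (simp add: inner_mult_left S_adj mult.assoc[symmetric] S_mult)
  define g where "g i = sqrt (r\<^sup>2 - (f i)\<^sup>2)" for i
  have gg: "g i * g i = r\<^sup>2 - f i * f i" if "i < m" for i
    using f[OF that] by (simp add: g_def abs_le_square_iff[symmetric] power2_eq_square)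
       (metis abs_le_square_iff abs_of_nonneg diff_ge_0_iff_ge power2_eq_square r real_sqrt_mult_self abs_of_nonneg)
  have "S (\<lambda>i. g i * g i) = (\<Sum>i<m. r\<^sup>2 *\<^sub>R (u i * adj (u i)) - (f i * f i) *\<^sub>R (u i * adj (u i)))"
    unfolding S_def by (intro sum.cong refl) (simp add: gg scaleR_left_diff_distrib)
  also have "\<dots> = r\<^sup>2 *\<^sub>R idm m - S (\<lambda>i. f i * f i)"
    unfolding S_def sum_subtractf by (simp add: u(3)[symmetric] scaleR_sum_right)
  finally have eq: "S (\<lambda>i. g i * g i) = r\<^sup>2 *\<^sub>R idm m - S (\<lambda>i. f i * f i)" .
  have "0 \<le> inner (S g * B) (S g * B)" by simp
  also have "\<dots> = r\<^sup>2 * inner B (idm m * B) - inner (S f * B) (S f * B)"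
    unfolding inner_S eq by (simp add: left_diff_distrib inner_diff_right)
  finally have "(norm (S f * B))\<^sup>2 \<le> r\<^sup>2 * inner B (idm m * B)" by (simp add: power2_norm_eq_inner)
  also have "\<dots> \<le> r\<^sup>2 * (norm B)\<^sup>2"
  proof (rule mult_left_mono)
    have "inner B (idm m * B) \<le> norm B * norm (idm m * B)" by (rule norm_cauchy_schwarz)
    also have "\<dots> \<le> norm B * norm B" using opbD[OF proj_opnorm_le[OF proj_idm]] by (simp add: mult_left_mono)
    finally show "inner B (idm m * B) \<le> (norm B)\<^sup>2" by (simp add: power2_eq_square)
  qed simp
  finally show "norm ((\<Sum>i<m. f i *\<^sub>R (u i * adj (u i))) * B) \<le> r * norm B"
    unfolding S_def[symmetric] by (metis power_mult_distrib power2_le_imp_le mult_nonneg_nonneg norm_ge_zero r)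
qed

section \<open>Carrier matrices as \<open>fmat\<close>, and the inverse of I - S\<close>

definition of_mat :: "real mat \<Rightarrow> fmat" where
  "of_mat A = mk_fmat (dim_row A) (dim_col A) (\<lambda>i j. A $$ (i, j))"

lemma ent_of_mat: "A \<in> carrier_mat m n \<Longrightarrow> ent (of_mat A) i j = (if i < m \<and> j < n then A $$ (i, j) else 0)"
  by (auto simp: of_mat_def ent_mk_fmat)

lemma supp_in_of_mat: "A \<in> carrier_mat m n \<Longrightarrow> supp_in m n (of_mat A)"
  by (auto simp: of_mat_def supp_in_mk_fmat)

lemma of_mat_mult: 
  assumes "A \<in> carrier_mat m n" "B \<in> carrier_mat n k" shows "of_mat (A * B) = of_mat A * of_mat B"
proof (rule fmat_eqI)
  fix i j
  have AB: "A * B \<in> carrier_mat m k" using assms by simp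
  show "ent (of_mat (A * B)) i j = ent (of_mat A * of_mat B) i j"
    using assms unfolding ent_mult[OF supp_in_of_mat[OF assms(1)]] ent_of_mat[OF AB]
    by (auto simp: ent_of_mat[OF assms(1)] ent_of_mat[OF assms(2)] scalar_prod_def atLeast0LessThan intro!: sum.cong)
qed

lemma of_mat_transpose: "of_mat (transpose_mat A) = adj (of_mat A)"
  by (rule fmat_eqI) (auto simp: of_mat_def ent_mk_fmat)

lemma of_mat_one: "of_mat (1\<^sub>m n) = idm n"
  by (rule fmat_eqI) (auto simp: of_mat_def ent_mk_fmat idm_def)

lemma ex_of_mat: assumes "supp_in m n A" obtains B where "B \<in> carrier_mat m n" "A = of_mat B"
proof
  show "mat m n (\<lambda>(i, j). ent A i j) \<in> carrier_mat m n" by simp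
  show "A = of_mat (mat m n (\<lambda>(i, j). ent A i j))"
    by (rule fmat_eqI) (auto simp: of_mat_def ent_mk_fmat supp_inD[OF assms] not_less)
qed

text \<open>I + B is the inverse of I - S; since the ring has no unit, the two inverse laws are
  written as equations for \<open>B\<close> alone. A kernel vector of I - S would be fixed by S,
  which is impossible for operator norm below 1, so the determinant does not vanish.\<close>

lemma ex_resolvent:
  assumes S: "supp_in m m S" and s: "opnorm_le S s" "s < 1"
  obtains B where "supp_in m m B" "B = S + S * B" "B = S + B * S"
proof -
  have "supp_in m m (idm m - S)" by (intro supp_in_diff S) (simp add: idm_eq_diagm supp_in_diagm)
  then obtain A where A: "A \<in> carrier_mat m m" "idm m - S = of_mat A" by (rule ex_of_mat)
  have "det A \<noteq> 0"
  proof
    assume "det A = 0"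
    then obtain v where v: "v \<in> carrier_vec m" "v \<noteq> 0\<^sub>v m" "A *\<^sub>v v = 0\<^sub>v m"
      using det_0_iff_vec_prod_zero[OF A(1)] by blast
    define C where "C = mat m 1 (\<lambda>(i, j). v $ i)"
    have C: "C \<in> carrier_mat m 1" by (simp add: C_def)
    have "A * C = 0\<^sub>m m 1"
    proof (rule eq_matI)
      fix i j assume ij: "i < dim_row (0\<^sub>m m 1 :: real mat)" "j < dim_col (0\<^sub>m m 1 :: real mat)"
      have "col C j = v" using ij v(1) by (intro eq_vecI) (auto simp: C_def)
      then have "(A * C) $$ (i, j) = (A *\<^sub>v v) $ i" using A C ij by auto
      then show "(A * C) $$ (i, j) = 0\<^sub>m m 1 $$ (i, j)" using v(3) ij by simp
    qed (use A C in auto)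
    then have "of_mat A * of_mat C = of_mat (0\<^sub>m m 1)" by (simp add: of_mat_mult[OF A(1) C, symmetric])
    also have "of_mat (0\<^sub>m m 1) = 0" by (rule fmat_eqI) (auto simp: of_mat_def ent_mk_fmat)
    finally have "(idm m - S) * of_mat C = 0" by (simp add: A(2))
    then have eq: "of_mat C = S * of_mat C" 
      by (simp add: left_diff_distrib idm_mult[OF supp_in_of_mat[OF C]])
    have "norm (of_mat C) \<le> s * norm (of_mat C)" using opbD[OF s(1), of "of_mat C"] eq by simp
    then have "(1 - s) * norm (of_mat C) \<le> 0" by (simp add: algebra_simps)
    then have "of_mat C = 0" using s(2) by (simp add: mult_le_0_iff)
    have "v = 0\<^sub>v m"
    proof (rule eq_vecI)
      fix i assume i: "i < dim_vec (0\<^sub>v m :: real vec)"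
      have "ent (of_mat C) i 0 = v $ i" using i C by (simp add: ent_of_mat[OF C]) (simp add: C_def)
      with \<open>of_mat C = 0\<close> i show "v $ i = 0\<^sub>v m $ i" by simp
    qed (use v in auto)
    with v show False by simp
  qed
  then have "A \<in> Units (ring_mat TYPE(real) m ())" by (rule det_non_zero_imp_unit[OF A(1)])
  then obtain A' where c: "A' \<in> carrier_mat m m" and A': "A * A' = 1\<^sub>m m" "A' * A = 1\<^sub>m m"
    unfolding Units_def ring_mat_def by auto
  have i1: "(idm m - S) * of_mat A' = idm m" and i2: "of_mat A' * (idm m - S) = idm m"
    unfolding A(2) by (simp_all add: of_mat_mult[OF A(1) c, symmetric] of_mat_mult[OF c A(1), symmetric] A' of_mat_one)
  define B where "B = of_mat A' - idm m"
  have sA: "supp_in m m (of_mat A')" by (rule supp_in_of_mat[OF c])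
  show thesis
  proof (rule that[of B])
    show "supp_in m m B" unfolding B_def by (intro supp_in_diff sA) (simp add: idm_eq_diagm supp_in_diagm)
    show "B = S + S * B" using i1 unfolding B_def 
      by (simp add: algebra_simps idm_mult[OF sA] mult_idm[OF S])
    show "B = S + B * S" using i2 unfolding B_def 
      by (simp add: algebra_simps mult_idm[OF sA] idm_mult[OF S])
  qed
qed

text \<open>With a threshold \<open>b\<close> separating the first K values from the others, each
  term is at most max(s_k - b, 0) + b w_k; the total weight K then restores the sum of the first K
  values.\<close>

lemma sum_top_weights_le:
  fixes s w :: "nat \<Rightarrow> real"
  assumes "K \<le> m" and s: "\<And>k. k < m \<Longrightarrow> 0 \<le> s k" "\<And>k l. k \<le> l \<Longrightarrow> l < m \<Longrightarrow> s l \<le> s k"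
    and w: "\<And>k. k < m \<Longrightarrow> 0 \<le> w k" "\<And>k. k < m \<Longrightarrow> w k \<le> 1" "(\<Sum>k<m. w k) \<le> real K"
  shows "(\<Sum>k<m. s k * w k) \<le> (\<Sum>k<K. s k)"
proof -
  define b where "b = (if K = 0 then s 0 else s (K - 1))"
  have "s k * w k \<le> (if k < K then s k - b else 0) + b * w k" if "k < m" for k
  proof (cases "k < K")
    case True
    then have "b \<le> s k" using s(2)[of k "K - 1"] assms(1) by (auto simp: b_def)
    then have "(s k - b) * w k \<le> s k - b" using w(2)[OF that] by (simp add: mult_left_le)
    then show ?thesis using True by (simp add: algebra_simps)
  next
    case False
    then have "s k \<le> b" using s(2)[of "K - 1" k] s(2)[of 0 k] that by (auto simp: b_def)
    then show ?thesis using False w(1)[OF that] by (simp add: mult_right_mono)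
  qed
  then have "(\<Sum>k<m. s k * w k) \<le> (\<Sum>k<m. (if k < K then s k - b else 0) + b * w k)"
    by (intro sum_mono) auto
  also have "\<dots> = (\<Sum>k<K. s k - b) + b * (\<Sum>k<m. w k)"
  proof -
    have "(\<Sum>k<m. if k < K then s k - b else 0) = (\<Sum>k<K. s k - b)"
      using assms(1) by (intro sum.mono_neutral_cong_right) auto
    then show ?thesis by (simp add: sum.distrib sum_distrib_left)
  qed
  also have "b * (\<Sum>k<m. w k) \<le> b * real K"
  proof (cases "m = 0")
    case False
    then have "0 \<le> b" using s(1) assms(1) by (auto simp: b_def)
    then show ?thesis by (rule mult_left_mono[OF w(3)])
  qed (use assms(1) in simp)
  also have "(\<Sum>k<K. s k - b) + b * real K = (\<Sum>k<K. s k)" by (simp add: sum_subtractf)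
  finally show ?thesis by simp
qed

text \<open>The squared norm of \<open>Q * N\<close> is the sum of s_k^2 |Q u_k|^2. The weights |Q
  u_k|^2 are at most 1 and sum to at most K, and \<open>P\<close> puts weight 1 on exactly the K
  largest s_k. By Pythagoras a larger projected part means a smaller residual.\<close>

lemma eckart_young:
  assumes U: "supp_in m m U" "adj U * U = idm m" "U * adj U = idm m"
    and W: "supp_in m m W" "adj W * W = idm m"
    and s: "\<And>k. k < m \<Longrightarrow> 0 \<le> s k" "\<And>k l. k \<le> l \<Longrightarrow> l < m \<Longrightarrow> s l \<le> s k"
    and N: "N = U * diagm m s * adj W" and K: "K \<le> m"
    and P: "P = U * diagm m (\<lambda>k. if k < K then 1 else 0) * adj U"
    and Q: "proj Q" "(norm Q)\<^sup>2 \<le> real K"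
  shows "norm (N - P * N) \<le> norm (N - Q * N)"
proof -
  define J where "J = diagm m (\<lambda>k. if k < K then 1 else (0::real))"
  have JJ: "J * J = J" unfolding J_def diagm_mult_diagm by (rule fmat_eqI) (auto simp: ent_diagm)
  have sJ: "supp_in m m J" by (simp add: J_def supp_in_diagm)
  have pP: "proj P"
  proof -
    have "P * P = U * J * (adj U * U) * J * adj U" by (simp add: P J_def[symmetric] mult.assoc)
    also have "\<dots> = U * (J * idm m * J) * adj U" by (simp add: U(2) mult.assoc)
    also have "\<dots> = P" by (simp add: mult_idm[OF sJ] JJ P J_def[symmetric])
    finally show ?thesis unfolding proj_def by (simp add: P adj_mult mult.assoc)
  qed
  have norm_W: "norm (A * adj W) = norm A" if "supp_in n m A" for A n
  proof -
    have "(norm (A * adj W))\<^sup>2 = inner A (A * adj W * W)" 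
      by (simp add: power2_norm_eq_inner inner_mult_right)
    also have "\<dots> = (norm A)\<^sup>2" by (simp add: mult.assoc W(2) mult_idm[OF that] power2_norm_eq_inner)
    finally show ?thesis by simp
  qed
  have norm_QN: "(norm (A * N))\<^sup>2 = (\<Sum>k<m. (s k)\<^sup>2 * (norm (A * U * unit_col k))\<^sup>2)" for A
  proof -
    obtain n where n: "supp_in n n A" using ex_supp by blast
    have s1: "supp_in n m (A * U * diagm m s)" by (rule supp_in_mult[OF supp_in_mult[OF n U(1)] supp_in_diagm])
    have "(norm (A * N))\<^sup>2 = (norm (A * U * diagm m s))\<^sup>2" 
      using norm_W[OF s1] by (simp add: N mult.assoc)
    also have "\<dots> = (\<Sum>k<m. (norm (A * U * (diagm m s * unit_col k)))\<^sup>2)"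
      unfolding norm_sq_eq_cols[OF s1] by (simp add: mult.assoc)
    also have "\<dots> = (\<Sum>k<m. (s k)\<^sup>2 * (norm (A * U * unit_col k))\<^sup>2)"
      by (intro sum.cong refl) (simp add: diagm_mult_unit_col power_mult_distrib)
    finally show ?thesis .
  qed
  have nU: "norm (U * unit_col k) = 1" if "k < m" for k
  proof -
    have "(norm (U * unit_col k))\<^sup>2 = inner (unit_col k) (adj U * U * unit_col k)"
      by (simp add: power2_norm_eq_inner inner_mult_left mult.assoc)
    also have "\<dots> = 1" using that by (simp add: U(2) idm_eq_diagm diagm_mult_unit_col inner_unit_col_unit_col)
    finally show ?thesis by (simp add: power2_eq_1_iff) (metis norm_ge_zero not_one_le_zero neg_0_le_iff_le order_trans)
  qed
  have PU: "P * U * unit_col k = (if k < K then 1 else 0) *\<^sub>R (U * unit_col k)" if "k < m" for k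
  proof -
    have "P * U * unit_col k = U * (J * (adj U * U * unit_col k))" by (simp add: P J_def[symmetric] mult.assoc)
    also have "\<dots> = (if k < K then 1 else 0) *\<^sub>R (U * unit_col k)" 
      using that by (simp add: U(2) idm_eq_diagm diagm_mult_unit_col J_def)
    finally show ?thesis .
  qed
  have "(norm (P * N))\<^sup>2 = (\<Sum>k<m. if k < K then (s k)\<^sup>2 else 0)"
    unfolding norm_QN by (intro sum.cong refl) (simp add: PU nU)
  also have "\<dots> = (\<Sum>k<K. (s k)\<^sup>2)" using K by (intro sum.mono_neutral_cong_right) auto
  finally have PN: "(norm (P * N))\<^sup>2 = (\<Sum>k<K. (s k)\<^sup>2)" .
  have "(norm (Q * N))\<^sup>2 \<le> (\<Sum>k<K. (s k)\<^sup>2)"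
    unfolding norm_QN
  proof (rule sum_top_weights_le[OF K])
    show "0 \<le> (s k)\<^sup>2" for k by simp
    show "(s l)\<^sup>2 \<le> (s k)\<^sup>2" if "k \<le> l" "l < m" for k l 
      using s that by (intro power_mono) auto
    show "0 \<le> (norm (Q * U * unit_col k))\<^sup>2" for k by simp
    show "(norm (Q * U * unit_col k))\<^sup>2 \<le> 1" if "k < m" for k
      using opbD[OF proj_opnorm_le[OF Q(1)], of "U * unit_col k"] nU[OF that] by (simp add: mult.assoc power_le_one)
    obtain n where n: "supp_in n n Q" using ex_supp by blast
    have "(\<Sum>k<m. (norm (Q * U * unit_col k))\<^sup>2) = (norm (Q * U))\<^sup>2"
      by (rule norm_sq_eq_cols[symmetric]) (rule supp_in_mult[OF n U(1)])
    also have "\<dots> \<le> (norm Q)\<^sup>2"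
    proof -
      have "opnorm_le U 1" by (rule opnorm_le_isometry[OF U(2)])
      from opnorm_le_right[OF this, of Q] show ?thesis by (simp add: power_mono)
    qed
    finally show "(\<Sum>k<m. (norm (Q * U * unit_col k))\<^sup>2) \<le> real K" using Q(2) by simp
  qed
  with PN have "(norm (Q * N))\<^sup>2 \<le> (norm (P * N))\<^sup>2" by simp
  then have "(norm (N - P * N))\<^sup>2 \<le> (norm (N - Q * N))\<^sup>2"
    using proj_pythagoras[OF pP, of N] proj_pythagoras[OF Q(1), of N] by linarith
  then show ?thesis by (rule power2_le_imp_le) simp
qed

section \<open>Spectral projectors of a diagonally perturbed incoherent matrix\<close>

text \<open>The signal after division by its smallest nonzero eigenvalue: \<open>lam\<close> then
  starts at 1, \<open>kap\<close> bounds the condition number and \<open>mu\<close> the squared row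
  norms of \<open>V\<close>. The number 1/10000 becomes the constant c of the theorem.\<close>

locale incoherent =
  fixes m K :: nat and V :: fmat and lam :: "nat \<Rightarrow> real" and kap mu :: real
  assumes supp_V: "supp_in m K V" and VV: "adj V * V = idm K"
    and lam: "\<And>i. i < K \<Longrightarrow> 1 \<le> lam i" "\<And>i. i < K \<Longrightarrow> lam i \<le> kap"
    and kap: "1 \<le> kap" and mu: "0 \<le> mu" "mu * kap \<le> 1 / 10000"
    and rows: "\<And>j. j < m \<Longrightarrow> (norm (adj V * unit_col j))\<^sup>2 \<le> mu"
begin

definition L :: fmat where "L = diagm K lam"
definition Li :: fmat where "Li = diagm K (\<lambda>i. 1 / lam i)"
definition M :: fmat where "M = V * L * adj V"
definition PV :: fmat where "PV = V * adj V"

lemma mu_le: "mu \<le> 1 / 10000"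
  using mu kap by (metis mult_left_mono mult.right_neutral order_trans)

lemma V_idm: "V * idm K = V" by (rule mult_idm[OF supp_V])
lemma adjV_supp: "supp_in K m (adj V)" by (rule supp_in_adj[OF supp_V])
lemma idm_adjV: "idm K * adj V = adj V" by (rule idm_mult[OF adjV_supp])
lemma L_Li: "L * Li = idm K" unfolding L_def Li_def diagm_mult_diagm idm_eq_diagm
  using lam(1) by (intro fmat_eqI) (force simp: ent_diagm)
lemma supp_L: "supp_in K K L" by (simp add: L_def supp_in_diagm)
lemma idm_L: "idm K * L = L" by (rule idm_mult[OF supp_L])
lemma L_idm: "L * idm K = L" by (rule mult_idm[OF supp_L])

lemma opnorm_le_V: "opnorm_le V 1" by (rule opnorm_le_isometry[OF VV])

lemma opnorm_le_adjV: "opnorm_le (adj V) 1" by (rule opnorm_le_adj[OF opnorm_le_V])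

lemma norm_V_mult: assumes "supp_in K n B" shows "norm (V * B) = norm B"
proof -
  have "(norm (V * B))\<^sup>2 = inner B (idm K * B)" 
    by (simp add: power2_norm_eq_inner inner_mult_left mult.assoc[symmetric] VV)
  then have "(norm (V * B))\<^sup>2 = (norm B)\<^sup>2" by (simp add: idm_mult[OF assms] power2_norm_eq_inner)
  then show ?thesis by simp
qed

lemma norm_V_sq: "(norm V)\<^sup>2 = K" 
  using norm_V_mult[of K "idm K"] by (simp add: V_idm norm_idm_sq idm_eq_diagm supp_in_diagm)
     (metis V_idm idm_eq_diagm norm_idm_sq norm_V_mult supp_in_diagm)

lemma opnorm_le_Li: "opnorm_le Li 1" 
  unfolding Li_def
proof (rule opnorm_le_diagm)
  fix i assume "i < K"
  from lam(1)[OF this] show "\<bar>1 / lam i\<bar> \<le> 1" by (simp add: field_simps)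
qed simp

lemma opnorm_le_L: "opnorm_le L kap" 
  unfolding L_def
proof (rule opnorm_le_diagm)
  fix i assume "i < K"
  from lam[OF this] show "\<bar>lam i\<bar> \<le> kap" by simp
qed (use kap in simp)

lemma adjV_V: "adj V * (V * A) = idm K * A" by (simp add: mult.assoc[symmetric] VV)

lemma proj_PV: "proj PV" 
  by (simp add: proj_def PV_def adj_mult mult.assoc adjV_V) (simp add: mult.assoc[symmetric] V_idm)

text \<open>Recovers V from M: (I - P)V = (I - P)M V L^{-1} for any P, where V L^{-1} has operator
  norm at most 1.\<close>

lemma M_VLi: "M * (V * Li) = V"
proof -
  have "M * (V * Li) = V * (L * (idm K * Li))" by (simp add: M_def mult.assoc adjV_V)
  also have "\<dots> = V * (L * idm K * Li)" by (simp add: mult.assoc)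
  also have "\<dots> = V" by (simp add: L_idm L_Li V_idm)
  finally show ?thesis .
qed

lemma adjV_M: "adj V * M = L * adj V" 
  unfolding M_def by (simp add: mult.assoc adjV_V) (simp add: mult.assoc[symmetric] idm_L)

lemma M_PV: "M * PV = M" 
  unfolding M_def PV_def by (simp add: mult.assoc adjV_V) (simp add: mult.assoc[symmetric] idm_adjV V_idm L_idm)

lemma adj_M: "adj M = M" by (simp add: M_def adj_mult L_def mult.assoc)

lemma PV_M: "PV * M = M" by (metis M_PV proj_PV projD(1) adj_M adj_mult)

lemma supp_M: "supp_in m m M" 
  unfolding M_def by (rule supp_in_mult[OF supp_in_mult[OF supp_V supp_L] adjV_supp])

lemma supp_PV: "supp_in m m PV" unfolding PV_def by (rule supp_in_mult[OF supp_V adjV_supp])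

lemma sqrt_mu: "norm (adj V * unit_col j) \<le> sqrt mu" if "j < m"
  using rows[OF that] by (simp add: real_le_rsqrt)

lemma sqrt_mu_le: "sqrt mu \<le> 1 / 100"
  by (rule real_le_lsqrt) (use mu mu_le in \<open>auto simp: power2_eq_square\<close>)

text \<open>A diagonal entry is y^T L y for the row y of \<open>V\<close>, hence at most
  \<open>kap * mu\<close>. The algorithm starts with zero diagonal, so this bounds the initial
  perturbation -diag(M).\<close>

lemma M_diag: assumes "j < m" shows "0 \<le> ent M j j" "ent M j j \<le> 1 / 10000"
proof -
  define y where "y = adj V * unit_col j"
  have eq: "ent M j j = inner y (L * y)" 
    by (simp add: ent_eq_inner M_def y_def inner_mult_left mult.assoc)
  show "0 \<le> ent M j j" unfolding eq L_def using lam(1) by (intro inner_diagm_nonneg) (meson order_trans zero_le_one)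
  have "inner y (L * y) \<le> norm y * (kap * norm y)"
    by (rule order_trans[OF norm_cauchy_schwarz mult_left_mono[OF opbD[OF opnorm_le_L]]]) simp
  also have "\<dots> = kap * (norm y)\<^sup>2" by (simp add: power2_eq_square)
  also have "\<dots> \<le> kap * mu" using rows[OF assms] kap by (simp add: y_def mult_left_mono)
  finally show "ent M j j \<le> 1 / 10000" using mu by (simp add: eq mult.commute)
qed

text \<open>\<open>P\<close> projects onto the dominant eigenspace of \<open>M + D\<close>, and \<open>Z\<close> is the pseudoinverse of \<open>P (M + D)\<close>.\<close>

definition is_ref :: "real \<Rightarrow> fmat \<Rightarrow> fmat \<Rightarrow> fmat \<Rightarrow> bool" where
  "is_ref a D P Z \<longleftrightarrow> 
     (\<exists>d. D = diagm m d \<and> (\<forall>i<m. \<bar>d i\<bar> \<le> a)) \<and> proj P \<and> supp_in m m P \<and> supp_in m m Z \<and>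
     (norm P)\<^sup>2 = real K \<and> P * (M + D) = (M + D) * P \<and> (M + D) * Z = P \<and> Z * (M + D) = P \<and>
     P * Z = Z \<and> opnorm_le Z 2 \<and> opnorm_le (M + D - P * (M + D)) (2 * a)"

text \<open>M is at least 1 on the range of \<open>V\<close> and 0 on its complement. If
  \<open>l\<close> is at most 1/2, comparison on the range makes the component y of the eigenvector
  there at most 2a; at least half the norm then lies in the complement, where only D acts, and this
  bounds l.\<close>

lemma small_eigenvalue:
  assumes a: "opnorm_le D a" "a \<le> 1 / 16" 
    and u: "supp_in m 1 u" "norm u = 1" "(M + D) * u = l *\<^sub>R u" and l: "l \<le> 1 / 2"
  shows "\<bar>l\<bar> \<le> 2 * a"
proof -
  have a0: "0 \<le> a" by (rule opnorm_le_nonneg[OF a(1)])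
  define y where "y = adj V * u"
  have sy: "supp_in K 1 y" unfolding y_def by (rule supp_in_mult[OF adjV_supp u(1)])
  have Vu: "adj V * ((M + D) * u) = L * y + adj V * (D * u)" 
    by (simp add: distrib_left distrib_right mult.assoc[symmetric] adjV_M) (simp add: y_def mult.assoc)
  then have eq: "L * y - l *\<^sub>R y = - (adj V * (D * u))" by (simp add: u(3) y_def)
  have Du: "norm (D * u) \<le> a" using opbD[OF a(1), of u] u(2) by simp
  have "L = idm K + diagm K (\<lambda>i. lam i - 1)" 
    unfolding L_def idm_eq_diagm diagm_add_diagm by (rule fmat_eqI) (auto simp: ent_diagm)
  then have "inner y (L * y) = inner y y + inner y (diagm K (\<lambda>i. lam i - 1) * y)"
    by (simp add: distrib_right inner_add_right idm_mult[OF sy])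
  moreover have "0 \<le> inner y (diagm K (\<lambda>i. lam i - 1) * y)" using lam(1) by (intro inner_diagm_nonneg) auto
  ultimately have "inner y y \<le> inner y (L * y)" by simp
  then have "(1 - l) * inner y y \<le> inner y (L * y - l *\<^sub>R y)" by (simp add: inner_diff_right algebra_simps)
  also have "\<dots> \<le> norm y * norm (adj V * (D * u))" unfolding eq 
    using norm_cauchy_schwarz[of y "- (adj V * (D * u))"] by simp
  also have "\<dots> \<le> norm y * a" using opbD[OF opnorm_le_adjV, of "D * u"] Du by (intro mult_left_mono) auto
  finally have 1: "(1 - l) * (norm y)\<^sup>2 \<le> norm y * a" by (simp add: power2_norm_eq_inner)
  have "1 / 2 * (norm y)\<^sup>2 \<le> (1 - l) * (norm y)\<^sup>2" by (rule mult_right_mono) (use l in auto)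
  with 1 have "norm y * norm y \<le> norm y * (2 * a)" by (simp add: power2_eq_square)
  then have ny: "norm y \<le> 2 * a" using a0 by (cases "norm y = 0") auto
  have "(norm (PV * u))\<^sup>2 = (norm y)\<^sup>2"
    by (simp add: PV_def mult.assoc y_def[symmetric] norm_V_mult[OF sy])
  then have z1: "(norm (u - PV * u))\<^sup>2 = 1 - (norm y)\<^sup>2" 
    using proj_pythagoras[OF proj_PV, of u] u(2) by simp
  have "norm y \<le> 1 / 2" using ny a(2) by simp
  then have "(norm y)\<^sup>2 \<le> (1 / 2)\<^sup>2" by (intro power_mono) auto
  then have "(1 / 2)\<^sup>2 \<le> (norm (u - PV * u))\<^sup>2" unfolding z1 by (simp add: power2_eq_square)
  then have z2: "1 / 2 \<le> norm (u - PV * u)" by (rule power2_le_imp_le) simp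
  have "l *\<^sub>R (u - PV * u) = (M + D) * u - PV * ((M + D) * u)" by (simp add: u(3) scaleR_diff_right)
  also have "\<dots> = D * u - PV * (D * u)" 
    by (simp add: distrib_left distrib_right mult.assoc[symmetric] PV_M)
  finally have "\<bar>l\<bar> * norm (u - PV * u) \<le> a"
    using proj_compl_le[OF proj_PV, of "D * u"] Du by (metis norm_scaleR order_trans)
  moreover have "\<bar>l\<bar> * (1 / 2) \<le> \<bar>l\<bar> * norm (u - PV * u)" by (rule mult_left_mono[OF z2]) simp
  ultimately show ?thesis by simp
qed

lemma opnorm_le_compl_M:
  assumes "proj P" "opnorm_le D a" "opnorm_le (M + D - P * (M + D)) r"
  shows "opnorm_le (M - P * M) (r + a)"
proof -
  have "opnorm_le ((M + D - P * (M + D)) - (D - P * D)) (r + a)"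
    by (intro opnorm_le_diff assms opnorm_le_proj_compl[OF assms(1)])
  then show ?thesis by (simp add: algebra_simps)
qed

text \<open>\<open>PV\<close> fixes M, so (I - PV)(M + D)Z reduces to (I - PV)D Z.\<close>

lemma opnorm_le_compl_P:
  assumes "opnorm_le D a" "opnorm_le Z z" "(M + D) * Z = P"
  shows "opnorm_le (P - PV * P) (a * z)"
proof -
  have "P - PV * P = (M + D - PV * (M + D)) * Z" by (simp add: assms(3)[symmetric] left_diff_distrib mult.assoc)
  also have "M + D - PV * (M + D) = D - PV * D" by (simp add: distrib_left PV_M)
  finally show ?thesis by (simp add: opnorm_le_mult opnorm_le_proj_compl[OF proj_PV] assms(1,2))
qed

text \<open>\<open>P\<close> is the spectral projector for the eigenvalues above 1/2 and
  \<open>Z\<close> inverts M + D there, whence the bound 2. The threshold lies in a gap: all other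
  eigenvalues are at most 2a <= 1/8 in absolute value. The rank is K by a count in both directions
  between the range of P and the range of V.\<close>

lemma ref_exists:
  assumes d: "\<And>i. i < m \<Longrightarrow> \<bar>d i\<bar> \<le> a" and a: "0 \<le> a" "a \<le> 1 / 16"
  shows "\<exists>P Z. is_ref a (diagm m d) P Z"
proof -
  define D where "D = diagm m d"
  have opD: "opnorm_le D a" unfolding D_def by (rule opnorm_le_diagm[OF d a(1)])
  have sD: "supp_in m m D" by (simp add: D_def supp_in_diagm)
  define N where "N = M + D"
  have sN: "supp_in m m N" unfolding N_def by (rule supp_in_add[OF supp_M sD])
  have trN: "adj N = N" by (simp add: N_def adj_add adj_M D_def)
  obtain u l where u: "\<And>i. i < m \<Longrightarrow> supp_in m 1 (u i)" "\<And>i. i < m \<Longrightarrow> N * u i = l i *\<^sub>R u i"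
     "\<And>i j. i < m \<Longrightarrow> j < m \<Longrightarrow> inner (u i) (u j) = (if i = j then 1 else 0)"
     "(\<Sum>i<m. u i * adj (u i)) = idm m"
    using spectral[OF sN trN] by blast
  define S where "S g = (\<Sum>i<m. g i *\<^sub>R (u i * adj (u i)))" for g :: "nat \<Rightarrow> real"
  have S_mult: "S g * S h = S (\<lambda>i. g i * h i)" for g h
    unfolding S_def by (rule outer_sum_mult[OF u(3,1)]) auto
  have S_adj: "adj (S g) = S g" for g by (simp add: S_def adj_sum adj_scaleR adj_mult)
  have S_cong: "S g = S h" if "\<And>i. i < m \<Longrightarrow> g i = h i" for g h
    unfolding S_def using that by (intro sum.cong) auto
  have S_opnorm_le: "opnorm_le (S g) r" if "\<And>i. i < m \<Longrightarrow> \<bar>g i\<bar> \<le> r" "0 \<le> r" for g r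
    unfolding S_def by (rule opnorm_le_outer_sum[OF u(3,1,4) that])
  have S_supp: "supp_in m m (S g)" for g unfolding S_def
    by (rule supp_in_sum) (use u(1) in \<open>auto intro!: supp_in_mult supp_in_adj supp_in_scaleR\<close>)
  have S_diff: "S g - S h = S (\<lambda>i. g i - h i)" for g h
    by (simp add: S_def sum_subtractf[symmetric] scaleR_left_diff_distrib)
  have N: "N = S l"
  proof -
    have "N = N * (\<Sum>i<m. u i * adj (u i))" by (simp add: u(4) mult_idm[OF sN])
    also have "\<dots> = S l" unfolding S_def sum_distrib_left 
      by (intro sum.cong refl) (simp add: mult.assoc[symmetric] u(2))
    finally show ?thesis .
  qed
  have nu: "norm (u i) = 1" if "i < m" for i using u(3)[OF that that] by (simp add: norm_eq_sqrt_inner)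
  define I where "I = {i. i < m \<and> 1 / 2 < l i}"
  define chi where "chi i = (if i \<in> I then 1 else (0::real))" for i
  define P where "P = S chi"
  define Z where "Z = S (\<lambda>i. chi i / l i)"
  have pP: "proj P" unfolding proj_def P_def S_adj S_mult by (auto intro!: S_cong simp: chi_def)
  have PN: "P * N = N * P" unfolding P_def N S_mult by (intro S_cong) simp
  have NZ: "N * Z = P" unfolding Z_def P_def N S_mult by (intro S_cong) (auto simp: chi_def I_def)
  have ZN: "Z * N = P" unfolding Z_def P_def N S_mult by (intro S_cong) (auto simp: chi_def I_def)
  have PZ: "P * Z = Z" unfolding Z_def P_def S_mult by (intro S_cong) (auto simp: chi_def I_def)
  have opZ: "opnorm_le Z 2" unfolding Z_def by (rule S_opnorm_le) (auto simp: chi_def I_def field_simps)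
  have small: "\<bar>l i\<bar> \<le> 2 * a" if "i < m" "i \<notin> I" for i
    using that u(1,2) nu by (intro small_eigenvalue[OF opD a(2), of "u i"]) (auto simp: I_def N_def)
  have opR: "opnorm_le (N - P * N) (2 * a)" unfolding P_def N S_mult S_diff
    by (rule S_opnorm_le) (use small a(1) in \<open>auto simp: chi_def\<close>)
  have fI: "finite I" by (simp add: I_def)
  have "(norm P)\<^sup>2 = (\<Sum>i<m. (chi i)\<^sup>2)" unfolding P_def S_def
    by (subst norm_sq_sum_orthonormal[where k=m and m=m]) (use u in auto)
  also have "\<dots> = (\<Sum>i\<in>I. 1)" by (intro sum.mono_neutral_cong_right) (auto simp: chi_def I_def)
  finally have normP: "(norm P)\<^sup>2 = card I" by simp
  have opQM: "opnorm_le (M - P * M) (3 * a)" using opnorm_le_compl_M[OF pP opD opR[unfolded N_def]] by simp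
  have opQV: "opnorm_le (V - P * V) (3 * a)"
  proof -
    have "opnorm_le ((M - P * M) * (V * Li)) (3 * a * (1 * 1))" by (intro opnorm_le_mult opQM opnorm_le_V opnorm_le_Li)
    moreover have "(M - P * M) * (V * Li) = V - P * V" 
      by (simp add: left_diff_distrib mult.assoc M_VLi)
    ultimately show ?thesis by simp
  qed
  have opVP: "opnorm_le (P - PV * P) (2 * a)" 
    using opnorm_le_compl_P[OF opD opZ NZ[unfolded N_def]] by (simp add: mult.commute)
  have P_apply: "P * v \<in> span (u ` I)" if "supp_in m 1 v" for v
  proof -
    have "P * v = (\<Sum>i<m. chi i *\<^sub>R (inner (u i) v *\<^sub>R u i))" unfolding P_def S_def sum_distrib_right
      by (intro sum.cong refl) (use u(1) that in \<open>simp add: outer_mult_vec[where m=m and n=m]\<close>)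
    also have "\<dots> = (\<Sum>i\<in>I. inner (u i) v *\<^sub>R u i)" 
      by (intro sum.mono_neutral_cong_right) (auto simp: chi_def I_def)
    finally show ?thesis by (simp add: span_sum span_scale span_base)
  qed
  have sVe: "supp_in m 1 (V * unit_col k)" if "k < K" for k 
    by (rule supp_in_mult[OF supp_V supp_in_unit_col[OF that]])
  \<comment> \<open>\<open>P\<close> is injective on the range of \<open>V\<close>, because (I - P)V
    has operator norm at most 3a < 1.\<close>
  have "card {..<K} \<le> card (u ` I)"
  proof (rule dim_bound)
    show "P * (V * unit_col k) \<in> span (u ` I)" if "k \<in> {..<K}" for k using P_apply sVe that by simp
    fix c :: "nat \<Rightarrow> real" and j assume 0: "(\<Sum>i<K. c i *\<^sub>R (P * (V * unit_col i))) = 0" and j: "j \<in> {..<K}"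
    define x where "x = (\<Sum>i<K. c i *\<^sub>R unit_col i)"
    have sx: "supp_in K 1 x" unfolding x_def by (intro supp_in_sum supp_in_scaleR supp_in_unit_col) simp
    have "P * (V * x) = 0" using 0 by (simp add: x_def sum_distrib_left)
    then have "norm x = norm ((V - P * V) * x)" 
      by (simp add: left_diff_distrib mult.assoc norm_V_mult[OF sx])
    also have "\<dots> \<le> 3 * a * norm x" by (rule opbD[OF opQV])
    finally have "(1 - 3 * a) * norm x \<le> 0" by (simp add: algebra_simps)
    then have "x = 0" using a(2) by (simp add: mult_le_0_iff)
    then have "inner (unit_col j) x = 0" by simp
    moreover have "inner (unit_col j) x = (\<Sum>i<K. if i = j then c j else 0)"
      unfolding x_def inner_sum_right by (intro sum.cong) (auto simp: inner_unit_col_unit_col)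
    ultimately show "c j = 0" using j by simp
  qed (auto simp: fI)
  then have K1: "K \<le> card I" using card_image_le[OF fI, of u] by simp
  \<comment> \<open>Conversely \<open>PV\<close> is injective on the range of \<open>P\<close>,
    because (I - PV)P has operator norm at most 2a < 1.\<close>
  have "card I \<le> card ((\<lambda>k. V * unit_col k) ` {..<K})"
  proof (rule dim_bound)
    show "PV * u i \<in> span ((\<lambda>k. V * unit_col k) ` {..<K})" if "i \<in> I" for i
    proof -
      have "supp_in K 1 (adj V * u i)" using that u(1) by (intro supp_in_mult[OF adjV_supp]) (auto simp: I_def)
      note eq = vec_expand[OF this]
      have "PV * u i = V * (adj V * u i)" by (simp add: PV_def mult.assoc)
      also have "\<dots> = (\<Sum>k<K. ent (adj V * u i) k 0 *\<^sub>R (V * unit_col k))" 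
        by (subst eq) (simp add: sum_distrib_left)
      finally show ?thesis 
        by simp (intro span_sum span_scale span_base imageI, simp)
    qed
    fix c j assume 0: "(\<Sum>i\<in>I. c i *\<^sub>R (PV * u i)) = 0" and j: "j \<in> I"
    define x where "x = (\<Sum>i\<in>I. c i *\<^sub>R u i)"
    have Pu: "P * u i = u i" if "i \<in> I" for i
    proof -
      have i: "i < m" using that by (simp add: I_def)
      have "P * u i = (\<Sum>j<m. chi j *\<^sub>R (inner (u j) (u i) *\<^sub>R u j))" unfolding P_def S_def sum_distrib_right
        by (intro sum.cong refl) (use u(1) i in \<open>simp add: outer_mult_vec[where m=m and n=m]\<close>)
      also have "\<dots> = (\<Sum>j<m. if j = i then u i else 0)" 
        by (intro sum.cong refl) (use u(3) i that in \<open>auto simp: chi_def\<close>)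
      finally show ?thesis using i by simp
    qed
    have Px: "P * x = x" by (simp add: x_def sum_distrib_left Pu)
    have "PV * x = 0" using 0 by (simp add: x_def sum_distrib_left)
    then have "x = (P - PV * P) * x" by (simp add: left_diff_distrib mult.assoc Px)
    then have "norm x \<le> 2 * a * norm x" using opbD[OF opVP, of x] by simp
    then have "(1 - 2 * a) * norm x \<le> 0" by (simp add: algebra_simps)
    then have "x = 0" using a(2) by (simp add: mult_le_0_iff)
    then have "inner (u j) x = 0" by simp
    moreover have "inner (u j) x = (\<Sum>i\<in>I. if i = j then c j else 0)"
      unfolding x_def inner_sum_right using u(3) j by (intro sum.cong) (auto simp: I_def)
    ultimately show "c j = 0" using j fI by simp
  qed (auto simp: fI)
  then have "card I \<le> K" using card_image_le[of "{..<K}" "\<lambda>k. V * unit_col k"] by simp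
  with K1 have "card I = K" by simp
  then have "is_ref a D P Z"
    unfolding is_ref_def N_def[symmetric] 
    using d pP PN NZ ZN PZ opZ opR normP by (auto simp: D_def P_def Z_def S_supp)
  then show ?thesis unfolding D_def by blast
qed

end

section \<open>Comparison with the noiseless run\<close>

context incoherent
begin

lemma refD:
  assumes "is_ref a D P Z"
  shows "proj P" "supp_in m m P" "supp_in m m Z" "(norm P)\<^sup>2 = real K" "opnorm_le Z 2"
    "opnorm_le (M + D - P * (M + D)) (2 * a)" "opnorm_le D a" "supp_in m m D" "adj D = D"
    "P * (M + D) = (M + D) * P" "(M + D) * Z = P" "Z * (M + D) = P" "P * Z = Z" "Z * P = Z" "0 \<le> a"
    "adj (M + D) = M + D" "diagp D = D"
proof -
  show "proj P" "supp_in m m P" "supp_in m m Z" "(norm P)\<^sup>2 = real K" "opnorm_le Z 2"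
    "opnorm_le (M + D - P * (M + D)) (2 * a)"
    "P * (M + D) = (M + D) * P" and NZ: "(M + D) * Z = P" and ZN: "Z * (M + D) = P" and PZ: "P * Z = Z"
    using assms unfolding is_ref_def by auto
  then show a: "0 \<le> a" using opnorm_le_nonneg by fastforce
  obtain d where d: "D = diagm m d" "\<And>i. i < m \<Longrightarrow> \<bar>d i\<bar> \<le> a" using assms unfolding is_ref_def by blast
  show "opnorm_le D a" unfolding d by (rule opnorm_le_diagm[OF d(2) a])
  show "supp_in m m D" unfolding d by (rule supp_in_diagm)
  show "adj D = D" unfolding d by simp
  show "adj (M + D) = M + D" unfolding d by (simp add: adj_add adj_M)
  show "diagp D = D" unfolding d by (rule fmat_eqI) (auto simp: ent_diagm)
  show "Z * P = Z" using NZ ZN PZ by (metis mult.assoc)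
qed

lemma ref_XR:
  assumes "is_ref a D P Z" and N: "N = M + D" and X: "X = P * N" and R: "R = N - X"
  shows "P * X = X" "X * P = X" "X * Z = P" "Z * X = P" "P * R = 0" "R * P = 0" 
    "N * P = X" "opnorm_le R (2 * a)" "N = X + R"
proof -
  note r = refD[OF assms(1)]
  show PX: "P * X = X" by (simp add: X projD[OF r(1)])
  show NP: "N * P = X" using r(10) by (simp add: X N)
  show XP: "X * P = X" using NP by (metis PX r(1) projD(4))
  show "X * Z = P" by (simp add: X N mult.assoc r(11) projD[OF r(1)])
  have "Z * X = Z * P * N" by (simp add: X mult.assoc)
  then show "Z * X = P" by (simp add: r(14) N r(12))
  show "P * R = 0" unfolding R right_diff_distrib PX by (simp add: X)
  show "R * P = 0" by (simp add: R left_diff_distrib XP NP)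
  show "opnorm_le R (2 * a)" using r(6) by (simp add: R X N)
  show "N = X + R" by (simp add: R)
qed

lemma ref_opQM: "is_ref a D P Z \<Longrightarrow> opnorm_le (M - P * M) (3 * a)"
  using opnorm_le_compl_M[of P D a "2 * a"] refD[of a D P Z] by simp

lemma ref_opVP: "is_ref a D P Z \<Longrightarrow> opnorm_le (P - PV * P) (2 * a)"
  using opnorm_le_compl_P[of D a Z 2 P] refD[of a D P Z] by (simp add: mult.commute)

text \<open>The new diagonal error is that of P D - (I - P)M. Its first part is d_j |P e_j|^2, and
  |P e_j| <= sqrt(mu) + 2a is below 1/10. In the second part M = M PV, the operator norm is at most
  3a, and |PV e_j| <= 1/100. Together this is at most 4a/100, well within the a/4 that sets the rate
  of the noiseless run.\<close>

lemma ref_contract: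
  assumes ref: "is_ref a D P Z" and a: "a \<le> 1 / 10000" and j: "j < m"
  shows "\<bar>ent (P * (M + D) - M) j j\<bar> \<le> a / 4"
proof -
  note r = refD[OF ref]
  define e where "e = unit_col j"
  have ne: "norm e = 1" by (simp add: e_def)
  obtain d where d: "D = diagm m d" "\<And>i. i < m \<Longrightarrow> \<bar>d i\<bar> \<le> a" using ref unfolding is_ref_def by blast
  define y where "y = P * e"
  have yy: "inner e y = (norm y)\<^sup>2" 
    by (simp add: y_def power2_norm_eq_inner inner_mult_left projD[OF r(1)])
  have Py: "P * y = y" by (simp add: y_def projD[OF r(1)])
  have "inner e (PV * y) = inner (adj V * e) (adj V * y)" by (simp add: PV_def inner_mult_left mult.assoc)
  also have "\<dots> \<le> norm (adj V * e) * norm (adj V * y)" by (rule norm_cauchy_schwarz)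
  also have "\<dots> \<le> sqrt mu * (1 * norm y)" 
    using sqrt_mu[OF j] mu by (intro mult_mono opbD[OF opnorm_le_adjV]) (auto simp: e_def)
  finally have 1: "inner e (PV * y) \<le> sqrt mu * norm y" by simp
  have "y - PV * y = (P - PV * P) * y" by (simp add: left_diff_distrib mult.assoc Py)
  then have 2: "inner e (y - PV * y) \<le> 2 * a * norm y"
    using abs_inner_mult_le[OF ref_opVP[OF ref], of e y] ne by simp
  have "norm y * norm y \<le> (sqrt mu + 2 * a) * norm y"
    using 1 2 yy by (simp add: inner_diff_right power2_eq_square algebra_simps)
  then have "norm y \<le> sqrt mu + 2 * a"
    using r(15) mu by (cases "norm y = 0") auto
  then have "norm y \<le> 1 / 10" using sqrt_mu_le a by simp
  then have ny: "(norm y)\<^sup>2 \<le> (1 / 10)\<^sup>2" by (intro power_mono) auto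
  have "inner e (P * (D * e)) = d j * (norm y)\<^sup>2"
    unfolding d(1) using j by (simp add: e_def diagm_mult_unit_col) (simp add: e_def[symmetric] y_def[symmetric] yy)
  then have A: "\<bar>inner e (P * (D * e))\<bar> \<le> a * (1 / 10)\<^sup>2"
    using d(2)[OF j] ny r(15) by (simp add: abs_mult mult_mono)
  have "M - P * M = (M - P * M) * PV" by (simp add: left_diff_distrib mult.assoc M_PV)
  then have "inner e ((M - P * M) * e) = inner e ((M - P * M) * (PV * e))" by (metis mult.assoc)
  then have "\<bar>inner e ((M - P * M) * e)\<bar> \<le> 3 * a * norm (PV * e)"
    using abs_inner_mult_le[OF ref_opQM[OF ref], of e "PV * e"] ne by simp
  also have "norm (PV * e) \<le> 1 / 100"
    using opbD[OF opnorm_le_V, of "adj V * e"] sqrt_mu[OF j] sqrt_mu_le by (simp add: PV_def mult.assoc e_def)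
  finally have B: "\<bar>inner e ((M - P * M) * e)\<bar> \<le> 3 * a * (1 / 100)"
    using r(15) by (simp add: mult_left_mono)
  have "ent (P * (M + D) - M) j j = inner e (P * (D * e)) - inner e ((M - P * M) * e)"
    unfolding ent_eq_inner e_def[symmetric] by (simp add: algebra_simps inner_diff_right inner_add_right)
  also have "\<bar>\<dots>\<bar> \<le> \<bar>inner e (P * (D * e))\<bar> + \<bar>inner e ((M - P * M) * e)\<bar>" by (rule abs_triangle_ineq4)
  finally show ?thesis using A B r(15) by (simp add: power2_eq_square)
qed

text \<open>\<open>R\<close> is normal to the rank-\<open>K\<close> matrices at \<open>P * N\<close>, so its pairing with them is of second order.\<close>

lemma ref_inner:
  assumes ref: "is_ref a D P Z" and N: "N = M + D" and X: "X = P * N" and R: "R = N - X"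
    and Q: "proj Q" "(norm Q)\<^sup>2 \<le> real K" "Q * Y = Y"
  shows "\<bar>inner R Y\<bar> \<le> 4 * a * (norm (Y - X))\<^sup>2"
proof -
  note r = refD[OF ref] and x = ref_XR[OF ref N X R]
  \<comment> \<open>Since X Z = P and Q fixes Y, the distance between the ranges is controlled by Y
    - X, at the price of the bound 2 on Z.\<close>
  have "norm (P - Q * P) \<le> 2 * norm (Y - X)"
  proof -
    have "P - Q * P = (X - Q * X) * Z" by (simp add: left_diff_distrib mult.assoc x(3))
    also have "X - Q * X = (X - Y) - Q * (X - Y)" by (simp add: right_diff_distrib Q(3))
    finally have "norm (P - Q * P) \<le> 2 * norm ((X - Y) - Q * (X - Y))" using opnorm_le_right[OF r(5)] by metis
    also have "\<dots> \<le> 2 * norm (X - Y)" using proj_compl_le[OF Q(1)] by simp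
    finally show ?thesis by (simp add: norm_minus_commute)
  qed
  \<comment> \<open>The rank bound on Q reverses the roles: |Q|^2 <= K = |P|^2, while |PQ| =
    |QP|.\<close>
  moreover have "norm (Q - P * Q) \<le> norm (P - Q * P)"
  proof (rule power2_le_imp_le)
    show "(norm (Q - P * Q))\<^sup>2 \<le> (norm (P - Q * P))\<^sup>2"
      using proj_pythagoras[OF r(1), of Q] proj_pythagoras[OF Q(1), of P] norm_proj_swap[OF r(1) Q(1)] Q(2) r(4)
      by simp
  qed simp
  moreover have "norm (Q - Q * P) = norm (Q - P * Q)"
  proof -
    have "adj (Q - Q * P) = Q - P * Q" by (simp add: adj_diff adj_mult projD(1)[OF Q(1)] projD(1)[OF r(1)])
    then show ?thesis by (metis norm_adj)
  qed
  ultimately have QP: "norm (Q - Q * P) \<le> 2 * norm (Y - X)" by linarith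
  \<comment> \<open>\<open>P\<close> annihilates R from both sides: the left side turns Q into Q -
    QP and the right side turns Y into Y - YP. Each gives one factor |Y - X|, and R gives
    2a.\<close>
  have "Q * R = (Q - Q * P) * R" by (simp add: left_diff_distrib mult.assoc x(5))
  then have QR: "norm (Q * R) \<le> 2 * a * (2 * norm (Y - X))"
    using opnorm_le_right[OF x(8), of "Q - Q * P"] mult_left_mono[OF QP, of "2 * a"] r(15) by simp
  have "inner R Y = inner (Q * R) Y" using Q by (simp add: inner_mult_left projD)
  also have "\<dots> = inner (Q * R) (Y - Y * P)"
  proof -
    have "inner (Q * R) (Y * P) = inner (Q * R * P) Y" 
      by (simp add: inner_commute[of _ "Y * P"] inner_mult_right projD[OF r(1)])
    then show ?thesis by (simp add: inner_diff_right mult.assoc x(6))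
  qed
  also have "Y - Y * P = (Y - X) - (Y - X) * P" by (simp add: left_diff_distrib x(2))
  finally have "\<bar>inner R Y\<bar> \<le> norm (Q * R) * norm ((Y - X) - (Y - X) * P)"
    using Cauchy_Schwarz_ineq2 by metis
  also have "\<dots> \<le> (2 * a * (2 * norm (Y - X))) * norm (Y - X)"
    using r(15) by (intro mult_mono QR proj_compl_le_right[OF r(1)]) auto
  finally show ?thesis by (simp add: power2_eq_square)
qed

text \<open>As D is diagonal, replacing the diagonal of M by that of X is the same as removing the
  diagonal of R from N; this matches the update of the noisy run.\<close>

lemma ref_step_eq:
  assumes ref: "is_ref a D P Z" and N: "N = M + D" and X: "X = P * N" and R: "R = N - X"
  shows "M + diagp (X - M) = N - diagp R"
  using refD(17)[OF ref] by (simp add: R N diagp_diff diagp_add)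

text \<open>Multiplication by near-identity matrices on both sides carries \<open>X\<close> to \<open>X'\<close> and keeps the rank.\<close>

lemma ref_transport:
  assumes ref: "is_ref a D P Z" and N: "N = M + D" and X: "X = P * N" and R: "R = N - X"
    and ref': "is_ref a' D' P' Z'" and D': "D' = diagp (X - M)" and N': "N' = M + D'" and X': "X' = P' * N'"
    and a: "a \<le> 1 / 10000" "a' \<le> a"
    and Y0: "supp_in m K A" "Y0 = A * C"
  obtains Y Q where "proj Q" "(norm Q)\<^sup>2 \<le> real K" "Q * Y = Y" 
    "norm (Y - X' - (Y0 - X)) \<le> 40 * a * norm (Y0 - X)"
proof -
  note r = refD[OF ref] and x = ref_XR[OF ref N X R] and r' = refD[OF ref'] 
  define R' where "R' = N' - X'"
  note x' = ref_XR[OF ref' N' X' R'_def]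
  define E where "E = R - diagp R"
  have N'X: "N' = X + E" using ref_step_eq[OF ref N X R] by (simp add: N' D' E_def R)
  \<comment> \<open>Removing a diagonal could increase an operator norm in general; here the
    diagonal of R is a difference of two reference perturbations and so is small itself.\<close>
  have "diagp R = D - D'" using ref_step_eq[OF ref N X R] by (simp add: D' N algebra_simps)
  then have "opnorm_le (R - diagp R) (2 * a + (a + a'))" by (simp only:) (intro opnorm_le_diff x r r')
  then have opE: "opnorm_le E (4 * a)" unfolding E_def by (rule opnorm_le_mono) (use a in simp)
  \<comment> \<open>Since Z' X' = P', S X' = E P'. Hence X' = N' P' = X P' + S X', and X' arises
    from X P' by the left factor I + B, the inverse of I - S.\<close>
  define S where "S = E * Z'"
  have "opnorm_le S (4 * a * 2)" unfolding S_def by (intro opnorm_le_mult opE r')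
  then have opS: "opnorm_le S (8 * a)" by simp
  have sN: "supp_in m m N" unfolding N by (rule supp_in_add[OF supp_M r(8)])
  have sR: "supp_in m m R" unfolding R X by (rule supp_in_diff[OF sN supp_in_mult[OF r(2) sN]])
  have "supp_in m m (diagp R)" using sR unfolding supp_in_def by auto
  then have sS: "supp_in m m S" unfolding S_def E_def by (rule supp_in_mult[OF supp_in_diff[OF sR] r'(3)])
  obtain B where B: "supp_in m m B" "B = S + S * B" "B = S + B * S"
    using ex_resolvent[OF sS opS] a by auto
  have opB: "opnorm_le B (16 * a)"
    unfolding opnorm_le_def
  proof
    fix C
    have "norm (B * C) \<le> norm (S * C) + norm (S * (B * C))"
      using norm_triangle_ineq[of "S * C" "S * (B * C)"] B(2) by (metis distrib_right mult.assoc)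
    also have "\<dots> \<le> 8 * a * norm C + 8 * a * norm (B * C)" by (intro add_mono opbD[OF opS])
    also have "8 * a * norm (B * C) \<le> 1 / 2 * norm (B * C)" using a by (intro mult_right_mono) auto
    finally show "norm (B * C) \<le> 16 * a * norm C" by simp
  qed
  \<comment> \<open>The right factor: X P' = X(I - W), where W is small because X(I - P') consists
    of terms of order a and Z turns X into P.\<close>
  define W where "W = P - P * P'"
  have "opnorm_le (Z * (R' - (E - E * P'))) (2 * (2 * a' + 4 * a))"
    by (intro opnorm_le_mult opnorm_le_diff r x' opnorm_le_proj_compl_right[OF r'(1)] opE)
  moreover have "Z * (R' - (E - E * P')) = W"
  proof -
    have "R' - (E - E * P') = X - X * P'"
      using x'(7) by (simp add: R'_def N'X algebra_simps)
    then show ?thesis by (simp add: W_def right_diff_distrib mult.assoc[symmetric] x(4))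
  qed
  ultimately have opW: "opnorm_le W (12 * a)" using a by (auto intro: opnorm_le_mono)
  have XW: "X - X * W = X * P'" by (simp add: W_def right_diff_distrib mult.assoc[symmetric] x(2))
  have "X' - S * X' = X * P'"
  proof -
    have "S * X' = E * P'" by (simp add: S_def mult.assoc x'(4))
    then show ?thesis using x'(7) by (simp add: N'X algebra_simps)
  qed
  moreover have "X' = (X' - S * X') + B * (X' - S * X')"
  proof -
    have "B * X' = S * X' + B * (S * X')" by (subst B(3)) (simp add: distrib_right mult.assoc)
    then show ?thesis by (simp add: right_diff_distrib)
  qed
  ultimately have X'eq: "X' = X * P' + B * (X * P')" by simp
  \<comment> \<open>The factors I + B and I - W that carry X to X', applied to \<open>Y0\<close>.
    They leave a left factor with K columns, hence rank at most K. With |B| <= 16a, |W| <= 12a and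
    |I - W| <= 7/4 the error is 16 (7/4) a + 12a = 40a.\<close>
  define Y where "Y = (Y0 - Y0 * W) + B * (Y0 - Y0 * W)"
  have "Y = (A + B * A) * (C - C * W)" by (simp add: Y_def Y0(2) algebra_simps)
  moreover have "supp_in m K (A + B * A)" by (rule supp_in_add[OF Y0(1) supp_in_mult[OF B(1) Y0(1)]])
  then obtain Q where Q: "proj Q" "(norm Q)\<^sup>2 \<le> real K" "Q * (A + B * A) = A + B * A" 
    by (rule ex_proj_range)
  ultimately have QY: "Q * Y = Y" by (simp add: mult.assoc[symmetric])
  define X0 where "X0 = Y0 - X"
  have eq: "Y - X' - X0 = B * (X0 - X0 * W) - X0 * W"
    unfolding Y_def X'eq X0_def XW[symmetric] by (simp add: algebra_simps)
  have n1: "norm (X0 * W) \<le> 12 * a * norm X0" by (rule opnorm_le_right[OF opW])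
  have "norm (X0 - X0 * W) \<le> norm X0 + 12 * a * norm X0" 
    using norm_triangle_ineq4[of X0 "X0 * W"] n1 by linarith
  also have "\<dots> \<le> 7 / 4 * norm X0" using a mult_right_mono[of "12 * a" "3 / 4" "norm X0"] by simp
  finally have "norm (B * (X0 - X0 * W)) \<le> 16 * a * (7 / 4 * norm X0)"
    using opbD[OF opB, of "X0 - X0 * W"] r(15) mult_left_mono[of "norm (X0 - X0 * W)" _ "16 * a"] by fastforce
  then have "norm (Y - X' - X0) \<le> 40 * a * norm X0"
    unfolding eq using n1 norm_triangle_ineq4[of "B * (X0 - X0 * W)" "X0 * W"] by simp
  with Q QY show thesis by (intro that[of Q Y]) (auto simp: X0_def)
qed

text \<open>Optimality in place of a decomposition, because the singular vectors are not unique. The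
  factorisation through K columns is the form of the rank bound that \<open>ref_transport\<close>
  takes up.\<close>

definition best_proj :: "fmat \<Rightarrow> fmat \<Rightarrow> bool" where
  "best_proj N P \<longleftrightarrow> proj P \<and> (norm P)\<^sup>2 \<le> real K \<and> (\<exists>A C. supp_in m K A \<and> P = A * C) \<and>
     (\<forall>Q. proj Q \<longrightarrow> (norm Q)\<^sup>2 \<le> real K \<longrightarrow> norm (N - P * N) \<le> norm (N - Q * N))"

lemma best_proj_best: 
  assumes "best_proj N P" "proj Q" "(norm Q)\<^sup>2 \<le> real K" "Q * Y = Y"
  shows "norm (N - P * N) \<le> norm (N - Y)"
proof -
  have "norm (N - P * N) \<le> norm (N - Q * N)" using assms unfolding best_proj_def by blast
  also have "N - Q * N = (N - Y) - Q * (N - Y)" by (simp add: right_diff_distrib assms(4))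
  also have "norm \<dots> \<le> norm (N - Y)" by (rule proj_compl_le[OF assms(2)])
  finally show ?thesis .
qed

text \<open>Expanding the square around R0, optimality replaces |N - PN| by |N - Y|, and only the
  pairings of R0 with PN and with Y remain. By \<open>ref_inner\<close> each is of second order; the
  factor 2 in front turns 4a into 8a.\<close>

lemma compare_best:
  assumes ref: "is_ref a D P0 Z" and N0: "N0 = M + D" and X0: "X0 = P0 * N0" and R0: "R0 = N0 - X0"
    and P: "best_proj N P" and Q: "proj Q" "(norm Q)\<^sup>2 \<le> real K" "Q * Y = Y"
  shows "(norm (N - P * N - R0))\<^sup>2 \<le> (norm (N - Y - R0))\<^sup>2 
     + 8 * a * (norm (P * N - X0))\<^sup>2 + 8 * a * (norm (Y - X0))\<^sup>2"
proof -
  define R where "R = N - P * N"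
  have best: "norm R \<le> norm (N - Y)" unfolding R_def by (rule best_proj_best[OF P Q])
  have pP: "proj P" "(norm P)\<^sup>2 \<le> real K" using P unfolding best_proj_def by auto
  have "(norm (R - R0))\<^sup>2 = (norm R)\<^sup>2 - 2 * inner R R0 + (norm R0)\<^sup>2"
    by (simp add: power2_norm_eq_inner inner_diff_left inner_diff_right inner_commute)
  also have "\<dots> \<le> (norm (N - Y))\<^sup>2 - 2 * inner R R0 + (norm R0)\<^sup>2" 
    using best by (simp add: power_mono)
  also have "\<dots> = (norm (N - Y - R0))\<^sup>2 + 2 * inner R0 (P * N) - 2 * inner R0 Y"
    by (simp add: R_def power2_norm_eq_inner inner_diff_left inner_diff_right inner_commute)
  also have "\<dots> \<le> (norm (N - Y - R0))\<^sup>2 + 8 * a * (norm (P * N - X0))\<^sup>2 + 8 * a * (norm (Y - X0))\<^sup>2"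
    using ref_inner[OF ref N0 X0 R0 pP, of "P * N"] ref_inner[OF ref N0 X0 R0 Q]
    by (simp add: projD[OF pP(1)])
  finally show ?thesis by (simp add: R_def)
qed

text \<open>N' - N0' is the old difference \<open>Xi\<close> of truncations plus the off-diagonal
  part \<open>T\<close> of the old difference of residuals. A competitor Y carried over from P N
  cancels \<open>Xi\<close> up to 40a |Xi|, leaving \<open>T\<close>, whose norm is at most |R -
  R0|.\<close>

lemma perturb_step:
  assumes ref: "is_ref a D P0 Z" and N0: "N0 = M + D" and X0: "X0 = P0 * N0" and R0: "R0 = N0 - X0"
    and ref': "is_ref a' D' P0' Z'" and D': "D' = diagp (X0 - M)" and N0': "N0' = M + D'" 
    and X0': "X0' = P0' * N0'" and R0': "R0' = N0' - X0'"
    and a: "a \<le> 1 / 10000" "a' \<le> a"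
    and P: "best_proj N P" and R: "R = N - P * N" and N': "N' = N - diagp R" and P': "best_proj N' P'"
  shows "(norm (N' - P' * N' - R0'))\<^sup>2 \<le> (norm (R - R0) + 40 * a * norm (P * N - X0))\<^sup>2
      + 8 * a * (norm (P' * N' - X0'))\<^sup>2 + 10 * a * (norm (P * N - X0))\<^sup>2"
    "norm (P' * N' - X0') \<le> norm (P * N - X0) + norm (R - R0) + norm (N' - P' * N' - R0')"
proof -
  define Xi where "Xi = P * N - X0"
  define T where "T = (R - R0) - diagp (R - R0)"
  have nT: "norm T \<le> norm (R - R0)" unfolding T_def by (rule norm_off_diag_le)
  have a0: "0 \<le> a" "0 \<le> a'" using refD(15)[OF ref] refD(15)[OF ref'] by auto
  obtain A C where A: "supp_in m K A" "P = A * C" using P unfolding best_proj_def by blast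
  have diff: "N' - N0' = Xi + T"
  proof -
    have 1: "Xi + (R - R0) = N - N0" by (simp add: Xi_def R R0)
    have 2: "N0' = N0 - diagp R0" using ref_step_eq[OF ref N0 X0 R0] by (simp add: N0' D')
    have "Xi + T = N - N0 - diagp (R - R0)" unfolding T_def 1[symmetric] by simp
    then show ?thesis by (simp add: N' 2 diagp_diff algebra_simps)
  qed
  obtain Y Q where Q: "proj Q" "(norm Q)\<^sup>2 \<le> real K" "Q * Y = Y" 
    and Y: "norm (Y - X0' - (P * N - X0)) \<le> 40 * a * norm (P * N - X0)"
  proof (rule ref_transport[OF ref N0 X0 R0 ref' D' N0' X0' a A(1)])
    show "P * N = A * (C * N)" by (simp add: A(2) mult.assoc)
  qed
  have Y: "norm (Y - X0' - Xi) \<le> 40 * a * norm Xi" using Y by (simp add: Xi_def)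
  have eq: "N' - Y - R0' = T - (Y - X0' - Xi)" using diff by (simp add: R0' algebra_simps)
  have n1: "norm (N' - Y - R0') \<le> norm (R - R0) + 40 * a * norm Xi"
    unfolding eq using norm_triangle_ineq4[of T "Y - X0' - Xi"] nT Y by linarith
  have "norm (Y - X0') \<le> norm Xi + 40 * a * norm Xi"
    using norm_triangle_ineq[of Xi "Y - X0' - Xi"] Y by simp
  also have "\<dots> \<le> 11 / 10 * norm Xi" using a mult_right_mono[of "40 * a" "1 / 10" "norm Xi"] by simp
  finally have "(norm (Y - X0'))\<^sup>2 \<le> (11 / 10 * norm Xi)\<^sup>2" by (intro power_mono) auto
  then have "(norm (Y - X0'))\<^sup>2 \<le> (11 / 10)\<^sup>2 * (norm Xi)\<^sup>2" by (simp only: power_mult_distrib)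
  then have n2: "8 * a' * (norm (Y - X0'))\<^sup>2 \<le> 8 * a * ((11 / 10)\<^sup>2 * (norm Xi)\<^sup>2)"
    using a a0 by (intro mult_mono) auto
  have n3: "8 * a' * (norm (P' * N' - X0'))\<^sup>2 \<le> 8 * a * (norm (P' * N' - X0'))\<^sup>2"
    using a by (intro mult_right_mono) auto
  have n4: "(norm (N' - Y - R0'))\<^sup>2 \<le> (norm (R - R0) + 40 * a * norm Xi)\<^sup>2"
    using n1 by (intro power_mono) auto
  \<comment> \<open>8 (11/10)^2 = 9.68, where 11/10 covers 1 + 40a.\<close>
  have n5: "8 * a * ((11 / 10)\<^sup>2 * (norm Xi)\<^sup>2) \<le> 10 * a * (norm Xi)\<^sup>2"
    using a0 by (simp add: power2_eq_square mult_right_mono)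
  show "(norm (N' - P' * N' - R0'))\<^sup>2 \<le> (norm (R - R0) + 40 * a * norm (P * N - X0))\<^sup>2
      + 8 * a * (norm (P' * N' - X0'))\<^sup>2 + 10 * a * (norm (P * N - X0))\<^sup>2"
    using compare_best[OF ref' N0' X0' R0' P' Q] n2 n3 n4 n5 unfolding Xi_def[symmetric] by linarith
  have eq2: "P' * N' - X0' = Xi + T - (N' - P' * N' - R0')" using diff by (simp add: R0' algebra_simps)
  show "norm (P' * N' - X0') \<le> norm (P * N - X0) + norm (R - R0) + norm (N' - P' * N' - R0')"
    unfolding eq2 Xi_def[symmetric]
    using norm_triangle_ineq4[of "Xi + T" "N' - P' * N' - R0'"] norm_triangle_ineq[of Xi T] nT by linarith
qed

end

section \<open>Propagation of the error\<close>

text \<open>\<open>h\<close> is the distance of the residuals, \<open>x\<close> that of the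
  truncations. All error terms are multiples of A = a p^2 g^2 with p = (3/2)^t, and A <= q g^2 /
  10000 for q = (9/16)^t. The slack 2 q g^2 kept below 4 g^2 shrinks at the same rate q and pays for
  them.\<close>

lemma invariant_step:
  fixes h x h' x' g a :: real
  assumes nn: "0 \<le> h" "0 \<le> x" "0 \<le> h'" "0 \<le> x'" "0 \<le> g" "0 \<le> a" and a: "a \<le> 1 / 10000 * (1 / 4) ^ t"
    and h: "h\<^sup>2 \<le> g\<^sup>2 * (4 - 2 * (9 / 16) ^ t)" and x: "x \<le> 8 * (3 / 2) ^ t * g"
    and h': "h'\<^sup>2 \<le> (h + 40 * a * x)\<^sup>2 + 8 * a * x'\<^sup>2 + 10 * a * x\<^sup>2" and x': "x' \<le> x + h + h'"
  shows "h'\<^sup>2 \<le> g\<^sup>2 * (4 - 2 * (9 / 16) ^ Suc t)" "x' \<le> 8 * (3 / 2) ^ Suc t * g"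
proof -
  define p where "p = (3 / 2 :: real) ^ t"
  define q where "q = (9 / 16 :: real) ^ t"
  have p1: "1 \<le> p" unfolding p_def by (rule one_le_power) simp
  have q0: "0 \<le> q" "q \<le> 1" unfolding q_def by (auto intro: power_le_one)
  have pq: "p\<^sup>2 * (1 / 4) ^ t = q" unfolding p_def q_def 
    by (simp add: power_mult[symmetric] mult.commute[of t 2]) (simp add: power_mult power_mult_distrib[symmetric] power2_eq_square)
  define A where "A = a * p\<^sup>2 * g\<^sup>2"
  have A0: "0 \<le> A" using nn by (simp add: A_def)
  have "a * p\<^sup>2 \<le> 1 / 10000 * (1 / 4) ^ t * p\<^sup>2" by (rule mult_right_mono[OF a]) simp
  then have ap: "a * p\<^sup>2 \<le> q / 10000" using pq by (simp add: mult.commute)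
  have Aq: "A \<le> q / 10000 * g\<^sup>2" unfolding A_def by (rule mult_right_mono[OF ap]) simp
  have a1: "a \<le> 1 / 10000" using a power_le_one[of "1/4 :: real" t] by simp
  have "h\<^sup>2 \<le> g\<^sup>2 * 4" using h mult_left_mono[of "4 - 2 * q" 4 "g\<^sup>2"] q0 by (simp add: q_def)
  then have "h\<^sup>2 \<le> (2 * g)\<^sup>2" by simp
  then have h2: "h \<le> 2 * g" using nn power2_le_imp_le[of h "2 * g"] by simp
  have x8: "x \<le> 8 * (p * g)" using x by (simp add: p_def)
  have gp: "g \<le> p * g" using p1 nn mult_right_mono[of 1 p g] by simp
  have pg0: "0 \<le> p * g" using p1 nn by simp
  have xx: "x\<^sup>2 \<le> 64 * (p * g)\<^sup>2" using power_mono[OF x8 nn(2), of 2] by simp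
  have hx: "h * x \<le> 2 * (p * g) * (8 * (p * g))" by (rule mult_mono) (use nn h2 gp x8 in auto)
  have Apg: "a * (p * g)\<^sup>2 = A" by (simp add: A_def power_mult_distrib)
  have t1: "80 * a * (h * x) \<le> 1280 * A"
    using mult_left_mono[OF hx nn(6)] by (simp add: Apg[symmetric] power2_eq_square mult_ac)
  have t2: "a * x\<^sup>2 \<le> 64 * A"
    using mult_left_mono[OF xx nn(6)] by (simp add: Apg[symmetric])
  have "a * (a * x\<^sup>2) \<le> 1 / 10000 * (64 * A)" by (rule mult_mono) (use a1 t2 nn in auto)
  then have t3: "1600 * (a * (a * x\<^sup>2)) \<le> 11 * A" using A0 by simp
  have "x' \<le> 10 * (p * g) + h'" using x' x8 h2 gp by simp
  then have "x'\<^sup>2 \<le> (10 * (p * g) + h')\<^sup>2" by (rule power_mono[OF _ nn(4)])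
  also have "\<dots> \<le> 200 * (p * g)\<^sup>2 + 2 * h'\<^sup>2" 
    using zero_le_power2[of "10 * (p * g) - h'"] by (simp add: power2_eq_square algebra_simps)
  finally have "a * x'\<^sup>2 \<le> a * (200 * (p * g)\<^sup>2 + 2 * h'\<^sup>2)" by (rule mult_left_mono[OF _ nn(6)])
  then have t4: "8 * a * x'\<^sup>2 \<le> 1600 * A + 16 * (a * h'\<^sup>2)" by (simp add: Apg[symmetric] algebra_simps)
  have "(h + 40 * a * x)\<^sup>2 = h\<^sup>2 + 80 * a * (h * x) + 1600 * (a * (a * x\<^sup>2))"
    by (simp add: power2_eq_square algebra_simps)
  \<comment> \<open>3531 = 1280 + 11 + 640 + 1600: the cross term, the square of 40ax, the term
    10ax^2, and the part of the \<open>x'\<close> term free of \<open>h'\<close>.\<close>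
  then have main: "h'\<^sup>2 \<le> h\<^sup>2 + 3531 * A + 16 * (a * h'\<^sup>2)" using h' t1 t2 t3 t4 by simp
  have "a * h'\<^sup>2 \<le> 1 / 10000 * h'\<^sup>2" by (rule mult_right_mono[OF a1]) simp
  moreover have "A \<le> 1 / 10000 * g\<^sup>2" using Aq q0 mult_right_mono[of q 1 "g\<^sup>2"] by simp
  \<comment> \<open>A crude bound on \<open>h'\<close>, fed back to remove it from the right-hand
    side; this adds 16 * 5 = 80 to 3531.\<close>
  ultimately have h5: "h'\<^sup>2 \<le> 5 * g\<^sup>2" 
    using main \<open>h\<^sup>2 \<le> g\<^sup>2 * 4\<close> zero_le_power2[of g] by linarith
  have "a * h'\<^sup>2 \<le> a * (5 * g\<^sup>2)" by (rule mult_left_mono[OF h5 nn(6)])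
  also have "\<dots> \<le> 5 * A" unfolding A_def using p1 nn mult_left_mono[of 1 "p\<^sup>2" "a * g\<^sup>2"] 
    by (simp add: mult_ac)
  finally have "h'\<^sup>2 \<le> h\<^sup>2 + 3611 * A" using main by simp
  also have "\<dots> \<le> g\<^sup>2 * (4 - 2 * q) + 3611 * (q / 10000 * g\<^sup>2)" using h Aq by (simp add: q_def)
  \<comment> \<open>The slack released in one step is (2 - 9/8) q g^2, more than 0.3611 q
    g^2.\<close>
  also have "\<dots> \<le> g\<^sup>2 * (4 - 2 * (9 / 16 * q))" 
    using mult_nonneg_nonneg[OF q0(1) zero_le_power2[of g]] by (simp add: algebra_simps)
  finally show res: "h'\<^sup>2 \<le> g\<^sup>2 * (4 - 2 * (9 / 16) ^ Suc t)" by (simp add: q_def)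
  have "h'\<^sup>2 \<le> g\<^sup>2 * 4" 
    using order_trans[OF res mult_left_mono[of "4 - 2 * (9 / 16) ^ Suc t" 4 "g\<^sup>2"]] by simp
  then have "h'\<^sup>2 \<le> (2 * g)\<^sup>2" by simp
  then have "h' \<le> 2 * g" using nn power2_le_imp_le[of h' "2 * g"] by simp
  \<comment> \<open>8p + 2 + 2 <= 12p = 8 (3/2) p.\<close>
  then show "x' \<le> 8 * (3 / 2) ^ Suc t * g" using x' x8 h2 gp by (simp add: p_def[symmetric])
qed

context incoherent
begin

text \<open>By incoherence PV P e_j contributes at most 1/100 to the entry P_jj, so |(I - PV)P e_j|
  >= 1/4 whenever P_jj >= 1/2. The squares sum to |P|^2 - |PV P|^2, and |P|^2 <= K = |V|^2 bounds
  this by |(I - P)V|^2.\<close>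

lemma card_retained:
  assumes P: "proj P" "supp_in m m P" "(norm P)\<^sup>2 \<le> real K"
  shows "real (card {j. j < m \<and> 1 / 2 \<le> ent P j j}) \<le> 16 * (norm (V - P * V))\<^sup>2"
proof -
  define J where "J = {j. j < m \<and> 1 / 2 \<le> ent P j j}"
  define F where "F = P - PV * P"
  have sF: "supp_in m m F" unfolding F_def by (rule supp_in_diff[OF P(2) supp_in_mult[OF supp_PV P(2)]])
  have each: "1 / 16 \<le> (norm (F * unit_col j))\<^sup>2" if j: "j \<in> J" for j
  proof -
    define e where "e = unit_col j"
    define y where "y = P * e"
    have jm: "j < m" and pj: "1 / 2 \<le> inner e y" using j by (auto simp: J_def ent_eq_inner e_def y_def)
    have ne: "norm e = 1" by (simp add: e_def)
    have ny: "norm y \<le> 1" using opbD[OF proj_opnorm_le[OF P(1)], of e] by (simp add: y_def ne)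
    have "inner e (PV * y) = inner (adj V * e) (adj V * y)" by (simp add: PV_def inner_mult_left mult.assoc)
    also have "\<dots> \<le> norm (adj V * e) * norm (adj V * y)" by (rule norm_cauchy_schwarz)
    also have "\<dots> \<le> 1 / 100 * (1 * norm y)" 
      using sqrt_mu[OF jm] sqrt_mu_le by (intro mult_mono opbD[OF opnorm_le_adjV]) (auto simp: e_def)
    finally have "inner e (PV * y) \<le> 1 / 100" using ny by simp
    moreover have "F * e = y - PV * y" by (simp add: F_def y_def left_diff_distrib mult.assoc)
    then have "inner e y - inner e (PV * y) \<le> norm (F * e)" 
      using norm_cauchy_schwarz[of e "F * e"] ne by (simp add: inner_diff_right)
    ultimately have "1 / 4 \<le> norm (F * e)" using pj by simp
    then have "(1 / 4)\<^sup>2 \<le> (norm (F * e))\<^sup>2" by (intro power_mono) auto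
    then show ?thesis by (simp add: e_def power2_eq_square)
  qed
  have fJ: "finite J" by (simp add: J_def)
  have "real (card J) * (1 / 16) = (\<Sum>j\<in>J. 1 / 16)" by simp
  also have "\<dots> \<le> (\<Sum>j\<in>J. (norm (F * unit_col j))\<^sup>2)" by (rule sum_mono[OF each])
  also have "\<dots> \<le> (\<Sum>j<m. (norm (F * unit_col j))\<^sup>2)" by (rule sum_mono2) (auto simp: J_def)
  also have "\<dots> = (norm F)\<^sup>2" by (rule norm_sq_eq_cols[OF sF, symmetric])
  also have "\<dots> = (norm P)\<^sup>2 - (norm (PV * P))\<^sup>2" 
    using proj_pythagoras[OF proj_PV, of P] by (simp add: F_def)
  also have "norm (PV * P) = norm (P * V)"
  proof -
    have "norm (PV * P) = norm (adj V * P)" 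
      unfolding PV_def mult.assoc by (rule norm_V_mult[OF supp_in_mult[OF adjV_supp P(2)]])
    also have "\<dots> = norm (P * V)" by (metis norm_adj projD(1)[OF P(1)] adj_mult adj_adj)
    finally show ?thesis .
  qed
  also have "(norm P)\<^sup>2 - (norm (P * V))\<^sup>2 \<le> (norm (V - P * V))\<^sup>2"
    using proj_pythagoras[OF P(1), of V] P(3) norm_V_sq by simp
  finally show ?thesis by (simp add: J_def)
qed

text \<open>Pair (I - P)V with itself, writing one copy as (I - P)M V L^{-1} and splitting the
  middle index into J and its complement. On J the terms are few and small. Off J, (I - P)M = H + R0
  - (I - P)D, where |H| <= 3g and D is read off from the diagonal of this same identity. In both
  parts x = |(I - P)V| returns only with a small coefficient and is absorbed.\<close>

lemma final_bound:
  assumes P: "proj P" "supp_in m m P" "(norm P)\<^sup>2 \<le> real K"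
    and N: "N = M + Gam + diagm m d" and Gam: "supp_in m m Gam" "norm Gam \<le> g"
    and R0: "opnorm_le R0 r" "supp_in m m R0" and R: "norm (N - P * N - R0) \<le> 2 * g"
  shows "norm (V - P * V) \<le> 4 * g + 5 * r * sqrt (real K)"
proof -
  define x where "x = norm (V - P * V)"
  define D where "D = diagm m d"
  define QV where "QV = V - P * V"
  define QM where "QM = M - P * M"
  define QD where "QD = D - P * D"
  define H where "H = M + D - P * (M + D) - R0"
  define k where "k = sqrt (real K)"
  have r0: "0 \<le> r" by (rule opnorm_le_nonneg[OF R0(1)])
  have g0: "0 \<le> g" using Gam(2) norm_ge_zero order_trans by blast
  have x0: "0 \<le> x" by (simp add: x_def)
  have nV: "norm V = k" using norm_V_sq by (metis k_def norm_ge_zero real_sqrt_abs abs_of_nonneg)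
  have opQV: "opnorm_le QV 1" unfolding QV_def by (rule opnorm_le_proj_compl[OF P(1) opnorm_le_V])
  have sQV: "supp_in m K QV" unfolding QV_def by (rule supp_in_diff[OF supp_V supp_in_mult[OF P(2) supp_V]])
  have QM_eq: "QM = QV * (L * adj V)" by (simp add: QM_def QV_def M_def left_diff_distrib mult.assoc)
  have "H = (N - P * N - R0) - (Gam - P * Gam)" by (simp add: H_def N D_def algebra_simps)
  then have nH: "norm H \<le> 3 * g"
    using norm_triangle_ineq4[of "N - P * N - R0" "Gam - P * Gam"] R proj_compl_le[OF P(1), of Gam] Gam(2) by simp
  have sMD: "supp_in m m (M + D)" unfolding D_def by (rule supp_in_add[OF supp_M supp_in_diagm])
  have sH: "supp_in m m H" unfolding H_def by (rule supp_in_diff[OF supp_in_diff[OF sMD supp_in_mult[OF P(2) sMD]] R0(2)])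
  have QM_H: "QM = H + R0 - QD" by (simp add: H_def QM_def QD_def algebra_simps)
  define J where "J = {j. j < m \<and> 1 / 2 \<le> ent P j j}"
  define chi where "chi j = (if j \<in> J then 1 else (0::real))" for j
  define PJ where "PJ = diagm m chi"
  define Pc where "Pc = diagm m (\<lambda>j. 1 - chi j)"
  define f where "f j = d j * (1 - chi j)" for j
  have PJc: "PJ + Pc = idm m" unfolding PJ_def Pc_def idm_eq_diagm diagm_add_diagm by simp
  have sVLi: "supp_in m K (V * Li)" unfolding Li_def by (rule supp_in_mult[OF supp_V supp_in_diagm])
  have "QV = QM * (V * Li)" by (simp add: QM_def QV_def left_diff_distrib mult.assoc M_VLi)
  also have "V * Li = (PJ + Pc) * (V * Li)" by (simp add: PJc idm_mult[OF sVLi])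
  finally have QV_split: "QV = QM * (PJ * (V * Li)) + QM * (Pc * (V * Li))" by (simp add: algebra_simps)
  define v where "v j = adj V * unit_col j" for j
  have fJ: "finite J" by (simp add: J_def)

  \<comment> \<open>For each j the pairing is between (I - P)V applied to L^{-1} v_j and to L v_j.
    As L^{-1} costs nothing, one factor \<open>kap\<close> suffices: each index contributes at most
    kap |v_j|^2.\<close>
  have T1: "inner QV (QM * (PJ * (V * Li))) \<le> real (card J) * (1 / 10000)"
  proof -
    have "PJ = (\<Sum>j\<in>J. unit_col j * adj (unit_col j))"
      unfolding PJ_def diagm_eq_sum by (intro sum.mono_neutral_cong_right) (auto simp: chi_def J_def)
    then have "inner QV (QM * (PJ * (V * Li))) 
      = (\<Sum>j\<in>J. inner QV (QM * unit_col j * (adj (unit_col j) * (V * Li))))"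
      by (simp add: sum_distrib_left sum_distrib_right inner_sum_right mult.assoc)
    also have "\<dots> \<le> (\<Sum>j\<in>J. 1 / 10000)"
    proof (rule sum_mono)
      fix j assume "j \<in> J"
      then have jm: "j < m" by (simp add: J_def)
      have "inner QV (QM * unit_col j * (adj (unit_col j) * (V * Li))) 
         = inner (QV * (Li * v j)) (QV * (L * v j))"
      proof -
        have 1: "adj (adj (unit_col j) * (V * Li)) = Li * v j" by (simp add: adj_mult v_def Li_def mult.assoc)
        have 2: "QM * unit_col j = QV * (L * v j)" by (simp add: QM_eq v_def mult.assoc)
        show ?thesis unfolding 2 
          using inner_mult_right[of "QV * (L * v j)" "adj (unit_col j) * (V * Li)" QV] unfolding 1
          by (simp only: inner_commute)
      qed
      also have "\<dots> \<le> norm (QV * (Li * v j)) * norm (QV * (L * v j))" by (rule norm_cauchy_schwarz)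
      also have "\<dots> \<le> (1 * (1 * norm (v j))) * (1 * (kap * norm (v j)))"
        by (intro mult_mono order_trans[OF opbD[OF opQV]] mult_left_mono opbD[OF opnorm_le_Li] opbD[OF opnorm_le_L]) 
          (use kap in auto)
      also have "\<dots> = kap * (norm (v j))\<^sup>2" by (simp add: power2_eq_square)
      also have "\<dots> \<le> kap * mu" using rows[OF jm] kap by (simp add: v_def mult_left_mono)
      also have "\<dots> \<le> 1 / 10000" using mu by (simp add: mult.commute)
      finally show "inner QV (QM * unit_col j * (adj (unit_col j) * (V * Li))) \<le> 1 / 10000" .
    qed
    finally show ?thesis by simp
  qed
  have J16: "real (card J) \<le> 16 * x\<^sup>2" unfolding J_def x_def by (rule card_retained[OF P])

  have opPc: "opnorm_le Pc 1" unfolding Pc_def by (rule opnorm_le_diagm) (auto simp: chi_def)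
  have opPcVLi: "opnorm_le (Pc * (V * Li)) 1" using opnorm_le_mult[OF opPc opnorm_le_mult[OF opnorm_le_V opnorm_le_Li]] by simp
  have n1: "norm (H * (Pc * (V * Li))) \<le> 3 * g" using opnorm_le_right[OF opPcVLi, of H] nH by simp
  have "norm (Pc * (V * Li)) \<le> k" using opbD[OF opPc, of "V * Li"] opnorm_le_right[OF opnorm_le_Li, of V] nV by simp
  then have n2: "norm (R0 * (Pc * (V * Li))) \<le> r * k" 
    using opbD[OF R0(1), of "Pc * (V * Li)"] mult_left_mono[OF _ r0] order_trans by blast
  have sum_v: "(\<Sum>j<m. (norm (v j))\<^sup>2) = real K"
    using norm_sq_eq_cols[OF adjV_supp] norm_V_sq by (simp add: v_def)
  define w where "w j = norm (adj QV * unit_col j)" for j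
  have sum_w: "(\<Sum>j<m. (w j)\<^sup>2) = x\<^sup>2"
    using norm_sq_eq_cols[OF supp_in_adj[OF sQV]] by (simp add: w_def x_def QV_def)
  have sum_H: "(\<Sum>j<m. (norm (H * unit_col j))\<^sup>2) = (norm H)\<^sup>2"
    by (rule norm_sq_eq_cols[OF sH, symmetric])
  \<comment> \<open>The j-th diagonal entry of (I - P)D = H + R0 - (I - P)M reads d_j (1 - P_jj) on
    the left, and 1 - P_jj > 1/2 allows solving for d_j. The 12 is 2^2 from this division times 3
    from squaring a sum of three terms.\<close>
  have of_vec: "(f j)\<^sup>2 * (norm (v j))\<^sup>2 
     \<le> 12 * (mu * (norm (H * unit_col j))\<^sup>2 + r\<^sup>2 * (norm (v j))\<^sup>2 + (kap * mu)\<^sup>2 * (w j)\<^sup>2)" if j: "j < m" for j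
  proof (cases "j \<in> J")
    case True
    then have "f j = 0" by (simp add: f_def chi_def)
    then show ?thesis using mu by simp
  next
    case False
    then have fj: "f j = d j" and pj: "ent P j j < 1 / 2" using j by (auto simp: f_def chi_def J_def)
    define e where "e = unit_col j"
    have ne: "norm e = 1" by (simp add: e_def)
    have De: "D * e = d j *\<^sub>R e" using j by (simp add: D_def e_def diagm_mult_unit_col)
    have "inner e (QD * e) = d j * (1 - ent P j j)"
      by (simp add: QD_def left_diff_distrib mult.assoc De inner_diff_right power2_norm_eq_inner[symmetric] ne
          ent_eq_inner e_def[symmetric] right_diff_distrib)
    also have "QD = H + R0 - QM" by (simp add: QM_H)
    finally have eq: "d j * (1 - ent P j j) = inner e (H * e) + inner e (R0 * e) - inner e (QM * e)"
      by (simp add: algebra_simps inner_diff_right inner_add_right)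
    have a1: "\<bar>inner e (H * e)\<bar> \<le> norm (H * e)" using Cauchy_Schwarz_ineq2[of e "H * e"] ne by simp
    have a2: "\<bar>inner e (R0 * e)\<bar> \<le> r" using abs_inner_mult_le[OF R0(1), of e e] ne by simp
    have "inner e (QM * e) = inner (adj QV * e) (L * v j)" by (simp add: QM_eq inner_mult_left mult.assoc v_def e_def)
    then have "\<bar>inner e (QM * e)\<bar> \<le> norm (adj QV * e) * norm (L * v j)" using Cauchy_Schwarz_ineq2 by metis
    also have "\<dots> \<le> w j * (kap * norm (v j))" unfolding w_def e_def by (intro mult_left_mono opbD[OF opnorm_le_L]) simp
    finally have a3: "\<bar>inner e (QM * e)\<bar> \<le> w j * (kap * norm (v j))" .
    have "\<bar>d j\<bar> * (1 / 2) \<le> \<bar>d j\<bar> * (1 - ent P j j)" using pj by (intro mult_left_mono) auto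
    also have "\<dots> = \<bar>d j * (1 - ent P j j)\<bar>" using pj by (simp add: abs_mult)
    also have "\<dots> \<le> norm (H * e) + r + w j * (kap * norm (v j))" unfolding eq using a1 a2 a3 by linarith
    finally have "\<bar>d j\<bar> \<le> 2 * (norm (H * e) + r + w j * (kap * norm (v j)))" by simp
    then have "(d j)\<^sup>2 \<le> (2 * (norm (H * e) + r + w j * (kap * norm (v j))))\<^sup>2"
      by (metis abs_ge_zero power2_abs power_mono)
    also have "\<dots> \<le> 12 * ((norm (H * e))\<^sup>2 + r\<^sup>2 + (w j * (kap * norm (v j)))\<^sup>2)"
    proof -
      have "(2 * (p + q + s))\<^sup>2 \<le> 12 * (p\<^sup>2 + q\<^sup>2 + s\<^sup>2)" for p q s :: real
        using zero_le_power2[of "p - q"] zero_le_power2[of "p - s"] zero_le_power2[of "q - s"]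
        by (simp add: power2_eq_square algebra_simps)
      then show ?thesis .
    qed
    finally have dj: "(d j)\<^sup>2 \<le> 12 * ((norm (H * e))\<^sup>2 + r\<^sup>2 + (w j * (kap * norm (v j)))\<^sup>2)" .
    have vm: "(norm (v j))\<^sup>2 \<le> mu" using rows[OF j] by (simp add: v_def)
    have b1: "(norm (H * e))\<^sup>2 * (norm (v j))\<^sup>2 \<le> mu * (norm (H * e))\<^sup>2" 
      using mult_left_mono[OF vm, of "(norm (H * e))\<^sup>2"] by (simp add: mult.commute)
    have "(norm (v j))\<^sup>2 * (norm (v j))\<^sup>2 \<le> mu * mu" by (rule mult_mono[OF vm vm]) (use mu in auto)
    then have "((w j)\<^sup>2 * kap\<^sup>2) * ((norm (v j))\<^sup>2 * (norm (v j))\<^sup>2) \<le> ((w j)\<^sup>2 * kap\<^sup>2) * (mu * mu)"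
      by (intro mult_left_mono) auto
    then have b2: "(w j * (kap * norm (v j)))\<^sup>2 * (norm (v j))\<^sup>2 \<le> (kap * mu)\<^sup>2 * (w j)\<^sup>2"
      by (simp add: power_mult_distrib mult_ac power2_eq_square)
    have "(f j)\<^sup>2 * (norm (v j))\<^sup>2 \<le> 12 * ((norm (H * e))\<^sup>2 + r\<^sup>2 + (w j * (kap * norm (v j)))\<^sup>2) * (norm (v j))\<^sup>2"
      unfolding fj by (rule mult_right_mono[OF dj]) simp
    also have "\<dots> = 12 * ((norm (H * e))\<^sup>2 * (norm (v j))\<^sup>2 + r\<^sup>2 * (norm (v j))\<^sup>2 
         + (w j * (kap * norm (v j)))\<^sup>2 * (norm (v j))\<^sup>2)" by (simp add: algebra_simps)
    also have "\<dots> \<le> 12 * (mu * (norm (H * e))\<^sup>2 + r\<^sup>2 * (norm (v j))\<^sup>2 + (kap * mu)\<^sup>2 * (w j)\<^sup>2)"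
      by (intro mult_left_mono add_mono b1 b2 order_refl) simp
    finally show ?thesis by (simp add: e_def)
  qed
  \<comment> \<open>Since (I - P) and L^{-1} do not increase norms, the square is at most the sum of
    f_j^2 |v_j|^2. The coefficients come from 12 * 9 / 10^4 <= (11/100)^2, 12 <= (7/2)^2 and 12 /
    10^8 <= (1/1000)^2.\<close>
  have n3: "norm (QD * (Pc * (V * Li))) \<le> 11 / 100 * g + 7 / 2 * (r * k) + 1 / 1000 * x"
  proof (rule power2_le_imp_le)
    have "QD * (Pc * (V * Li)) = (diagm m f * (V * Li)) - P * (diagm m f * (V * Li))"
    proof -
      have 1: "D * Pc = diagm m f" by (simp add: D_def Pc_def diagm_mult_diagm f_def[abs_def])
      show ?thesis unfolding 1[symmetric] by (simp add: QD_def left_diff_distrib mult.assoc)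
    qed
    then have "norm (QD * (Pc * (V * Li))) \<le> norm (diagm m f * V * Li)" 
      using proj_compl_le[OF P(1), of "diagm m f * (V * Li)"] by (simp add: mult.assoc)
    also have "\<dots> \<le> norm (diagm m f * V)" using opnorm_le_right[OF opnorm_le_Li, of "diagm m f * V"] by simp
    also have "norm (diagm m f * V) = norm (adj V * diagm m f)" by (metis norm_adj adj_diagm adj_mult adj_adj)
    finally have "(norm (QD * (Pc * (V * Li))))\<^sup>2 \<le> (norm (adj V * diagm m f))\<^sup>2" by (simp add: power_mono)
    also have "\<dots> = (\<Sum>j<m. (norm (adj V * (diagm m f * unit_col j)))\<^sup>2)"
      using norm_sq_eq_cols[OF supp_in_mult[OF adjV_supp supp_in_diagm]] by (simp add: mult.assoc)
    also have "\<dots> = (\<Sum>j<m. (f j)\<^sup>2 * (norm (v j))\<^sup>2)"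
      by (intro sum.cong refl) (simp add: diagm_mult_unit_col v_def power_mult_distrib)
    also have "\<dots> \<le> (\<Sum>j<m. 12 * (mu * (norm (H * unit_col j))\<^sup>2 + r\<^sup>2 * (norm (v j))\<^sup>2 + (kap * mu)\<^sup>2 * (w j)\<^sup>2))"
      by (rule sum_mono) (use of_vec in auto)
    also have "\<dots> = 12 * (mu * (norm H)\<^sup>2 + r\<^sup>2 * real K + (kap * mu)\<^sup>2 * x\<^sup>2)"
      by (simp add: sum_distrib_left[symmetric] sum.distrib sum_H[symmetric] sum_w[symmetric] sum_v[symmetric])
    also have "\<dots> \<le> (11 / 100 * g)\<^sup>2 + (7 / 2 * (r * k))\<^sup>2 + (1 / 1000 * x)\<^sup>2"
    proof -
      have sq: "(c * y)\<^sup>2 = c\<^sup>2 * y\<^sup>2" "0 \<le> y\<^sup>2" for c y :: real by (simp_all add: power_mult_distrib)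
      have num: "(11 / 100 :: real)\<^sup>2 = 121 / 10000" "(7 / 2 :: real)\<^sup>2 = 49 / 4" 
        "(1 / 1000 :: real)\<^sup>2 = 1 / 1000000" "(1 / 10000 :: real)\<^sup>2 = 1 / 100000000"
        by (simp_all add: power2_eq_square)
      have "(norm H)\<^sup>2 \<le> 9 * g\<^sup>2" using power_mono[OF nH norm_ge_zero, of 2] by (simp add: sq)
      then have "mu * (norm H)\<^sup>2 \<le> 1 / 10000 * (9 * g\<^sup>2)" using mu_le mu by (intro mult_mono) auto
      then have c1: "12 * (mu * (norm H)\<^sup>2) \<le> (11 / 100 * g)\<^sup>2" 
        using sq(2)[of g] unfolding sq(1)[of _ g] num by linarith
      have "r\<^sup>2 * real K = (r * k)\<^sup>2" by (simp add: k_def power_mult_distrib)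
      then have c2: "12 * (r\<^sup>2 * real K) \<le> (7 / 2 * (r * k))\<^sup>2" 
        using sq(2)[of "r * k"] unfolding sq(1)[of _ "r * k"] num by linarith
      have "(kap * mu)\<^sup>2 \<le> (1 / 10000)\<^sup>2" using mu kap by (intro power_mono) (auto simp: mult.commute)
      then have "(kap * mu)\<^sup>2 * x\<^sup>2 \<le> (1 / 10000)\<^sup>2 * x\<^sup>2" by (rule mult_right_mono) simp
      then have c3: "12 * ((kap * mu)\<^sup>2 * x\<^sup>2) \<le> (1 / 1000 * x)\<^sup>2" 
        using sq(2)[of x] unfolding sq(1)[of _ x] num by linarith
      show ?thesis unfolding distrib_left by (intro add_mono c1 c2 c3)
    qed
    also have "\<dots> \<le> (11 / 100 * g + 7 / 2 * (r * k) + 1 / 1000 * x)\<^sup>2"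
    proof -
      have "p\<^sup>2 + q\<^sup>2 + s\<^sup>2 \<le> (p + q + s)\<^sup>2" if "0 \<le> p" "0 \<le> q" "0 \<le> s" for p q s :: real
        using that by (simp add: power2_eq_square algebra_simps add_nonneg_nonneg)
      then show ?thesis using g0 r0 x0 by (simp add: k_def)
    qed
    finally show "(norm (QD * (Pc * (V * Li))))\<^sup>2 \<le> (11 / 100 * g + 7 / 2 * (r * k) + 1 / 1000 * x)\<^sup>2" .
    show "0 \<le> 11 / 100 * g + 7 / 2 * (r * k) + 1 / 1000 * x" using g0 r0 x0 by (simp add: k_def)
  qed
  define B where "B = 3 * g + r * k + (11 / 100 * g + 7 / 2 * (r * k) + 1 / 1000 * x)"
  have T2: "inner QV (QM * (Pc * (V * Li))) \<le> x * B"
  proof -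
    have eq: "QM * (Pc * (V * Li)) = H * (Pc * (V * Li)) + R0 * (Pc * (V * Li)) - QD * (Pc * (V * Li))"
      by (simp add: QM_H left_diff_distrib distrib_right)
    have nB: "norm (QM * (Pc * (V * Li))) \<le> B"
      unfolding eq B_def
      using n1 n2 n3 norm_triangle_ineq4[of "H * (Pc * (V * Li)) + R0 * (Pc * (V * Li))" "QD * (Pc * (V * Li))"]
        norm_triangle_ineq[of "H * (Pc * (V * Li))" "R0 * (Pc * (V * Li))"] by linarith
    have "inner QV (QM * (Pc * (V * Li))) \<le> x * norm (QM * (Pc * (V * Li)))"
      unfolding x_def QV_def[symmetric] by (rule norm_cauchy_schwarz)
    also have "\<dots> \<le> x * B" by (rule mult_left_mono[OF nB x0])
    finally show ?thesis .
  qed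
  have "x\<^sup>2 = inner QV QV" by (simp add: x_def QV_def power2_norm_eq_inner)
  also have "\<dots> = inner QV (QM * (PJ * (V * Li))) + inner QV (QM * (Pc * (V * Li)))"
    by (subst (2) QV_split) (simp add: inner_add_right)
  also have "\<dots> \<le> 16 * x\<^sup>2 * (1 / 10000) + x * B" using T1 T2 J16 by simp
  \<comment> \<open>The part on J costs 16/10000 of x^2. With the x/1000 inside \<open>B\<close>,
    0.9974 x remains on the left, against 3.11 g + 4.5 r k.\<close>
  finally have "x * (x * (9984 / 10000)) \<le> x * B" by (simp add: power2_eq_square)
  then have "x \<le> 4 * g + 5 * (r * k)"
  proof (cases "x = 0")
    case True
    then show ?thesis using g0 r0 by (simp add: k_def)
  next
    case False
    then have "x * (9984 / 10000) \<le> B" using \<open>x * (x * (9984 / 10000)) \<le> x * B\<close> x0 by simp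
    moreover have "0 \<le> r * k" using r0 by (simp add: k_def)
    ultimately show ?thesis using g0 unfolding B_def by linarith
  qed
  then show ?thesis by (simp add: x_def k_def mult.assoc)
qed

text \<open>
  The first bound never exceeds \<open>4 g\<^sup>2\<close>; the growth in the second one is harmless because the reference
  perturbation decays like \<open>4\<^sup>-\<^sup>t\<close>.
\<close>

definition tracked :: "fmat \<Rightarrow> real \<Rightarrow> nat \<Rightarrow> fmat \<Rightarrow> bool" where
  "tracked Gam g t N \<longleftrightarrow> (\<exists>D P0 Z. is_ref (1 / 10000 * (1 / 4) ^ t) D P0 Z \<and> (\<exists>d. N = M + Gam + diagm m d) \<and>
     (\<forall>P. best_proj N P \<longrightarrow> 
        (norm (N - P * N - (M + D - P0 * (M + D))))\<^sup>2 \<le> g\<^sup>2 * (4 - 2 * (9 / 16) ^ t) \<and>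
        norm (P * N - P0 * (M + D)) \<le> 8 * (3 / 2) ^ t * g))"

text \<open>Both runs start with the diagonal of M removed, so they differ by exactly
  \<open>Gam\<close>, and the noiseless truncation itself serves as competitor. This gives h^2 <=
  g^2 + 8a x^2 with x <= g + h, closed by the smallness of a.\<close>

lemma tracked_init:
  assumes Gam: "norm Gam \<le> g"
  shows "tracked Gam g 0 (M + Gam - diagp M)"
proof -
  define a where "a = (1 / 10000 :: real)"
  define D where "D = diagm m (\<lambda>i. - ent M i i)"
  have D: "D = - diagp M" unfolding D_def by (rule fmat_eqI) (auto simp: ent_diagm supp_inD[OF supp_M])
  obtain P0 Z where ref: "is_ref a D P0 Z" 
    using ref_exists[of "\<lambda>i. - ent M i i" a] M_diag unfolding D_def a_def by fastforce
  note r = refD[OF ref]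
  define N where "N = M + Gam - diagp M"
  define N0 where "N0 = M + D"
  define X0 where "X0 = P0 * N0"
  define R0 where "R0 = N0 - X0"
  have g0: "0 \<le> g" using Gam norm_ge_zero order_trans by blast
  have bound: "(norm (N - P * N - R0))\<^sup>2 \<le> g\<^sup>2 * 2 \<and> norm (P * N - X0) \<le> 8 * g" if P: "best_proj N P" for P
  proof -
    define h where "h = norm (N - P * N - R0)"
    define x where "x = norm (P * N - X0)"
    have diff: "N - N0 = Gam" by (simp add: N_def N0_def D)
    have "h\<^sup>2 \<le> (norm (N - X0 - R0))\<^sup>2 + 8 * a * x\<^sup>2 + 8 * a * (norm (X0 - X0))\<^sup>2"
      unfolding h_def x_def
      by (rule compare_best[OF ref N0_def X0_def R0_def P r(1)]) (use r(4) in \<open>auto simp: X0_def projD[OF r(1)]\<close>)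
    also have "N - X0 - R0 = Gam" using diff by (simp add: R0_def)
    finally have 1: "h\<^sup>2 \<le> g\<^sup>2 + 8 / 10000 * x\<^sup>2" using power_mono[OF Gam norm_ge_zero, of 2] by (simp add: a_def)
    have eq: "P * N - X0 = Gam - (N - P * N - R0)" using diff by (simp add: R0_def algebra_simps)
    have 2: "x \<le> g + h" unfolding x_def eq h_def 
      using norm_triangle_ineq4[of Gam "N - P * N - R0"] Gam by linarith
    have nn: "0 \<le> x" "0 \<le> h" by (simp_all add: x_def h_def)
    have "x\<^sup>2 \<le> (g + h)\<^sup>2" using 2 nn by (intro power_mono) auto
    also have "\<dots> \<le> 2 * g\<^sup>2 + 2 * h\<^sup>2" using zero_le_power2[of "g - h"] by (simp add: power2_eq_square algebra_simps)
    finally have 3: "h\<^sup>2 \<le> g\<^sup>2 * 2" using 1 zero_le_power2[of g] by linarith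
    have "(2 * g)\<^sup>2 = 4 * g\<^sup>2" by simp
    then have "h\<^sup>2 \<le> (2 * g)\<^sup>2" using 3 zero_le_power2[of g] by linarith
    then have "h \<le> 2 * g" using g0 power2_le_imp_le[of h "2 * g"] by simp
    then have "x \<le> 8 * g" using 2 g0 by simp
    with 3 show ?thesis by (simp add: h_def x_def)
  qed
  have form: "\<exists>d. N = M + Gam + diagm m d" 
    by (rule exI[of _ "\<lambda>i. - ent M i i"]) (simp add: N_def D_def[symmetric] D)
  have "is_ref (1 / 10000 * (1 / 4) ^ 0) D P0 Z" using ref by (simp add: a_def)
  moreover have "\<forall>P. best_proj N P \<longrightarrow> (norm (N - P * N - (M + D - P0 * (M + D))))\<^sup>2 \<le> g\<^sup>2 * (4 - 2 * (9 / 16) ^ 0) \<and>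
        norm (P * N - P0 * (M + D)) \<le> 8 * (3 / 2) ^ 0 * g"
    using bound unfolding X0_def N0_def R0_def by simp
  ultimately show ?thesis unfolding tracked_def N_def[symmetric] using form by blast
qed

text \<open>The invariant holds for every optimal projection of N, in particular for the one chosen
  by the run. \<open>ref_contract\<close> supplies the next noiseless perturbation at a quarter of
  the size, \<open>perturb_step\<close> and \<open>invariant_step\<close> the two bounds.\<close>

lemma tracked_step:
  assumes tracked: "tracked Gam g t N" and Gam: "supp_in m m Gam" and g: "0 \<le> g"
    and P: "best_proj N P" and N': "N' = N - diagp (N - P * N)"
  shows "tracked Gam g (Suc t) N'"
proof -
  define a where "a = 1 / 10000 * (1 / 4 :: real) ^ t"
  define a' where "a' = 1 / 10000 * (1 / 4 :: real) ^ Suc t"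
  have a: "a \<le> 1 / 10000" "a' \<le> a" "0 \<le> a'" "a' = a / 4"
    unfolding a_def a'_def using power_le_one[of "1/4 :: real" t] by auto
  obtain D P0 Z d where ref: "is_ref a D P0 Z" and N: "N = M + Gam + diagm m d" 
    and inv: "(norm (N - P * N - (M + D - P0 * (M + D))))\<^sup>2 \<le> g\<^sup>2 * (4 - 2 * (9 / 16) ^ t)"
        "norm (P * N - P0 * (M + D)) \<le> 8 * (3 / 2) ^ t * g"
    using tracked P unfolding tracked_def a_def by blast
  note r = refD[OF ref]
  define N0 where "N0 = M + D"
  define X0 where "X0 = P0 * N0"
  define R0 where "R0 = N0 - X0"
  define D' where "D' = diagp (X0 - M)"
  have sN0: "supp_in m m N0" unfolding N0_def by (rule supp_in_add[OF supp_M r(8)])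
  have sX0M: "supp_in m m (X0 - M)" unfolding X0_def by (rule supp_in_diff[OF supp_in_mult[OF r(2) sN0] supp_M])
  have D'dg: "D' = diagm m (\<lambda>i. ent (X0 - M) i i)" unfolding D'_def by (rule diagp_eq_diagm[OF sX0M])
  have "\<bar>ent (X0 - M) i i\<bar> \<le> a'" if "i < m" for i
    using ref_contract[OF ref a(1) that] by (simp add: X0_def N0_def a(4))
  then obtain P0' Z' where ref': "is_ref a' D' P0' Z'" 
    unfolding D'dg using ref_exists[of "\<lambda>i. ent (X0 - M) i i" a'] a by force
  define N0' where "N0' = M + D'"
  define X0' where "X0' = P0' * N0'"
  define R0' where "R0' = N0' - X0'"
  define R where "R = N - P * N"
  have bound: "(norm (N' - P' * N' - R0'))\<^sup>2 \<le> g\<^sup>2 * (4 - 2 * (9 / 16) ^ Suc t) \<and>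
     norm (P' * N' - X0') \<le> 8 * (3 / 2) ^ Suc t * g" if P': "best_proj N' P'" for P'
  proof -
    note st = perturb_step[OF ref N0_def X0_def R0_def ref' D'_def N0'_def X0'_def R0'_def a(1,2) P R_def 
        N'[folded R_def] P']
    have "a \<le> 1 / 10000 * (1 / 4) ^ t" by (simp add: a_def)
    note iv = invariant_step[OF norm_ge_zero norm_ge_zero norm_ge_zero norm_ge_zero g r(15) this _ _ st]
    show ?thesis using iv inv by (simp add: R_def R0_def X0_def N0_def)
  qed
  obtain A C where A: "supp_in m K A" "P = A * C" using P unfolding best_proj_def by blast
  have sN: "supp_in m m N" unfolding N by (intro supp_in_add supp_M Gam supp_in_diagm)
  obtain n where n: "supp_in n n (C * N)" using ex_supp by blast
  have sPN: "supp_in m n (P * N)" unfolding A(2) mult.assoc by (rule supp_in_mult[OF A(1) n])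
  have "supp_in m (max m n) (N - P * N)" 
    by (rule supp_in_diff[OF supp_in_mono[OF sN] supp_in_mono[OF sPN]]) auto
  then have "N' = M + Gam + diagm m (\<lambda>i. d i - ent (N - P * N) i i)"
    unfolding N' diagp_eq_diagm[OF \<open>supp_in m (max m n) (N - P * N)\<close>] diagm_diff_diagm[symmetric] by (simp add: N)
  then have form: "\<exists>d. N' = M + Gam + diagm m d" by blast
  show ?thesis unfolding tracked_def
    using ref' form bound unfolding a'_def N0'_def X0'_def R0'_def by blast
qed

text \<open>The noiseless residual has operator norm at most r = 2a, and 5 * 2a is 4^-t /
  1000.\<close>

lemma tracked_final:
  assumes tracked: "tracked Gam g t N" and Gam: "supp_in m m Gam" "norm Gam \<le> g" and P: "best_proj N P" "supp_in m m P"
  shows "norm (V - P * V) \<le> 4 * g + (1 / 4) ^ t * sqrt (real K)"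
proof -
  define a where "a = 1 / 10000 * (1 / 4 :: real) ^ t"
  have g: "0 \<le> g" using Gam(2) norm_ge_zero order_trans by blast
  obtain D P0 Z d where ref: "is_ref a D P0 Z" and N: "N = M + Gam + diagm m d" 
    and inv: "(norm (N - P * N - (M + D - P0 * (M + D))))\<^sup>2 \<le> g\<^sup>2 * (4 - 2 * (9 / 16) ^ t)"
    using tracked P unfolding tracked_def a_def by blast
  note r = refD[OF ref]
  define R0 where "R0 = M + D - P0 * (M + D)"
  have sN0: "supp_in m m (M + D)" by (rule supp_in_add[OF supp_M r(8)])
  have "(norm (N - P * N - R0))\<^sup>2 \<le> g\<^sup>2 * 4"
    unfolding R0_def by (rule order_trans[OF inv mult_left_mono]) auto
  then have "(norm (N - P * N - R0))\<^sup>2 \<le> (2 * g)\<^sup>2" by simp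
  then have R: "norm (N - P * N - R0) \<le> 2 * g" by (rule power2_le_imp_le) (use g in simp)
  have pP: "proj P" "(norm P)\<^sup>2 \<le> real K" using P(1) unfolding best_proj_def by auto
  have opR0: "opnorm_le R0 (2 * a)" unfolding R0_def by (rule r(6))
  have sR0: "supp_in m m R0" unfolding R0_def by (rule supp_in_diff[OF sN0 supp_in_mult[OF r(2) sN0]])
  have "norm (V - P * V) \<le> 4 * g + 5 * (2 * a) * sqrt (real K)"
    by (rule final_bound[OF pP(1) P(2) pP(2) N Gam opR0 sR0 R])
  also have "5 * (2 * a) * sqrt (real K) \<le> (1 / 4) ^ t * sqrt (real K)"
    by (rule mult_right_mono) (auto simp: a_def)
  finally show ?thesis by simp
qed

end

section \<open>Transfer to matrices with carriers\<close>

definition of_vec :: "real vec \<Rightarrow> fmat" where "of_vec v = mk_fmat (dim_vec v) 1 (\<lambda>i _. v $ i)"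

lemma ent_of_vec: "v \<in> carrier_vec m \<Longrightarrow> ent (of_vec v) i j = (if i < m \<and> j = 0 then v $ i else 0)"
  by (auto simp: of_vec_def ent_mk_fmat)

lemma supp_in_of_vec: "v \<in> carrier_vec m \<Longrightarrow> supp_in m 1 (of_vec v)"
  by (auto simp: of_vec_def supp_in_mk_fmat)

lemma of_mat_mult_unit_col: "A \<in> carrier_mat m n \<Longrightarrow> j < n \<Longrightarrow> of_mat A * unit_col j = of_vec (col A j)"
  by (rule fmat_eqI) (auto simp: ent_mult_unit_col ent_of_mat[of A m n] ent_of_vec[of "col A j" m])

lemma of_mat_mult_of_vec:
  assumes "A \<in> carrier_mat m n" "v \<in> carrier_vec n" shows "of_mat A * of_vec v = of_vec (A *\<^sub>v v)"
proof (rule fmat_eqI)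
  fix i j
  have Av: "A *\<^sub>v v \<in> carrier_vec m" using assms by simp
  show "ent (of_mat A * of_vec v) i j = ent (of_vec (A *\<^sub>v v)) i j"
    using assms unfolding ent_mult[OF supp_in_of_mat[OF assms(1)]] ent_of_vec[OF Av]
    by (auto simp: ent_of_mat[OF assms(1)] ent_of_vec[OF assms(2)] scalar_prod_def atLeast0LessThan intro!: sum.cong)
qed

lemma norm_of_vec_sq: assumes "v \<in> carrier_vec m" shows "(norm (of_vec v))\<^sup>2 = v \<bullet> v"
proof -
  have "(norm (of_vec v))\<^sup>2 = (\<Sum>i<m. \<Sum>j<1. (ent (of_vec v) i j)\<^sup>2)" by (rule norm_sq_eq_sum[OF supp_in_of_vec[OF assms]])
  also have "\<dots> = (\<Sum>i<m. v $ i * v $ i)"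
    by (intro sum.cong refl) (simp add: ent_of_vec[OF assms] power2_eq_square One_nat_def)
  finally show ?thesis using assms by (simp add: scalar_prod_def atLeast0LessThan)
qed

lemma frob_norm_eq: "frob_norm A = norm (of_mat A)"
proof -
  have A: "A \<in> carrier_mat (dim_row A) (dim_col A)" by simp
  have "(norm (of_mat A))\<^sup>2 = (\<Sum>i<dim_row A. \<Sum>j<dim_col A. (A $$ (i, j))\<^sup>2)"
    unfolding norm_sq_eq_sum[OF supp_in_of_mat[OF A]] by (intro sum.cong refl) (simp add: ent_of_mat[OF A])
  then show ?thesis unfolding frob_norm_def by (metis norm_ge_zero real_sqrt_unique)
qed

text \<open>A maximal independent subset of the columns has as many elements as the rank, and a
  column outside its span could be added to it. The linear combinations are then carried over to
  \<open>fmat\<close>.\<close>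

lemma ex_col_basis:
  assumes M: "(M :: real mat) \<in> carrier_mat m n"
  shows "\<exists>U. finite U \<and> card U = vec_space.rank m M \<and> (\<forall>j<n. of_vec (col M j) \<in> span (of_vec ` U))"
proof -
  interpret vec_space "TYPE(real)" m .
  have C: "set (cols M) \<subseteq> carrier_vec m" using cols_dim[of M] M by auto
  obtain U where U: "maximal U (\<lambda>T. T \<subseteq> set (cols M) \<and> lin_indpt T)" 
    using maximal_exists_superset[of "set (cols M)" "\<lambda>T. T \<subseteq> set (cols M) \<and> lin_indpt T" "{}"] 
    by (auto simp: lin_dep_def)
  then have Usub: "U \<subseteq> set (cols M)" and Uli: "lin_indpt U" by (auto simp: maximal_def)
  have fU: "finite U" using Usub finite_subset by blast
  have Uc: "U \<subseteq> carrier_vec m" using Usub C by blast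
  have rank: "vec_space.rank m M = card U" by (rule rank_card_indpt[OF M U])
  have in_span: "v \<in> LinearCombinations.module.span class_ring (module_vec TYPE(real) m) U" if v: "v \<in> set (cols M)" for v
  proof (rule ccontr)
    assume ns: "\<not> ?thesis"
    have vc: "v \<in> carrier_vec m" using v C by blast
    have "v \<notin> U" using ns Uc span_mem by auto
    have "lin_indpt (U \<union> {v})" using ns lin_dep_iff_in_span[of U v] Uc Uli vc \<open>v \<notin> U\<close> by auto
    then show False using U v \<open>v \<notin> U\<close> Usub unfolding maximal_def by blast
  qed
  have "of_vec v \<in> Real_Vector_Spaces.span (of_vec ` U)" if v: "v \<in> set (cols M)" for v
  proof -
    from in_span[OF v] obtain a A where A: "finite A" "A \<subseteq> U" "v = lincomb a A" 
      unfolding span_def by blast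
    have Ac: "A \<subseteq> carrier_vec m" using A Uc by blast
    have vc: "v \<in> carrier_vec m" using v C by blast
    have "of_vec v = (\<Sum>x\<in>A. a x *\<^sub>R of_vec x)"
    proof (rule fmat_eqI)
      fix i j
      have "ent (\<Sum>x\<in>A. a x *\<^sub>R of_vec x) i j = (\<Sum>x\<in>A. a x * (if i < m \<and> j = 0 then x $ i else 0))"
        unfolding ent_sum by (intro sum.cong refl) (use Ac in \<open>auto simp: ent_of_vec\<close>)
      moreover have "v $ i = (\<Sum>x\<in>A. a x * x $ i)" if "i < m" 
        using lincomb_index[OF that Ac, of a] A(3) by simp
      ultimately show "ent (of_vec v) i j = ent (\<Sum>x\<in>A. a x *\<^sub>R of_vec x) i j"
        unfolding ent_of_vec[OF vc] by auto
    qed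
    also have "\<dots> \<in> Real_Vector_Spaces.span (of_vec ` U)"
      using A(2) by (intro span_sum span_scale span_base) auto
    finally show ?thesis .
  qed
  then have "\<forall>j<n. of_vec (col M j) \<in> Real_Vector_Spaces.span (of_vec ` U)" 
    using M by (metis carrier_matD(2) cols_length cols_nth nth_mem)
  with fU rank show ?thesis by auto
qed

text \<open>If B, the difference of the two sides, were nonzero, some column y of B would be a
  nonzero vector in the range of M, orthogonal to all columns of V. These columns lie in that range
  too, their eigenvalues being nonzero, which makes K + 1 independent vectors in a space of
  dimension K.\<close>

lemma eigen_decomposition_of_rank:
  assumes M: "M \<in> carrier_mat m m" "transpose_mat M = M" and rank: "vec_space.rank m M = K"
    and V: "V \<in> carrier_mat m K" "orthonormal_cols V"
    and ev: "\<And>i. i < K \<Longrightarrow> M *\<^sub>v col V i = l i \<cdot>\<^sub>v col V i" and l: "\<And>i. i < K \<Longrightarrow> l i \<noteq> 0"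
  shows "of_mat M = of_mat V * diagm K l * adj (of_mat V)"
proof (rule ccontr)
  define A where "A = of_mat M"
  define W where "W = of_mat V"
  have sA: "supp_in m m A" and sW: "supp_in m K W" using M V by (auto simp: A_def W_def supp_in_of_mat)
  have trA: "adj A = A" using M(2) by (simp add: A_def of_mat_transpose[symmetric])
  have WW: "adj W * W = idm K"
    using V unfolding W_def orthonormal_cols_def of_mat_transpose[symmetric]
    by (metis carrier_matD(2) of_mat_mult of_mat_one transpose_carrier_mat)
  have AW: "A * (W * unit_col i) = l i *\<^sub>R (W * unit_col i)" if "i < K" for i
  proof -
    have c: "col V i \<in> carrier_vec m" by (rule col_carrier_vec[OF that V(1)])
    have "A * (W * unit_col i) = of_vec (l i \<cdot>\<^sub>v col V i)" 
      using that V(1) M(1) ev[OF that] c by (simp add: A_def W_def of_mat_mult_unit_col of_mat_mult_of_vec)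
    also have "\<dots> = l i *\<^sub>R of_vec (col V i)" 
      using c V(1) by (intro fmat_eqI) (auto simp: ent_of_vec[of _ m])
    finally show ?thesis using that V(1) by (simp add: W_def of_mat_mult_unit_col)
  qed
  have AWl: "A * W = W * diagm K l"
    by (rule fmat_eqI_cols[OF supp_in_mult[OF sA sW] supp_in_mult[OF sW supp_in_diagm]])
      (simp add: mult.assoc AW diagm_mult_unit_col)
  define B where "B = A - W * diagm K l * adj W"
  assume "of_mat M \<noteq> of_mat V * diagm K l * adj (of_mat V)"
  then have "B \<noteq> 0" by (simp add: B_def A_def W_def)
  have sB: "supp_in m m B" unfolding B_def 
    by (rule supp_in_diff[OF sA supp_in_mult[OF supp_in_mult[OF sW supp_in_diagm] supp_in_adj[OF sW]]])
  have BW: "B * W = 0" 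
    by (simp add: B_def left_diff_distrib AWl mult.assoc WW mult_idm[OF supp_in_diagm])
  have trB: "adj B = B" by (simp add: B_def adj_diff trA adj_mult mult.assoc)
  have WB: "adj W * B = 0" using BW trB by (metis adj_mult adj_zero)
  obtain j where j: "j < m" "B * unit_col j \<noteq> 0"
  proof -
    have "\<exists>j<m. B * unit_col j \<noteq> 0"
    proof (rule ccontr)
      assume "\<not> ?thesis"
      then have "B = 0" by (intro fmat_eqI_cols[OF sB supp_in_0]) auto
      with \<open>B \<noteq> 0\<close> show False by simp
    qed
    then show thesis using that by blast
  qed
  define y where "y = B * unit_col j"
  \<comment> \<open>Writing y as an image under A is what places it in the column space.\<close>
  have y_eq: "y = A * (unit_col j - W * (adj W * unit_col j))"
    by (simp add: y_def B_def algebra_simps AWl[symmetric])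
  obtain U where U: "finite U" "card U = K" "\<forall>j<m. of_vec (col M j) \<in> span (of_vec ` U)"
    using ex_col_basis[OF M(1)] rank by auto
  have in_span: "A * x \<in> span (of_vec ` U)" if "supp_in m 1 x" for x
  proof -
    note eq = vec_expand[OF that]
    have "A * x = (\<Sum>i<m. ent x i 0 *\<^sub>R (A * unit_col i))" by (subst eq) (simp add: sum_distrib_left)
    also have "\<dots> \<in> span (of_vec ` U)"
      using U(3) M(1) by (intro span_sum span_scale) (simp add: A_def of_mat_mult_unit_col)
    finally show ?thesis .
  qed
  have sWe: "supp_in m 1 (W * unit_col i)" if "i < K" for i by (rule supp_in_mult[OF sW supp_in_unit_col[OF that]])
  define f where "f i = (if i < K then W * unit_col i else y)" for i
  have inner_W: "inner (W * unit_col i) (W * unit_col k) = (if i = k then 1 else 0)" if "i < K" "k < K" for i k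
  proof -
    have "inner (W * unit_col i) (W * unit_col k) = inner (unit_col i) (adj W * W * unit_col k)"
      by (simp add: inner_mult_left mult.assoc)
    then show ?thesis using that by (simp add: WW idm_eq_diagm diagm_mult_unit_col inner_unit_col_unit_col)
  qed
  have inner_y: "inner (W * unit_col i) y = 0" for i
    by (simp add: inner_mult_left y_def mult.assoc[symmetric] WB)
  have "card {..<Suc K} \<le> card (of_vec ` U)"
  proof (rule dim_bound)
    show "f i \<in> span (of_vec ` U)" if "i \<in> {..<Suc K}" for i
    proof (cases "i < K")
      case True
      have "f i = (1 / l i) *\<^sub>R (A * (W * unit_col i))" using True l[OF True] by (simp add: AW f_def)
      then show ?thesis using in_span[OF sWe[OF True]] by (simp add: span_scale)
    next
      case False
      have "supp_in m 1 (unit_col j - W * (adj W * unit_col j))"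
        by (rule supp_in_diff[OF supp_in_unit_col[OF j(1)] 
              supp_in_mult[OF sW supp_in_mult[OF supp_in_adj[OF sW] supp_in_unit_col[OF j(1)]]]])
      then show ?thesis using False in_span by (simp add: f_def y_eq)
    qed
    fix c k assume 0: "(\<Sum>i<Suc K. c i *\<^sub>R f i) = 0" and k: "k \<in> {..<Suc K}"
    have sum: "(\<Sum>i<K. c i *\<^sub>R (W * unit_col i)) + c K *\<^sub>R y = 0" using 0 by (simp add: f_def)
    show "c k = 0"
    proof (cases "k < K")
      case True
      have "(\<Sum>i<K. c i * (if k = i then 1 else 0)) = inner (W * unit_col k) ((\<Sum>i<K. c i *\<^sub>R (W * unit_col i)) + c K *\<^sub>R y)"
        unfolding inner_add_right inner_sum_right inner_scaleR_right inner_y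
        using inner_W[OF True] by simp
      also have "(\<Sum>i<K. c i * (if k = i then 1 else 0)) = (\<Sum>i<K. if i = k then c k else 0)" 
        by (intro sum.cong) auto
      finally show ?thesis using True by (simp add: sum)
    next
      case False
      then have k: "k = K" using k by simp
      have "inner y ((\<Sum>i<K. c i *\<^sub>R (W * unit_col i)) + c K *\<^sub>R y) = c K * inner y y"
        unfolding inner_add_right inner_sum_right inner_scaleR_right using inner_y by (simp add: inner_commute)
      then show ?thesis using j(2) by (simp add: sum k y_def[symmetric])
    qed
  qed (auto simp: U)
  also have "\<dots> \<le> K" using card_image_le[OF U(1), of of_vec] U(2) by simp
  finally show False by simp
qed

lemma of_mat_svd_sum:
  assumes U: "U \<in> carrier_mat m m" and W: "W \<in> carrier_mat m m" and "r \<le> m"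
  shows "of_mat (svd_sum r U s W) = of_mat U * diagm m (\<lambda>k. if k < r then s k else 0) * adj (of_mat W)"
proof (rule fmat_eqI)
  fix i j
  define f where "f k = (if k < r then s k else 0)" for k
  have c: "svd_sum r U s W \<in> carrier_mat m m" using U W by (simp add: svd_sum_def)
  have sU: "supp_in m m (of_mat U * diagm m f)" by (rule supp_in_mult[OF supp_in_of_mat[OF U] supp_in_diagm])
  have "ent (of_mat U * diagm m f * adj (of_mat W)) i j = (\<Sum>k<m. ent (of_mat U) i k * f k * ent (of_mat W) j k)"
    unfolding ent_mult[OF sU] by (intro sum.cong refl) (simp add: ent_mult_diagm)
  also have "\<dots> = (\<Sum>k<r. s k * ent (of_mat U) i k * ent (of_mat W) j k)"
    using \<open>r \<le> m\<close> by (intro sum.mono_neutral_cong_right) (auto simp: f_def)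
  also have "\<dots> = ent (of_mat (svd_sum r U s W)) i j"
    unfolding ent_of_mat[OF c] ent_of_mat[OF U] ent_of_mat[OF W] 
    using U W \<open>r \<le> m\<close> by (auto simp: svd_sum_def intro!: sum.cong)
  finally show "ent (of_mat (svd_sum r U s W)) i j 
    = ent (of_mat U * diagm m (\<lambda>k. if k < r then s k else 0) * adj (of_mat W)) i j" by (simp add: f_def[abs_def])
qed

lemma of_mat_orthogonal:
  assumes "U \<in> carrier_mat m m" "orthogonal_matrix U"
  shows "adj (of_mat U) * of_mat U = idm m" "of_mat U * adj (of_mat U) = idm m"
proof -
  have 1: "transpose_mat U * U = 1\<^sub>m m" using assms by (simp add: orthogonal_matrix_def orthonormal_cols_def)
  then have 2: "U * transpose_mat U = 1\<^sub>m m" 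
    using assms(1) mat_mult_left_right_inverse[of "transpose_mat U" m U] by simp
  show "adj (of_mat U) * of_mat U = idm m" "of_mat U * adj (of_mat U) = idm m"
    using 1 2 assms(1) unfolding of_mat_transpose[symmetric] 
    by (metis of_mat_mult of_mat_one transpose_carrier_mat)+
qed

lemma off_diag_index: "A \<in> carrier_mat m m \<Longrightarrow> i < m \<Longrightarrow> j < m \<Longrightarrow> 
    off_diag A $$ (i, j) = (if i = j then 0 else A $$ (i, j))"
  by (auto simp: off_diag_def diag_part_def)

lemma off_diag_carrier: "A \<in> carrier_mat m m \<Longrightarrow> off_diag A \<in> carrier_mat m m"
  by (auto simp: off_diag_def diag_part_def)

lemma hetero_iterate_off_diag:
  assumes S: "S \<in> carrier_mat m m" and "hetero_iterate S r t N"
  shows "N \<in> carrier_mat m m \<and> (\<forall>i<m. \<forall>j<m. i \<noteq> j \<longrightarrow> N $$ (i, j) = S $$ (i, j))"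
  using assms(2) by (induction) (use S in auto)

lemma sum_split_add: 
  fixes h :: "nat \<Rightarrow> real"
  shows "(\<Sum>k<a + b. h k) = (\<Sum>k<a. h k) + (\<Sum>k<b. h (a + k))"
  by (induction b) auto

text \<open>Orthogonality of the completed matrix gives Vp Vp^T = I - Vh Vh^T for every completion,
  so the squared norm of Vp^T V is the pairing of V with (I - P)V.\<close>

lemma sin_theta_norm:
  assumes Vh: "Vh \<in> carrier_mat m K" and V: "V \<in> carrier_mat m n" and S: "S \<in> sin_theta Vh V"
    and K: "K \<le> m" and P: "proj (of_mat Vh * adj (of_mat Vh))"
  shows "frob_norm S = norm (of_mat V - of_mat Vh * adj (of_mat Vh) * of_mat V)"
proof -
  obtain Vp where S: "S = transpose_mat Vp * V" and Vp: "Vp \<in> carrier_mat m (m - K)"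
    and orth: "orthogonal_matrix (mat_of_cols m (cols Vh @ cols Vp))"
    using S Vh unfolding sin_theta_def by auto
  define Q where "Q = mat_of_cols m (cols Vh @ cols Vp)"
  have Q: "Q \<in> carrier_mat m m" using Vh Vp K by (simp add: Q_def mat_of_cols_def)
  have Qi: "Q $$ (i, k) = (if k < K then Vh $$ (i, k) else Vp $$ (i, k - K))" if "i < m" "k < m" for i k
    using that Vh Vp K by (auto simp: Q_def mat_of_cols_def nth_append)
  have QQ: "of_mat Q * adj (of_mat Q) = idm m" using of_mat_orthogonal(2)[OF Q] orth by (simp add: Q_def)
  have sum: "of_mat Vh * adj (of_mat Vh) + of_mat Vp * adj (of_mat Vp) = idm m"
  proof (rule fmat_eqI)
    fix i j
    have "ent (of_mat Q * adj (of_mat Q)) i j = (\<Sum>k<m. ent (of_mat Q) i k * ent (of_mat Q) j k)"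
      unfolding ent_mult[OF supp_in_of_mat[OF Q]] by simp
    also have "\<dots> = (\<Sum>k<K + (m - K). ent (of_mat Q) i k * ent (of_mat Q) j k)" using K by simp
    also have "\<dots> = (\<Sum>k<K. ent (of_mat Q) i k * ent (of_mat Q) j k) + (\<Sum>k<m - K. ent (of_mat Q) i (K + k) * ent (of_mat Q) j (K + k))"
      by (rule sum_split_add)
    also have "(\<Sum>k<K. ent (of_mat Q) i k * ent (of_mat Q) j k) = ent (of_mat Vh * adj (of_mat Vh)) i j"
      unfolding ent_mult[OF supp_in_of_mat[OF Vh]] using K
      by (intro sum.cong refl) (auto simp: ent_of_mat[OF Q] ent_of_mat[OF Vh] Qi)
    also have "(\<Sum>k<m - K. ent (of_mat Q) i (K + k) * ent (of_mat Q) j (K + k)) = ent (of_mat Vp * adj (of_mat Vp)) i j"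
      unfolding ent_mult[OF supp_in_of_mat[OF Vp]] using K
      by (intro sum.cong refl) (auto simp: ent_of_mat[OF Q] ent_of_mat[OF Vp] Qi)
    finally show "ent (of_mat Vh * adj (of_mat Vh) + of_mat Vp * adj (of_mat Vp)) i j = ent (idm m) i j" by (simp add: QQ)
  qed
  define P where "P = of_mat Vh * adj (of_mat Vh)"
  have pp: "of_mat Vp * adj (of_mat Vp) = idm m - P" using sum by (simp add: P_def algebra_simps)
  have "of_mat S = adj (of_mat Vp) * of_mat V" using S Vp V by (simp add: of_mat_mult[of _ "m - K" m _ n] of_mat_transpose)
  then have "(frob_norm S)\<^sup>2 = inner (of_mat V) (of_mat Vp * adj (of_mat Vp) * of_mat V)"
    by (simp add: frob_norm_eq power2_norm_eq_inner inner_mult_left mult.assoc)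
  also have "\<dots> = inner (of_mat V) (of_mat V - P * of_mat V)"
    unfolding pp by (simp add: left_diff_distrib idm_mult[OF supp_in_of_mat[OF V]])
  also have "\<dots> = (norm (of_mat V))\<^sup>2 - (norm (P * of_mat V))\<^sup>2"
  proof -
    have "inner (of_mat V) (P * of_mat V) = inner (P * of_mat V) (P * of_mat V)"
      using assms(5) by (simp add: inner_mult_left projD P_def[symmetric])
    then show ?thesis by (simp add: inner_diff_right power2_norm_eq_inner)
  qed
  also have "\<dots> = (norm (of_mat V - P * of_mat V))\<^sup>2"
    using proj_pythagoras[of P "of_mat V"] assms(5) by (simp add: P_def)
  finally show ?thesis by (simp add: P_def frob_norm_eq)
qed

lemma of_mat_mat_of_cols:
  assumes U: "U \<in> carrier_mat m m" and K: "K \<le> m"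
  shows "of_mat (mat_of_cols m (map (col U) [0..<K])) = of_mat U * diagm m (\<lambda>k. if k < K then 1 else 0)"
  by (rule fmat_eqI) (use U K in \<open>auto simp: of_mat_def ent_mk_fmat ent_mult_diagm mat_of_cols_def\<close>)

lemma is_svd_of_mat:
  assumes "is_svd m N U s W"
  shows "U \<in> carrier_mat m m" "W \<in> carrier_mat m m" 
    "adj (of_mat U) * of_mat U = idm m" "of_mat U * adj (of_mat U) = idm m" "adj (of_mat W) * of_mat W = idm m"
    "\<And>k. k < m \<Longrightarrow> 0 \<le> s k" "\<And>k l. k \<le> l \<Longrightarrow> l < m \<Longrightarrow> s l \<le> s k"
    "of_mat N = of_mat U * diagm m s * adj (of_mat W)"
proof -
  show U: "U \<in> carrier_mat m m" and W: "W \<in> carrier_mat m m"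
    and "\<And>k. k < m \<Longrightarrow> 0 \<le> s k" "\<And>k l. k \<le> l \<Longrightarrow> l < m \<Longrightarrow> s l \<le> s k"
    using assms unfolding is_svd_def by blast+
  show "adj (of_mat U) * of_mat U = idm m" "of_mat U * adj (of_mat U) = idm m" "adj (of_mat W) * of_mat W = idm m"
    using assms of_mat_orthogonal unfolding is_svd_def by blast+
  have "diagm m (\<lambda>k. if k < m then s k else 0) = diagm m s" by (rule fmat_eqI) (auto simp: ent_diagm)
  then show "of_mat N = of_mat U * diagm m s * adj (of_mat W)"
    using assms of_mat_svd_sum[OF U W, of m s] unfolding is_svd_def by simp
qed

section \<open>The projection onto the leading left singular vectors\<close>

definition top_proj :: "nat \<Rightarrow> nat \<Rightarrow> real mat \<Rightarrow> fmat" where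
  "top_proj m K U = of_mat U * diagm m (\<lambda>k. if k < K then 1 else 0) * adj (of_mat U)"

text \<open>Turns the truncated decomposition into a left multiplication by a projection, the form
  in which optimality is stated.\<close>

lemma top_proj_mult:
  assumes "is_svd m N U s W" "K \<le> m"
  shows "top_proj m K U * of_mat N = of_mat (svd_sum K U s W)"
proof -
  note sv = is_svd_of_mat[OF assms(1)]
  have "top_proj m K U * of_mat N = of_mat U * diagm m (\<lambda>k. if k < K then 1 else 0) * (adj (of_mat U) * of_mat U) * diagm m s * adj (of_mat W)"
    by (simp add: top_proj_def sv(8) mult.assoc)
  also have "\<dots> = of_mat U * (diagm m (\<lambda>k. if k < K then 1 else 0) * diagm m s) * adj (of_mat W)"
    unfolding sv(3) by (simp add: mult.assoc) (simp add: mult.assoc[symmetric] mult_idm[OF supp_in_diagm])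
  also have "diagm m (\<lambda>k. if k < K then 1 else 0) * diagm m s = diagm m (\<lambda>k. if k < K then s k else 0)"
    unfolding diagm_mult_diagm by (rule fmat_eqI) (auto simp: ent_diagm)
  finally show ?thesis by (simp add: of_mat_svd_sum[OF sv(1,2) assms(2)])
qed

lemma supp_top_proj:
  assumes "is_svd m N U s W" shows "supp_in m m (top_proj m K U)"
  unfolding top_proj_def using supp_in_of_mat[OF is_svd_of_mat(1)[OF assms]]
  by (intro supp_in_mult[OF supp_in_mult[OF _ supp_in_diagm] supp_in_adj])

text \<open>The run itself is not rescaled, while the estimates assume smallest eigenvalue 1.
  Optimality of a projection is unaffected by the factor \<open>c\<close>, so it holds for the
  scaled iterates.\<close>

lemma (in incoherent) best_proj_top_proj:
  assumes sv: "is_svd m N U s W" and K: "K \<le> m" and c: "0 \<le> c"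
  shows "best_proj (c *\<^sub>R of_mat N) (top_proj m K U)"
proof -
  note f = is_svd_of_mat[OF sv]
  define J where "J = diagm m (\<lambda>k. if k < K then 1 else (0::real))"
  have JJ: "J * J = J" unfolding J_def diagm_mult_diagm by (rule fmat_eqI) (auto simp: ent_diagm)
  have sJ: "supp_in m m J" by (simp add: J_def supp_in_diagm)
  have P: "top_proj m K U = of_mat U * J * adj (of_mat U)" by (simp add: top_proj_def J_def)
  have "of_mat U * J * adj (of_mat U) * (of_mat U * J * adj (of_mat U)) = of_mat U * (J * (adj (of_mat U) * of_mat U) * J) * adj (of_mat U)" 
    by (simp add: mult.assoc)
  also have "\<dots> = of_mat U * J * adj (of_mat U)" by (simp add: f(3) mult_idm[OF sJ] JJ)
  finally have pP: "proj (top_proj m K U)" unfolding proj_def P by (simp add: adj_mult mult.assoc J_def)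
  have opU: "opnorm_le (of_mat U) 1" by (rule opnorm_le_isometry[OF f(3)])
  have "norm (top_proj m K U) \<le> norm J"
    using opbD[OF opU, of "J * adj (of_mat U)"] opnorm_le_right[OF opnorm_le_adj[OF opU], of J] by (simp add: P mult.assoc)
  then have "(norm (top_proj m K U))\<^sup>2 \<le> (norm J)\<^sup>2" by (rule power_mono) simp
  also have "\<dots> = (\<Sum>k<m. if k < K then 1 else 0)" unfolding J_def norm_diagm_sq by (rule sum.cong) auto
  also have "\<dots> = (\<Sum>k<K. 1)" using K by (intro sum.mono_neutral_cong_right) auto
  finally have nP: "(norm (top_proj m K U))\<^sup>2 \<le> real K" by simp
  have "supp_in m K (of_mat U * J)"
    unfolding supp_in_def using supp_inD[OF supp_in_of_mat[OF f(1)]] 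
    by (auto simp: J_def ent_mult_diagm not_less[symmetric] split: if_splits)
  moreover have "norm (c *\<^sub>R of_mat N - top_proj m K U * c *\<^sub>R of_mat N) \<le> norm (c *\<^sub>R of_mat N - Q * c *\<^sub>R of_mat N)"
    if Q: "proj Q" "(norm Q)\<^sup>2 \<le> real K" for Q
  proof -
    have "norm (of_mat N - top_proj m K U * of_mat N) \<le> norm (of_mat N - Q * of_mat N)"
      by (rule eckart_young[OF supp_in_of_mat[OF f(1)] f(3,4) supp_in_of_mat[OF f(2)] f(5,6,7,8) K top_proj_def Q])
    then have "norm (c *\<^sub>R (of_mat N - top_proj m K U * of_mat N)) \<le> norm (c *\<^sub>R (of_mat N - Q * of_mat N))"
      using c by (simp add: mult_left_mono)
    then show ?thesis by (simp add: scaleR_diff_right)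
  qed
  ultimately show ?thesis unfolding best_proj_def using pP nP P by blast
qed

text \<open>All iterates agree with S off the diagonal, so replacing diagonal entries by those of
  the truncation means subtracting the diagonal of the residual, as \<open>tracked_step\<close>
  expects.\<close>

lemma (in incoherent) tracked_iterate:
  assumes it: "hetero_iterate S K t N" and S: "S \<in> carrier_mat m m" and K: "K \<le> m"
    and eq: "c *\<^sub>R of_mat S - diagp (c *\<^sub>R of_mat S) = M + Gam - diagp M" and c: "0 \<le> c"
    and Gam: "supp_in m m Gam" "norm Gam \<le> g"
  shows "tracked Gam g t (c *\<^sub>R of_mat N)"
  using it
proof (induction)
  case init
  have "of_mat (mat (dim_row S) (dim_row S) (\<lambda>(i, j). if i = j then 0 else S $$ (i, j))) = of_mat S - diagp (of_mat S)"
    using S by (intro fmat_eqI) (auto simp: of_mat_def ent_mk_fmat)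
  moreover have "diagp (c *\<^sub>R of_mat S) = c *\<^sub>R diagp (of_mat S)" by (rule fmat_eqI) auto
  ultimately show ?case using tracked_init[OF Gam(2)] eq by (simp add: scaleR_diff_right)
next
  case (step t N U s W)
  have dS: "dim_row S = m" using S by simp
  have N: "N \<in> carrier_mat m m" "\<And>i j. i < m \<Longrightarrow> j < m \<Longrightarrow> i \<noteq> j \<Longrightarrow> N $$ (i, j) = S $$ (i, j)"
    using hetero_iterate_off_diag[OF S step.hyps(1)] by auto
  have sv: "is_svd m N U s W" using step.hyps(2) dS by simp
  note f = is_svd_of_mat[OF sv]
  define N' where "N' = mat (dim_row S) (dim_row S)
              (\<lambda>(i, j). if i = j then svd_sum K U s W $$ (i, i) else S $$ (i, j))"
  have cX: "svd_sum K U s W \<in> carrier_mat m m" using f(1,2) by (simp add: svd_sum_def)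
  have cN': "N' \<in> carrier_mat m m" by (simp add: N'_def dS)
  have "of_mat N' = of_mat N - diagp (of_mat N - of_mat (svd_sum K U s W))"
    unfolding fmat_eq_iff ent_diff ent_diagp ent_of_mat[OF cN'] ent_of_mat[OF N(1)] ent_of_mat[OF cX]
    using N(2) by (auto simp: N'_def dS)
  moreover have "diagp (c *\<^sub>R A) = c *\<^sub>R diagp A" for A by (rule fmat_eqI) auto
  ultimately have "c *\<^sub>R of_mat N' = c *\<^sub>R of_mat N - diagp (c *\<^sub>R of_mat N - top_proj m K U * c *\<^sub>R of_mat N)"
    by (simp add: top_proj_mult[OF sv K] scaleR_diff_right[symmetric])
  moreover have "0 \<le> g" using Gam(2) norm_ge_zero order_trans by blast
  ultimately have "tracked Gam g (Suc t) (c *\<^sub>R of_mat N')"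
    using tracked_step[OF step.IH Gam(1) _ best_proj_top_proj[OF sv K c]] by blast
  then show ?case by (simp add: N'_def)
qed

lemma hetero_error_bound:
  fixes N M Z V Vh :: "real mat"
  assumes M: "M \<in> carrier_mat m m" and Z: "Z \<in> carrier_mat m m"
    and M_sym: "transpose_mat M = M" and N: "N = M + Z"
    and K: "1 \<le> K" and rank: "vec_space.rank m M = K"
    and mono: "\<forall>i\<in>{1..<K}. eigval M (i + 1) \<le> eigval M i" and pos: "eigval M K > 0"
    and V: "leading_eigenvectors M K V"
    and inc: "Max ((\<lambda>j. (l2_norm (transpose_mat V *\<^sub>v unit_vec m j))\<^sup>2) ` {..<m})
         * (eigval M 1 / eigval M K) \<le> 1 / 10000"
    and T: "ereal (real T) \<ge> ereal 1 * max 1 (log_ratio (sqrt (real K) * eigval M K) (frob_norm (off_diag Z)))"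
    and out: "heteroPCA_output N K T Vh" and S: "S \<in> sin_theta Vh V"
  shows "frob_norm S \<le> 5 * min (frob_norm (off_diag Z) / eigval M K) (sqrt (real K))"
proof -
  define lK where "lK = eigval M K"
  define c where "c = 1 / lK"
  have c: "0 < c" using pos by (simp add: c_def lK_def)
  have Vc: "V \<in> carrier_mat m K" "orthonormal_cols V"
    and ev: "\<And>i. i < K \<Longrightarrow> eigenvector M (col V i) (eigval M (i + 1))"
    using V M unfolding leading_eigenvectors_def by auto
  define W where "W = of_mat V"
  have sW: "supp_in m K W" using Vc by (simp add: W_def supp_in_of_mat)
  have WW: "adj W * W = idm K"
    using Vc unfolding W_def orthonormal_cols_def of_mat_transpose[symmetric]
    by (metis carrier_matD(2) of_mat_mult of_mat_one transpose_carrier_mat)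
  have anti: "eigval M j \<le> eigval M i" if "1 \<le> i" "i \<le> j" "j \<le> K" for i j
    using that(2,3)
  proof (induction j rule: dec_induct)
    case (step n)
    then have "eigval M (n + 1) \<le> eigval M n" using mono that(1) by simp
    then show ?case using step by (simp add: One_nat_def)
  qed simp
  have ge: "lK \<le> eigval M (i + 1)" "eigval M (i + 1) \<le> eigval M 1" if "i < K" for i
    using anti[of "i + 1" K] anti[of 1 "i + 1"] that by (auto simp: lK_def)
  define lam where "lam i = eigval M (i + 1) / lK" for i
  define kap where "kap = eigval M 1 / lK"
  define mu where "mu = Max ((\<lambda>j. (l2_norm (transpose_mat V *\<^sub>v unit_vec m j))\<^sup>2) ` {..<m})"
  have lK: "0 < lK" using pos by (simp add: lK_def)
  have row: "(l2_norm (transpose_mat V *\<^sub>v unit_vec m j))\<^sup>2 = (norm (adj W * unit_col j))\<^sup>2" if "j < m" for j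
  proof -
    have cv: "transpose_mat V *\<^sub>v unit_vec m j \<in> carrier_vec K" using Vc(1) by simp
    have "of_vec (unit_vec m j) = unit_col j" 
      using that by (intro fmat_eqI) (auto simp: ent_of_vec[of _ m] ent_unit_col)
    then have "of_vec (transpose_mat V *\<^sub>v unit_vec m j) = adj W * unit_col j"
      using of_mat_mult_of_vec[of "transpose_mat V" K m "unit_vec m j"] Vc(1) by (simp add: W_def of_mat_transpose)
    then have "(norm (adj W * unit_col j))\<^sup>2 = (transpose_mat V *\<^sub>v unit_vec m j) \<bullet> (transpose_mat V *\<^sub>v unit_vec m j)"
      using norm_of_vec_sq[OF cv] by simp
    moreover then have "0 \<le> (transpose_mat V *\<^sub>v unit_vec m j) \<bullet> (transpose_mat V *\<^sub>v unit_vec m j)"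
      by (metis zero_le_power2)
    ultimately show ?thesis unfolding l2_norm_def by simp
  qed
  have mu_ge: "(norm (adj W * unit_col j))\<^sup>2 \<le> mu" if "j < m" for j
    unfolding row[OF that, symmetric] mu_def using that by (intro Max_ge) auto
  \<comment> \<open>Nonnegativity of \<open>mu\<close> needs at least one row, since the maximum
    over no rows carries no information.\<close>
  have m0: "0 < m"
  proof (rule ccontr)
    assume "\<not> 0 < m"
    then have "W = 0" using sW by (intro fmat_eqI) (auto simp: supp_in_def)
    then have "(norm (idm K))\<^sup>2 = 0" using WW by (metis mult_zero_right norm_zero power_zero_numeral)
    then show False using K norm_idm_sq[of K] by simp
  qed
  interpret inc: incoherent m K W lam kap mu
  proof
    show "1 \<le> lam i" "lam i \<le> kap" if "i < K" for i
      using ge[OF that] lK by (auto simp: lam_def kap_def field_simps divide_right_mono)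
    show "1 \<le> kap" using anti[of 1 K] K lK by (simp add: kap_def lK_def)
    show "0 \<le> mu" using mu_ge[OF m0] zero_le_power2 order_trans by blast
    show "mu * kap \<le> 1 / 10000" using inc by (simp add: mu_def kap_def lK_def)
    show "(norm (adj W * unit_col j))\<^sup>2 \<le> mu" if "j < m" for j by (rule mu_ge[OF that])
  qed (rule sW WW)+
  \<comment> \<open>Comparison of traces: the squared norm of \<open>PV\<close> is K, that of
    \<open>idm m\<close> is m.\<close>
  have Km: "K \<le> m"
  proof -
    have "(norm inc.PV)\<^sup>2 = real K"
    proof -
      have "norm inc.PV = norm (adj W)" unfolding inc.PV_def by (rule inc.norm_V_mult[OF inc.adjV_supp])
      then show ?thesis using inc.norm_V_sq by simp
    qed
    moreover have "norm inc.PV \<le> norm (idm m)"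
      using opbD[OF proj_opnorm_le[OF inc.proj_PV], of "idm m"] by (simp add: mult_idm[OF inc.supp_PV])
    then have "(norm inc.PV)\<^sup>2 \<le> (norm (idm m))\<^sup>2" by (rule power_mono) simp
    ultimately show ?thesis by (simp add: norm_idm_sq)
  qed
  have M_eq: "c *\<^sub>R of_mat M = inc.M"
  proof -
    have "of_mat M = W * diagm K (\<lambda>i. eigval M (i + 1)) * adj W" unfolding W_def
    proof (rule eigen_decomposition_of_rank[OF M M_sym rank Vc])
      show "M *\<^sub>v col V i = eigval M (i + 1) \<cdot>\<^sub>v col V i" if "i < K" for i 
        using ev[OF that] by (simp add: eigenvector_def)
      show "eigval M (i + 1) \<noteq> 0" if "i < K" for i using ge(1)[OF that] lK by simp
    qed
    moreover have "c *\<^sub>R diagm K (\<lambda>i. eigval M (i + 1)) = inc.L"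
      unfolding inc.L_def by (rule fmat_eqI) (auto simp: ent_diagm c_def lam_def)
    ultimately show ?thesis unfolding inc.M_def by (metis mult_scaleR_left mult_scaleR_right)
  qed
  define Gam where "Gam = c *\<^sub>R of_mat (off_diag Z)"
  define g where "g = frob_norm (off_diag Z) / lK"
  have Gam: "supp_in m m Gam" "norm Gam \<le> g"
    using supp_in_scaleR[OF supp_in_of_mat[OF off_diag_carrier[OF Z]]] lK 
    by (auto simp: Gam_def g_def frob_norm_eq c_def)
  have Nc: "N \<in> carrier_mat m m" using M Z by (simp add: N)
  have eq: "c *\<^sub>R of_mat N - diagp (c *\<^sub>R of_mat N) = inc.M + Gam - diagp inc.M"
    unfolding M_eq[symmetric] Gam_def fmat_eq_iff ent_diff ent_add ent_diagp ent_scaleR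
      ent_of_mat[OF Nc] ent_of_mat[OF M] ent_of_mat[OF off_diag_carrier[OF Z]]
    by (auto simp: off_diag_index[OF Z] N carrier_matD[OF M] carrier_matD[OF Z] algebra_simps)
  obtain Nt U s W' where it: "hetero_iterate N K T Nt" and sv: "is_svd m Nt U s W'" 
    and Vh: "Vh = mat_of_cols m (map (col U) [0..<K])"
    using out Nc unfolding heteroPCA_output_def by auto
  note f = is_svd_of_mat[OF sv]
  have fmVh: "of_mat Vh = of_mat U * diagm m (\<lambda>k. if k < K then 1 else 0)" unfolding Vh by (rule of_mat_mat_of_cols[OF f(1) Km])
  have "diagm m (\<lambda>k. if k < K then 1 else 0) * diagm m (\<lambda>k. if k < K then 1 else 0) 
      = diagm m (\<lambda>k. if k < K then 1 else (0::real))" unfolding diagm_mult_diagm by (rule fmat_eqI) (auto simp: ent_diagm)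
  then have P: "of_mat Vh * adj (of_mat Vh) = top_proj m K U"
    unfolding fmVh top_proj_def adj_mult by (simp add: mult.assoc) (simp add: mult.assoc[symmetric])
  have adj: "inc.best_proj (c *\<^sub>R of_mat Nt) (top_proj m K U)" using inc.best_proj_top_proj[OF sv Km] c by simp
  then have pP: "proj (of_mat Vh * adj (of_mat Vh))" by (simp add: P inc.best_proj_def)
  have Vhc: "Vh \<in> carrier_mat m K" by (simp add: Vh mat_of_cols_def)
  have S_eq: "frob_norm S = norm (W - top_proj m K U * W)"
    unfolding W_def P[symmetric] by (rule sin_theta_norm[OF Vhc Vc(1) S Km pP])
  have S1: "frob_norm S \<le> sqrt (real K)"
  proof -
    have "(norm W)\<^sup>2 = real K" by (rule inc.norm_V_sq)
    then have "norm W = sqrt (real K)" by (metis norm_ge_zero real_sqrt_unique)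
    then show ?thesis using proj_compl_le[OF pP, of W] by (simp add: S_eq P)
  qed
  have "inc.tracked Gam g T (c *\<^sub>R of_mat Nt)"
    by (rule inc.tracked_iterate[OF it Nc Km eq _ Gam]) (use c in simp)
  from inc.tracked_final[OF this Gam adj supp_top_proj[OF sv]]
  have S2: "frob_norm S \<le> 4 * g + (1 / 4) ^ T * sqrt (real K)" by (simp add: S_eq)
  define b where "b = frob_norm (off_diag Z)"
  \<comment> \<open>For vanishing off-diagonal noise \<open>log_ratio\<close> is infinite, and no
    finite T meets the hypothesis.\<close>
  have b0: "0 < b"
  proof (rule ccontr)
    assume "\<not> 0 < b"
    then have "b = 0" using norm_ge_zero[of "of_mat (off_diag Z)"] by (simp add: b_def frob_norm_eq)
    then show False using T by (simp add: log_ratio_def b_def[symmetric])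
  qed
  have ln_le: "ln (sqrt (real K) * lK / b) \<le> real T"
  proof -
    have "log_ratio (sqrt (real K) * lK) b \<le> ereal (real T)" 
      using T by (simp add: b_def lK_def)
    then show ?thesis using b0 by (simp add: log_ratio_def)
  qed
  have "0 < sqrt (real K) * lK / b" using K lK b0 by simp
  with ln_le have "sqrt (real K) * lK / b \<le> exp (real T)" by (metis exp_le_cancel_iff exp_ln)
  also have "\<dots> = exp 1 ^ T" by (simp add: exp_of_nat_mult[symmetric])
  \<comment> \<open>The rate 4^-t of the noiseless run is faster than e^-t, so C = 1 is enough to
    bring the remaining term below g.\<close>
  also have "\<dots> \<le> 4 ^ T" using exp_le by (intro power_mono) auto
  finally have "sqrt (real K) \<le> 4 ^ T * g" using lK b0 by (simp add: g_def b_def field_simps)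
  then have "(1 / 4) ^ T * sqrt (real K) \<le> g" by (simp add: power_divide field_simps)
  with S2 have "frob_norm S \<le> 5 * g" by simp
  moreover have "frob_norm S \<le> 5 * sqrt (real K)" using S1 real_sqrt_ge_zero[of "real K"] by linarith
  ultimately show ?thesis by (simp add: g_def lK_def min_def)
qed

theorem theorem13:
  shows "\<exists>c C C' :: real. c > 0 \<and> C > 0 \<and> C' > 0 \<and>
    (\<forall>(m::nat) (K::nat) (N::real mat) (M::real mat) (Z::real mat) (V::real mat)
        (T::nat) (Vh::real mat).
       N \<in> carrier_mat m m \<and> M \<in> carrier_mat m m \<and> Z \<in> carrier_mat m m \<and>
       transpose_mat N = N \<and> transpose_mat M = M \<and> transpose_mat Z = Z \<and>
       N = M + Z \<and>
       1 \<le> K \<and> vec_space.rank m M = K \<and>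
       (\<forall>i\<in>{1..<K}. eigval M (i + 1) \<le> eigval M i) \<and> eigval M K > 0 \<and>
       leading_eigenvectors M K V \<and>
       Max ((\<lambda>j. (l2_norm (transpose_mat V *\<^sub>v unit_vec m j))\<^sup>2) ` {..<m})
         * (eigval M 1 / eigval M K) \<le> c \<and>
       frob_norm (off_diag Z) \<le> c * sqrt (real K) * eigval M K \<and>
       ereal (real T) \<ge>
         ereal C * max 1 (log_ratio (sqrt (real K) * eigval M K) (frob_norm (off_diag Z))) \<and>
       heteroPCA_output N K T Vh
       \<longrightarrow> (\<forall>S \<in> sin_theta Vh V.
             frob_norm S \<le> C' * min (frob_norm (off_diag Z) / eigval M K) (sqrt (real K))))"
\<comment> \<open>c is the incoherence bound of the locale, C = 1 because e <= 4, and C' = 5 is 4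
  from the final estimate plus 1 for the remaining term 4^-T sqrt K.\<close>
proof (rule exI[of _ "1 / 10000"], rule exI[of _ 1], rule exI[of _ 5], intro conjI allI impI ballI)
qed (simp, simp, simp, elim conjE, (rule hetero_error_bound; assumption))

end
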